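(* Let $n\ge1$, let $\psi\in\mathcal{T}_n^0$ with representing measure $\mu$, and let $(\nu_t)_{t\ge0}$ be the convolution semigroup of probability measures on $\mathbb{R}_+^n$ with $\int_{\mathbb{R}_+^n}e^{z\cdot u}\,d\nu_t(u)=e^{t\psi(z)}$ for $z\in(-\infty,0)^n$. Put $$K(\nu_t,\mu):=\sup_{p\in E(\mathbb{R}_+^n),\,\|p\|=1}\left|\int_{\mathbb{R}_+^n}\int_{\mathbb{R}_+^n}p(r)\,d_r(\nu_t(r-u)-\nu_t(r))\,d\mu(u)\right|.$$ Let $\limsup_{t\to0+}tK(\nu_t,\mu)<\infty$. If the map $t\mapsto\nu_t$, $\mathbb{R}_+\to\mathcal{M}^b(\mathbb{R}_+^n)$, is weakly differentiable for $t>0$, then $\psi\in\mathcal{T}_n^Y$ (i.e. for every complex Banach space $X$ and every $n$-tuple $A$ of commuting generators of bounded $C_0$-semigroups on $X$, $\psi(A)$ is the generator of a quasibounded holomorphic semigroup $g(A)$ in $X$).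
   Context: $\mathbb{R}_+=[0,\infty)$. $E(\mathbb{R}_+^n)$ is the space of exponential polynomials $p(r)=\sum_jc_je^{s_j\cdot r}$ (finite sums, $c_j\in\mathbb{C}$, $s_j\in(-\infty,0)^n$) on $\mathbb{R}_+^n$ with the sup norm. $\nu_t(\cdot-u)$ denotes the translate of $\nu_t$ by $u$, so that the inner integral is $\int_{\mathbb{R}_+^n}(p(r+u)-p(r))\,d\nu_t(r)$. $\mathcal{T}_n$ is the set of nonpositive $\psi\in C^\infty((-\infty,0)^n)$ all of whose first partial derivatives are absolutely monotone (nonnegative together with all their partial derivatives of all orders). Every $\psi\in\mathcal{T}_n$ has a representation $\psi(s)=c_0+c_1\cdot s+\int_{\mathbb{R}_+^n\setminus\{0\}}(e^{s\cdot v}-1)\,d\mu(v)$ with $c_0=\lim_{s\to-0}\psi(s)$, $c_1\in\mathbb{R}_+^n$ and a positive measure $\mu$ on $\mathbb{R}_+^n\setminus\{0\}$ (the representing measure, regarded as a measure on $\mathbb{R}_+^n$ with $\mu(\{0\})=0$), all determined by $\psi$. $\mathcal{T}_n^0$ is the subclass with $c_0=0$, $c_1=0$. For $\psi\in\mathcal{T}_n^0$ the measures $\nu_t$ exist, are unique, and form a convolution semigroup with $\nu_0=\delta_0$. $\mathcal{M}^b(\mathbb{R}_+^n)$ is the space of bounded (signed or complex Radon) measures on $\mathbb{R}_+^n$. $\mu=w\lim_k\mu_k$ means $\int f\,d\mu_k\to\int f\,d\mu$ for every bounded continuous $f$ on $\mathbb{R}_+^n$. Weakly differentiable for $t>0$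 means that $w\nu_t'=w\lim_{\Delta t\to0}\frac1{\Delta t}(\nu_{t+\Delta t}-\nu_t)$ exists in $\mathcal{M}^b(\mathbb{R}_+^n)$ for all $t>0$. A bounded $C_0$-semigroup is a strongly continuous one-parameter operator semigroup with uniformly bounded norms. Generators commute if the corresponding semigroups commute. If $A=(A_1,\dots,A_n)$ is an $n$-tuple of commuting generators of bounded $C_0$-semigroups $T_1,\dots,T_n$ on $X$, then $g_t(A)x=\int_{\mathbb{R}_+^n}T_1(u_1)\cdots T_n(u_n)x\,d\nu_t(u)$ defines a bounded $C_0$-semigroup $g(A)$ on $X$, and $\psi(A)$ denotes its generator. A bounded $C_0$-semigroup $U$ with generator $G$ on $X$ satisfies condition (Y), and is then called a quasibounded holomorphic semigroup, if $U(t)X\subset D(G)$ for all $t>0$ and $\limsup_{t\to0+}t\|GU(t)\|<\infty$. $\mathcal{T}_n^Y$ is the set of all $\psi\in\mathcal{T}_n^0$ such that, for every complex Banach space $X$ and every $n$-tuple $A$ of commuting generators of bounded $C_0$-semigroups on $X$, $\psi(A)$ generates a bounded $C_0$-semigroup with property (Y). *)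

theory Defs
  imports "HOL-Probability.Probability"
begin

section \<open>Complex Banach spaces\<close>

class complex_banach = banach +
  fixes scaleC :: "complex \<Rightarrow> 'a \<Rightarrow> 'a"  (infixr \<open>*\<^sub>C\<close> 75)
  assumes scaleC_add_right: "a *\<^sub>C (x + y) = a *\<^sub>C x + a *\<^sub>C y"
    and scaleC_add_left: "(a + b) *\<^sub>C x = a *\<^sub>C x + b *\<^sub>C x"
    and scaleC_scaleC: "a *\<^sub>C (b *\<^sub>C x) = (a * b) *\<^sub>C x"
    and scaleC_of_real: "complex_of_real r *\<^sub>C x = r *\<^sub>R x"
    and norm_scaleC: "norm (a *\<^sub>C x) = cmod a * norm x"

instantiation complex :: complex_banach
begin

definition "scaleC_complex (a :: complex) (x :: complex) = a * x"

instance
  by standard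
    (simp_all add: scaleC_complex_def algebra_simps scaleR_conv_of_real norm_mult)

end

section \<open>Orthants and measures on the closed orthant\<close>

definition orthant :: "(real ^ 'n) set" where
  "orthant = {u. \<forall>i. 0 \<le> u $ i}"

definition neg_orthant :: "(real ^ 'n) set" where
  "neg_orthant = {s. \<forall>i. s $ i < 0}"

text \<open>Measures on the closed orthant are measures whose \<^emph>\<open>space\<close> is the orthant, so that
  integrals against them never see values outside of it.\<close>

definition orthant_borel :: "(real ^ 'n) measure" where
  "orthant_borel = restrict_space borel orthant"

definition orthant_measure :: "(real ^ 'n) measure \<Rightarrow> bool" where
  "orthant_measure M \<longleftrightarrow> space M = orthant \<and> sets M = sets orthant_borel"

section \<open>The classes of Bernstein functions\<close>

text \<open>Functions on the open negative orthant are total functions on the whole space; all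
  conditions below concern their values on the open negative orthant only.\<close>

definition partial :: "'n \<Rightarrow> (real ^ 'n \<Rightarrow> real) \<Rightarrow> real ^ 'n \<Rightarrow> real" where
  "partial i f s = deriv (\<lambda>h. f (s + h *\<^sub>R axis i 1)) 0"

abbreviation partials :: "'n list \<Rightarrow> (real ^ 'n \<Rightarrow> real) \<Rightarrow> real ^ 'n \<Rightarrow> real" where
  "partials is f \<equiv> foldr partial is f"

definition smooth_on :: "(real ^ 'n) set \<Rightarrow> (real ^ 'n \<Rightarrow> real) \<Rightarrow> bool" where
  "smooth_on S f \<longleftrightarrow>
     (\<forall>is. continuous_on S (partials is f) \<and>
       (\<forall>i. \<forall>s\<in>S. (\<lambda>h. partials is f (s + h *\<^sub>R axis i 1)) differentiable (at 0)))"

definition absolutely_monotone :: "(real ^ 'n \<Rightarrow> real) \<Rightarrow> bool" where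
  "absolutely_monotone f \<longleftrightarrow> (\<forall>is. \<forall>s\<in>neg_orthant. 0 \<le> partials is f s)"

definition class_T :: "(real ^ 'n \<Rightarrow> real) set" where
  "class_T = {\<psi>. smooth_on neg_orthant \<psi> \<and> (\<forall>s\<in>neg_orthant. \<psi> s \<le> 0) \<and>
     (\<forall>i. absolutely_monotone (partial i \<psi>))}"

definition levy_representation ::
    "(real ^ 'n \<Rightarrow> real) \<Rightarrow> real \<Rightarrow> real ^ 'n \<Rightarrow> (real ^ 'n) measure \<Rightarrow> bool" where
  "levy_representation \<psi> c0 c1 \<mu> \<longleftrightarrow>
     (\<psi> \<longlongrightarrow> c0) (at 0 within neg_orthant) \<and> c1 \<in> orthant \<and>
     orthant_measure \<mu> \<and> emeasure \<mu> {0} = 0 \<and>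
     (\<forall>s\<in>neg_orthant. integrable \<mu> (\<lambda>v. exp (s \<bullet> v) - 1) \<and>
        \<psi> s = c0 + c1 \<bullet> s + (\<integral>v. (exp (s \<bullet> v) - 1) \<partial>\<mu>))"

definition class_T0 :: "(real ^ 'n \<Rightarrow> real) set" where
  "class_T0 = {\<psi> \<in> class_T. \<exists>\<mu>. levy_representation \<psi> 0 0 \<mu>}"

section \<open>The convolution semigroup\<close>

definition has_laplace_exponent :: "(real ^ 'n) measure \<Rightarrow> (real ^ 'n \<Rightarrow> real) \<Rightarrow> bool" where
  "has_laplace_exponent N \<phi> \<longleftrightarrow>
     orthant_measure N \<and> prob_space N \<and>
     (\<forall>z\<in>neg_orthant. (\<integral>u. exp (z \<bullet> u) \<partial>N) = exp (\<phi> z))"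

text \<open>Times are real numbers, but only the values at nonnegative times matter (the same holds
  for the operator semigroups below).\<close>

definition convolution_semigroup_of ::
    "(real ^ 'n \<Rightarrow> real) \<Rightarrow> (real \<Rightarrow> (real ^ 'n) measure) \<Rightarrow> bool" where
  "convolution_semigroup_of \<psi> \<nu> \<longleftrightarrow>
     (\<forall>t\<ge>0. has_laplace_exponent (\<nu> t) (\<lambda>z. t * \<psi> z)) \<and>
     \<nu> 0 = return orthant_borel 0 \<and>
     (\<forall>s\<ge>0. \<forall>t\<ge>0.
        \<nu> (s + t) = distr (\<nu> s \<Otimes>\<^sub>M \<nu> t) orthant_borel (\<lambda>(u, v). u + v))"

definition conv_semigroup :: "(real ^ 'n \<Rightarrow> real) \<Rightarrow> real \<Rightarrow> (real ^ 'n) measure" where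
  "conv_semigroup \<psi> t = (THE N. has_laplace_exponent N (\<lambda>z. t * \<psi> z))"

section \<open>Exponential polynomials and the quantity $K$\<close>

definition exp_polys :: "(real ^ 'n \<Rightarrow> complex) set" where
  "exp_polys = {p. \<exists>(m::nat) (c :: nat \<Rightarrow> complex) (s :: nat \<Rightarrow> real ^ 'n).
     (\<forall>j<m. s j \<in> neg_orthant) \<and> p = (\<lambda>r. \<Sum>j<m. c j * exp (complex_of_real (s j \<bullet> r)))}"

definition sup_norm :: "(real ^ 'n \<Rightarrow> complex) \<Rightarrow> real" where
  "sup_norm p = (SUP r\<in>orthant. cmod (p r))"

text \<open>The inner integral is the integral of \<open>p\<close> against the translate of \<open>N\<close> by \<open>u\<close> minus \<open>N\<close>.\<close>

definition K :: "(real ^ 'n) measure \<Rightarrow> (real ^ 'n) measure \<Rightarrow> ennreal" where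
  "K N \<mu> = (SUP p\<in>{p \<in> exp_polys. sup_norm p = 1}.
     ennreal (cmod (\<integral>u. (\<integral>r. p (r + u) - p r \<partial>N) \<partial>\<mu>)))"

section \<open>Bounded complex measures and weak differentiability\<close>

text \<open>By the Jordan decomposition, the bounded complex measures are the combinations
  \<open>P - N + \<i> (Q - R)\<close> of finite positive measures \<open>P, N, Q, R\<close>; the quadruple \<open>(P, N, Q, R)\<close>
  stands for this combination. On a closed orthant, finite Borel measures are Radon.\<close>

type_synonym 'n bmeasure =
  "(real ^ 'n) measure \<times> (real ^ 'n) measure \<times> (real ^ 'n) measure \<times> (real ^ 'n) measure"

definition bounded_measures :: "'n::finite bmeasure set" where
  "bounded_measures = {(P, N, Q, R). \<forall>M\<in>{P, N, Q, R}. orthant_measure M \<and> finite_measure M}"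

definition bintegral :: "'n::finite bmeasure \<Rightarrow> (real ^ 'n \<Rightarrow> complex) \<Rightarrow> complex" where
  "bintegral m f = (case m of (P, N, Q, R) \<Rightarrow>
     (\<integral>u. f u \<partial>P) - (\<integral>u. f u \<partial>N) + \<i> * ((\<integral>u. f u \<partial>Q) - (\<integral>u. f u \<partial>R)))"

definition has_weak_derivative ::
    "(real \<Rightarrow> (real ^ 'n) measure) \<Rightarrow> 'n::finite bmeasure \<Rightarrow> real \<Rightarrow> bool" where
  "has_weak_derivative \<nu> m t \<longleftrightarrow>
     (\<forall>f :: real ^ 'n \<Rightarrow> complex. continuous_on orthant f \<and> bounded (f ` orthant) \<longrightarrow>
       ((\<lambda>h. ((\<integral>u. f u \<partial>\<nu> (t + h)) - (\<integral>u. f u \<partial>\<nu> t)) / complex_of_real h)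
          \<longlongrightarrow> bintegral m f) (at 0))"

definition weakly_differentiable :: "(real \<Rightarrow> (real ^ 'n) measure) \<Rightarrow> bool" where
  "weakly_differentiable \<nu> \<longleftrightarrow> (\<forall>t>0. \<exists>m\<in>bounded_measures. has_weak_derivative \<nu> m t)"

section \<open>Operator semigroups and generators\<close>

definition bounded_C0_semigroup :: "(real \<Rightarrow> 'x::complex_banach \<Rightarrow> 'x) \<Rightarrow> bool" where
  "bounded_C0_semigroup U \<longleftrightarrow>
     (\<forall>t\<ge>0. bounded_linear (U t) \<and> (\<forall>c x. U t (c *\<^sub>C x) = c *\<^sub>C U t x)) \<and>
     U 0 = id \<and> (\<forall>s\<ge>0. \<forall>t\<ge>0. U (s + t) = U s \<circ> U t) \<and>
     (\<forall>x. continuous_on {0..} (\<lambda>t. U t x)) \<and>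
     (\<exists>M. \<forall>t\<ge>0. onorm (U t) \<le> M)"

text \<open>Unbounded operators are given by their graphs.\<close>

definition generator :: "(real \<Rightarrow> 'x::complex_banach \<Rightarrow> 'x) \<Rightarrow> ('x \<times> 'x) set" where
  "generator U = {(x, y). ((\<lambda>h. (U h x - x) /\<^sub>R h) \<longlongrightarrow> y) (at_right 0)}"

definition generates :: "('x \<times> 'x) set \<Rightarrow> (real \<Rightarrow> 'x::complex_banach \<Rightarrow> 'x) \<Rightarrow> bool" where
  "generates G U \<longleftrightarrow> bounded_C0_semigroup U \<and> generator U = G"

text \<open>The semigroup generated by \<open>G\<close>, which is determined by \<open>G\<close> at nonnegative times.\<close>

definition semigroup_of :: "('x \<times> 'x) set \<Rightarrow> real \<Rightarrow> 'x::complex_banach \<Rightarrow> 'x" where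
  "semigroup_of G t x = (THE y. \<exists>U. generates G U \<and> y = U t x)"

definition commuting_generators :: "('n \<Rightarrow> ('x \<times> 'x::complex_banach) set) \<Rightarrow> bool" where
  "commuting_generators A \<longleftrightarrow> (\<forall>i. \<exists>U. generates (A i) U) \<and>
     (\<forall>i j. \<forall>s\<ge>0. \<forall>t\<ge>0.
        semigroup_of (A i) s \<circ> semigroup_of (A j) t = semigroup_of (A j) t \<circ> semigroup_of (A i) s)"

definition op_apply :: "('x \<times> 'x) set \<Rightarrow> 'x \<Rightarrow> 'x" where
  "op_apply G x = (THE y. (x, y) \<in> G)"

definition op_norm :: "('x::complex_banach \<Rightarrow> 'x) \<Rightarrow> ennreal" where
  "op_norm F = (SUP x\<in>{x. norm x \<le> 1}. ennreal (norm (F x)))"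

definition condition_Y :: "(real \<Rightarrow> 'x::complex_banach \<Rightarrow> 'x) \<Rightarrow> bool" where
  "condition_Y U \<longleftrightarrow>
     (\<forall>t>0. range (U t) \<subseteq> Domain (generator U)) \<and>
     Limsup (at_right 0) (\<lambda>t. ennreal t * op_norm (\<lambda>x. op_apply (generator U) (U t x))) < \<infinity>"

definition quasibounded_holomorphic :: "(real \<Rightarrow> 'x::complex_banach \<Rightarrow> 'x) \<Rightarrow> bool" where
  "quasibounded_holomorphic U \<longleftrightarrow> bounded_C0_semigroup U \<and> condition_Y U"

section \<open>The functional calculus\<close>

text \<open>The Bochner integral. This is the definition of \<^const>\<open>has_bochner_integral\<close> without the
  restriction to second countable spaces, which would exclude nonseparable Banach spaces.\<close>

definition has_bochner :: "'a measure \<Rightarrow> ('a \<Rightarrow> 'x::banach) \<Rightarrow> 'x \<Rightarrow> bool" where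
  "has_bochner M f y \<longleftrightarrow> f \<in> borel_measurable M \<and>
     (\<exists>s. (\<forall>k::nat. Bochner_Integration.simple_bochner_integrable M (s k)) \<and>
        (\<lambda>k. \<integral>\<^sup>+u. ennreal (norm (f u - s k u)) \<partial>M) \<longlonglongrightarrow> 0 \<and>
        (\<lambda>k. Bochner_Integration.simple_bochner_integral M (s k)) \<longlonglongrightarrow> y)"

definition bochner_integral :: "'a measure \<Rightarrow> ('a \<Rightarrow> 'x::banach) \<Rightarrow> 'x" where
  "bochner_integral M f = (THE y. has_bochner M f y)"

text \<open>The product \<open>T\<^sub>1(u\<^sub>1) \<dots> T\<^sub>n(u\<^sub>n) x\<close>; since the factors commute, the fold over the index type
  does not depend on an order of the indices.\<close>

definition joint_semigroup ::
    "('n::finite \<Rightarrow> ('x \<times> 'x) set) \<Rightarrow> real ^ 'n \<Rightarrow> 'x::complex_banach \<Rightarrow> 'x" where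
  "joint_semigroup A u x = Finite_Set.fold (\<lambda>i. semigroup_of (A i) (u $ i)) x UNIV"

definition subordinate_semigroup ::
    "(real ^ 'n \<Rightarrow> real) \<Rightarrow> ('n::finite \<Rightarrow> ('x \<times> 'x) set) \<Rightarrow> real \<Rightarrow> 'x::complex_banach \<Rightarrow> 'x" where
  "subordinate_semigroup \<psi> A t x =
     bochner_integral (conv_semigroup \<psi> t) (\<lambda>u. joint_semigroup A u x)"

definition calculus ::
    "(real ^ 'n \<Rightarrow> real) \<Rightarrow> ('n::finite \<Rightarrow> ('x \<times> 'x) set) \<Rightarrow> ('x \<times> 'x::complex_banach) set" where
  "calculus \<psi> A = generator (subordinate_semigroup \<psi> A)"

text \<open>One cannot quantify over types inside a formula, so the Banach space is a type argument;
  a statement with a type variable here is a statement about all complex Banach spaces.\<close>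

definition class_TY :: "'x::complex_banach itself \<Rightarrow> (real ^ 'n::finite \<Rightarrow> real) set" where
  "class_TY X = {\<psi> \<in> class_T0. \<forall>A :: 'n \<Rightarrow> ('x \<times> 'x) set. commuting_generators A \<longrightarrow>
     generates (calculus \<psi> A) (subordinate_semigroup \<psi> A) \<and>
     quasibounded_holomorphic (subordinate_semigroup \<psi> A)}"

end

theory Submission
  imports Defs
begin

text \<open>Write \<open>D\<^sub>h = (\<nu>\<^bsub>t+h\<^esub> - \<nu>\<^sub>t) / h\<close> and, for an exponential polynomial \<open>p = \<Sum> c\<^sub>j e\<^bsup>s\<^sub>j \<cdot> r\<^esup>\<close>,
  \<open>\<Phi>(t) = \<integral> p d\<nu>\<^sub>t = \<Sum> c\<^sub>j e\<^bsup>t \<psi>(s\<^sub>j)\<^esup>\<close>. By the Levy representation of \<open>\<psi>\<close> the double integral in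
  \<open>K(\<nu>\<^sub>t, \<mu>)\<close> is \<open>\<Phi>'(t)\<close>, so \<open>\<bar>\<Phi>'(t)\<bar> \<le> K(\<nu>\<^sub>t, \<mu>) \<parallel>p\<parallel>\<close>. Using this twice at time \<open>t/2\<close> also gives
  \<open>\<bar>\<Phi>''(t)\<bar> \<le> K(\<nu>\<^bsub>t/2\<^esub>, \<mu>)\<^sup>2 \<parallel>p\<parallel>\<close>, and therefore \<open>\<bar>D\<^sub>h(p) - D\<^sub>k(p)\<bar> \<le> (h + k) (2 C / t)\<^sup>2 \<parallel>p\<parallel>\<close> for
  small \<open>t\<close>. By the Stone-Weierstrass theorem these are bounds for total variations, and with
  partitions of unity in place of linear functionals they pass to the Bochner integrals of
  \<open>u \<mapsto> T(u) x\<close>. Hence the difference quotients of \<open>g\<^sub>t(A) x\<close> are Cauchy as \<open>h \<rightarrow> 0+\<close>, so \<open>g\<^sub>t(A) x\<close> lies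
  in the domain of \<open>\<psi>(A)\<close>, and \<open>\<parallel>\<psi>(A) g\<^sub>t(A)\<parallel>\<close> is at most a constant divided by \<open>t\<close>.\<close>

section \<open>Bochner integrals\<close>

text \<open>The Banach space may be nonseparable, so sums of measurable functions need not be
  measurable. Integrals are therefore handled through simple functions and real-valued error
  functions. The central estimate says that a Bochner integral differs from a finite sum
  \<open>sum_j (integral of f_j) z_j\<close> by at most the integral of a pointwise error;
  partitions of unity supply such sums.

  Membership in the domain of a generator asks for a norm limit of difference quotients. This is why
  a second order bound is sought: it makes \<open>D_h\<close> Cauchy in total variation, uniformly
  enough to be integrated against any bounded continuous operator family. The bounds hold for small
  times; the semigroup law reaches the others.

  The Bochner integral, the measure with a given Laplace exponent and the semigroup of a generator
  are all introduced by definite descriptions, so each needs a uniqueness theorem before it can be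
  computed. The last one rests on the density of the domain and on an argument with right
  derivatives only.\<close>

lemma simple_bochner_integrable_finite_measure:
  assumes "finite_measure N" and "simple_function N s"
  shows "Bochner_Integration.simple_bochner_integrable N s"
  using assms by (auto intro!: simple_bochner_integrable.intros simp: finite_measure.emeasure_finite)

lemma simple_bochner_sum_scaleR:
  fixes g :: "'j \<Rightarrow> 'a \<Rightarrow> real" and z :: "'j \<Rightarrow> 'x::real_normed_vector"
  assumes "finite J" and "\<And>j. j \<in> J \<Longrightarrow> Bochner_Integration.simple_bochner_integrable N (g j)"
  shows "Bochner_Integration.simple_bochner_integrable N (\<lambda>u. \<Sum>j\<in>J. g j u *\<^sub>R z j)"
    and "Bochner_Integration.simple_bochner_integral N (\<lambda>u. \<Sum>j\<in>J. g j u *\<^sub>R z j) =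
      (\<Sum>j\<in>J. Bochner_Integration.simple_bochner_integral N (g j) *\<^sub>R z j)"
proof -
  have "Bochner_Integration.simple_bochner_integrable N (\<lambda>u. \<Sum>j\<in>J. g j u *\<^sub>R z j) \<and>
    Bochner_Integration.simple_bochner_integral N (\<lambda>u. \<Sum>j\<in>J. g j u *\<^sub>R z j) =
      (\<Sum>j\<in>J. Bochner_Integration.simple_bochner_integral N (g j) *\<^sub>R z j)"
    using assms
  proof (induction J)
    case empty
    show ?case
      by (auto intro!: simple_bochner_integrable.intros sum.neutral
          simp: simple_bochner_integral_def)
  next
    case (insert i J)
    have gi: "Bochner_Integration.simple_bochner_integrable N (g i)" using insert by auto
    have i: "Bochner_Integration.simple_bochner_integrable N (\<lambda>u. g i u *\<^sub>R z i)"
      using simple_bochner_integrable_compose2[OF _ gi gi, of "\<lambda>x y. x *\<^sub>R z i"] by simp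
    have "linear (\<lambda>r. r *\<^sub>R z i)"
      by (simp add: bounded_linear.linear bounded_linear_scaleR_left)
    from simple_bochner_integral_linear[OF this gi]
    have si: "Bochner_Integration.simple_bochner_integral N (\<lambda>u. g i u *\<^sub>R z i) =
        Bochner_Integration.simple_bochner_integral N (g i) *\<^sub>R z i" .
    have IH: "Bochner_Integration.simple_bochner_integrable N (\<lambda>u. \<Sum>j\<in>J. g j u *\<^sub>R z j)"
      "Bochner_Integration.simple_bochner_integral N (\<lambda>u. \<Sum>j\<in>J. g j u *\<^sub>R z j) =
      (\<Sum>j\<in>J. Bochner_Integration.simple_bochner_integral N (g j) *\<^sub>R z j)"
      using insert by auto
    show ?case
      using simple_bochner_integrable_compose2[OF _ i IH(1), of "(+)"]
        simple_bochner_integral_add[OF i IH(1)] si IH(2) insert by simp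
  qed
  then show "Bochner_Integration.simple_bochner_integrable N (\<lambda>u. \<Sum>j\<in>J. g j u *\<^sub>R z j)"
    "Bochner_Integration.simple_bochner_integral N (\<lambda>u. \<Sum>j\<in>J. g j u *\<^sub>R z j) =
      (\<Sum>j\<in>J. Bochner_Integration.simple_bochner_integral N (g j) *\<^sub>R z j)"
    by auto
qed

lemma integrable_L1_simple_approx:
  fixes f :: "'a \<Rightarrow> real"
  assumes "integrable N f" and "0 < \<epsilon>"
  obtains g where "Bochner_Integration.simple_bochner_integrable N g" "integrable N g"
    "Bochner_Integration.simple_bochner_integral N g = (\<integral>u. g u \<partial>N)"
    "(\<integral>u. \<bar>f u - g u\<bar> \<partial>N) \<le> \<epsilon>"
proof -
  from assms(1) obtain y where "has_bochner_integral N f y"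
    by (auto simp: integrable.simps)
  then obtain s where s: "\<And>k. Bochner_Integration.simple_bochner_integrable N (s k)"
    and lim: "(\<lambda>k. \<integral>\<^sup>+u. ennreal (norm (f u - s k u)) \<partial>N) \<longlonglongrightarrow> 0"
    unfolding has_bochner_integral.simps by blast
  have "\<forall>\<^sub>F k in sequentially. (\<integral>\<^sup>+u. ennreal (norm (f u - s k u)) \<partial>N) < ennreal \<epsilon>"
    using order_tendstoD(2)[OF lim, of "ennreal \<epsilon>"] assms(2) by simp
  then obtain k where k: "(\<integral>\<^sup>+u. ennreal (norm (f u - s k u)) \<partial>N) < ennreal \<epsilon>"
    by (auto simp: eventually_sequentially)
  have hb: "has_bochner_integral N (s k) (Bochner_Integration.simple_bochner_integral N (s k))"
    by (rule has_bochner_integral_simple_bochner_integrable[OF s])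
  then have i: "integrable N (s k)" by (auto simp: integrable.simps)
  have "ennreal (\<integral>u. norm (f u - s k u) \<partial>N) = (\<integral>\<^sup>+u. ennreal (norm (f u - s k u)) \<partial>N)"
    using assms(1) i by (intro nn_integral_eq_integral[symmetric]) auto
  with k have "ennreal (\<integral>u. norm (f u - s k u) \<partial>N) \<le> ennreal \<epsilon>" by simp
  then have "(\<integral>u. \<bar>f u - s k u\<bar> \<partial>N) \<le> \<epsilon>" using assms(2) by simp
  with that[OF s i] has_bochner_integral_integral_eq[OF hb] show thesis by auto
qed

text \<open>For simple \<open>f j\<close> this is the triangle inequality for integrals of simple
  functions, and L1 density of simple functions does the rest. Only scalar integrals of the
  coefficients occur, so no vector-valued integral of \<open>sum_j f_j z_j\<close> has to
  exist.\<close>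

lemma norm_sum_integral_scaleR_le:
  fixes f :: "'j \<Rightarrow> 'a \<Rightarrow> real" and z :: "'j \<Rightarrow> 'x::real_normed_vector"
  assumes fin: "finite J" and f: "\<And>j. j \<in> J \<Longrightarrow> integrable N (f j)" and e: "integrable N e"
    and le: "\<And>u. u \<in> space N \<Longrightarrow> norm (\<Sum>j\<in>J. f j u *\<^sub>R z j) \<le> e u"
  shows "norm (\<Sum>j\<in>J. (\<integral>u. f j u \<partial>N) *\<^sub>R z j) \<le> (\<integral>u. e u \<partial>N)"
proof (rule field_le_epsilon)
  fix \<delta> :: real
  assume "0 < \<delta>"
  define Z where "Z = (\<Sum>j\<in>J. norm (z j))"
  have Z: "0 \<le> Z" unfolding Z_def by (simp add: sum_nonneg)
  \<comment> \<open>Replacing \<open>f j\<close> by \<open>g j\<close> is paid for twice, under the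
    integral and in the coefficients, each time with at most \<open>\<epsilon> * Z\<close>.\<close>
  define \<epsilon> where "\<epsilon> = \<delta> / (2 * (Z + 1))"
  have \<epsilon>: "0 < \<epsilon>" "2 * \<epsilon> * Z \<le> \<delta>"
    using \<open>0 < \<delta>\<close> Z by (auto simp: \<epsilon>_def field_simps)
  have "\<exists>g. Bochner_Integration.simple_bochner_integrable N g \<and> integrable N g \<and>
    Bochner_Integration.simple_bochner_integral N g = (\<integral>u. g u \<partial>N) \<and>
    (\<integral>u. \<bar>f j u - g u\<bar> \<partial>N) \<le> \<epsilon>" if "j \<in> J" for j
    using integrable_L1_simple_approx[OF f[OF that] \<epsilon>(1)] by metis
  then obtain g where g: "\<And>j. j \<in> J \<Longrightarrow> Bochner_Integration.simple_bochner_integrable N (g j)"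
    "\<And>j. j \<in> J \<Longrightarrow> integrable N (g j)"
    "\<And>j. j \<in> J \<Longrightarrow> Bochner_Integration.simple_bochner_integral N (g j) = (\<integral>u. g j u \<partial>N)"
    "\<And>j. j \<in> J \<Longrightarrow> (\<integral>u. \<bar>f j u - g j u\<bar> \<partial>N) \<le> \<epsilon>"
    by metis
  define G where "G u = (\<Sum>j\<in>J. g j u *\<^sub>R z j)" for u
  have G: "Bochner_Integration.simple_bochner_integrable N G"
    "Bochner_Integration.simple_bochner_integral N G = (\<Sum>j\<in>J. (\<integral>u. g j u \<partial>N) *\<^sub>R z j)"
    using simple_bochner_sum_scaleR[of J N g z] fin g unfolding G_def by auto
  have nG: "Bochner_Integration.simple_bochner_integrable N (\<lambda>u. norm (G u))"
    using simple_bochner_integrable_compose2[OF _ G(1) G(1), of "\<lambda>x y. norm x"] by simp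
  note hb = has_bochner_integral_simple_bochner_integrable[OF nG]
  have iG: "integrable N (\<lambda>u. norm (G u))" using hb by (auto simp: integrable.simps)
  have ie: "integrable N (\<lambda>u. e u + (\<Sum>j\<in>J. \<bar>f j u - g j u\<bar> * norm (z j)))"
    using e f g by auto
  have "norm (\<Sum>j\<in>J. (\<integral>u. g j u \<partial>N) *\<^sub>R z j) \<le>
      Bochner_Integration.simple_bochner_integral N (\<lambda>u. norm (G u))"
    using simple_bochner_integral_norm_bound[OF G(1)] G(2) by simp
  also have "\<dots> = (\<integral>u. norm (G u) \<partial>N)"
    using has_bochner_integral_integral_eq[OF hb] by simp
  also have "\<dots> \<le> (\<integral>u. e u + (\<Sum>j\<in>J. \<bar>f j u - g j u\<bar> * norm (z j)) \<partial>N)"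
  proof (rule integral_mono[OF iG ie])
    fix u assume u: "u \<in> space N"
    have "G u = (\<Sum>j\<in>J. f j u *\<^sub>R z j) - (\<Sum>j\<in>J. (f j u - g j u) *\<^sub>R z j)"
      unfolding G_def by (simp add: sum_subtractf[symmetric] scaleR_diff_left)
    also have "norm \<dots> \<le> e u + norm (\<Sum>j\<in>J. (f j u - g j u) *\<^sub>R z j)"
      using norm_triangle_ineq4 le[OF u] by (meson add_right_mono order_trans)
    also have "norm (\<Sum>j\<in>J. (f j u - g j u) *\<^sub>R z j) \<le> (\<Sum>j\<in>J. \<bar>f j u - g j u\<bar> * norm (z j))"
      by (rule order_trans[OF norm_sum]) simp
    finally show "norm (G u) \<le> e u + (\<Sum>j\<in>J. \<bar>f j u - g j u\<bar> * norm (z j))" by simp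
  qed
  also have "\<dots> = (\<integral>u. e u \<partial>N) + (\<Sum>j\<in>J. (\<integral>u. \<bar>f j u - g j u\<bar> \<partial>N) * norm (z j))"
    using e f g by (subst Bochner_Integration.integral_add) (auto simp: Bochner_Integration.integral_sum)
  also have "\<dots> \<le> (\<integral>u. e u \<partial>N) + \<epsilon> * Z"
    unfolding Z_def sum_distrib_left using g by (intro add_left_mono sum_mono mult_right_mono) auto
  finally have 1: "norm (\<Sum>j\<in>J. (\<integral>u. g j u \<partial>N) *\<^sub>R z j) \<le> (\<integral>u. e u \<partial>N) + \<epsilon> * Z" .
  have "(\<Sum>j\<in>J. (\<integral>u. f j u \<partial>N) *\<^sub>R z j) =
      (\<Sum>j\<in>J. (\<integral>u. g j u \<partial>N) *\<^sub>R z j) + (\<Sum>j\<in>J. (\<integral>u. f j u - g j u \<partial>N) *\<^sub>R z j)"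
    unfolding sum.distrib[symmetric] using f g by (intro sum.cong) (auto simp: scaleR_diff_left)
  also have "norm \<dots> \<le> (\<integral>u. e u \<partial>N) + \<epsilon> * Z + norm (\<Sum>j\<in>J. (\<integral>u. f j u - g j u \<partial>N) *\<^sub>R z j)"
    using 1 norm_triangle_ineq by (meson add_right_mono order_trans)
  also have "norm (\<Sum>j\<in>J. (\<integral>u. f j u - g j u \<partial>N) *\<^sub>R z j) \<le> (\<Sum>j\<in>J. \<epsilon> * norm (z j))"
  proof (rule order_trans[OF norm_sum], rule sum_mono)
    fix j assume j: "j \<in> J"
    have "\<bar>\<integral>u. f j u - g j u \<partial>N\<bar> \<le> (\<integral>u. \<bar>f j u - g j u\<bar> \<partial>N)"
      by (rule integral_abs_bound)
    also have "\<dots> \<le> \<epsilon>" by (rule g(4)[OF j])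
    finally show "norm ((\<integral>u. f j u - g j u \<partial>N) *\<^sub>R z j) \<le> \<epsilon> * norm (z j)"
      by (auto intro: mult_right_mono)
  qed
  also have "\<dots> = \<epsilon> * Z" by (simp add: Z_def sum_distrib_left)
  finally show "norm (\<Sum>j\<in>J. (\<integral>u. f j u \<partial>N) *\<^sub>R z j) \<le> (\<integral>u. e u \<partial>N) + \<delta>"
    using \<epsilon>(2) by (simp add: algebra_simps)
qed

lemma simple_function_expand:
  fixes s :: "'a \<Rightarrow> 'x::real_normed_vector"
  assumes "simple_function N s" and "u \<in> space N"
  shows "s u = (\<Sum>c\<in>s ` space N. indicat_real {v\<in>space N. s v = c} u *\<^sub>R c)"
proof -
  have fin: "finite (s ` space N)" using assms(1) by (rule simple_functionD)
  have "(\<Sum>c\<in>s ` space N. indicat_real {v\<in>space N. s v = c} u *\<^sub>R c) =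
      (\<Sum>c\<in>s ` space N. if c = s u then c else 0)"
    using assms(2) by (intro sum.cong) (auto simp: indicator_def)
  also have "\<dots> = s u" using fin assms(2) by simp
  finally show ?thesis ..
qed

lemma simple_function_level_set:
  assumes "simple_function N s"
  shows "{v\<in>space N. s v = c} \<in> sets N"
proof -
  have "{v\<in>space N. s v = c} = s -` {c} \<inter> space N" by auto
  then show ?thesis using simple_functionD(2)[OF assms] by simp
qed

text \<open>Without a countable base a difference of measurable functions need not be measurable. On
  each of the finitely many level sets of \<open>s\<close>, however, a constant is subtracted, and
  \<open>norm (F u - c)\<close> is a continuous function of \<open>F u\<close>.\<close>

lemma measurable_norm_diff_simple:
  fixes F s :: "'a \<Rightarrow> 'x::real_normed_vector"
  assumes "F \<in> borel_measurable N" and "simple_function N s"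
  shows "(\<lambda>u. norm (F u - s u)) \<in> borel_measurable N"
proof -
  have fin: "finite (s ` space N)" using assms(2) by (rule simple_functionD)
  have "(\<lambda>u. \<Sum>c\<in>s ` space N. indicat_real {v\<in>space N. s v = c} u * norm (F u - c)) \<in> borel_measurable N"
  proof (intro borel_measurable_sum borel_measurable_times)
    fix c
    show "indicat_real {v \<in> space N. s v = c} \<in> borel_measurable N"
      using simple_function_level_set[OF assms(2)] by (rule borel_measurable_indicator)
    show "(\<lambda>u. norm (F u - c)) \<in> borel_measurable N"
      using assms(1) by (rule borel_measurable_continuous_on[rotated]) (intro continuous_intros)
  qed
  moreover have "norm (F u - s u) =
      (\<Sum>c\<in>s ` space N. indicat_real {v\<in>space N. s v = c} u * norm (F u - c))" if u: "u \<in> space N" for u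
  proof -
    have "(\<Sum>c\<in>s ` space N. indicat_real {v\<in>space N. s v = c} u * norm (F u - c)) =
      (\<Sum>c\<in>s ` space N. if c = s u then norm (F u - c) else 0)"
      using u by (intro sum.cong) (auto simp: indicator_def)
    also have "\<dots> = norm (F u - s u)" using fin u by simp
    finally show ?thesis ..
  qed
  ultimately show ?thesis by (subst measurable_cong) auto
qed

text \<open>The distances in the definition may be infinite for finitely many \<open>k\<close>.
  Dropping those terms makes every distance an integral of a real integrable function, and the
  arguments below can use real arithmetic.\<close>

lemma has_bochner_simple_approx:
  fixes F :: "'a \<Rightarrow> 'x::banach"
  assumes "has_bochner N F y"
  shows "\<exists>s. (\<forall>k::nat. simple_function N (s k)) \<and>
    (\<forall>k. integrable N (\<lambda>u. norm (F u - s k u))) \<and>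
    (\<lambda>k. \<integral>u. norm (F u - s k u) \<partial>N) \<longlonglongrightarrow> 0 \<and>
    (\<forall>k. Bochner_Integration.simple_bochner_integrable N (s k)) \<and>
    (\<lambda>k. Bochner_Integration.simple_bochner_integral N (s k)) \<longlonglongrightarrow> y"
proof -
  from assms obtain s where F: "F \<in> borel_measurable N"
    and s: "\<And>k::nat. Bochner_Integration.simple_bochner_integrable N (s k)"
    and lim: "(\<lambda>k. \<integral>\<^sup>+u. ennreal (norm (F u - s k u)) \<partial>N) \<longlonglongrightarrow> 0"
    and y: "(\<lambda>k. Bochner_Integration.simple_bochner_integral N (s k)) \<longlonglongrightarrow> y"
    unfolding has_bochner_def by auto
  have sf: "simple_function N (s k)" for k using s[of k] by (auto elim: simple_bochner_integrable.cases)
  have "\<forall>\<^sub>F k in sequentially. (\<integral>\<^sup>+u. ennreal (norm (F u - s k u)) \<partial>N) < 1"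
    using order_tendstoD(2)[OF lim, of 1] by simp
  then obtain k0 where k0: "\<And>k. k \<ge> k0 \<Longrightarrow> (\<integral>\<^sup>+u. ennreal (norm (F u - s k u)) \<partial>N) < 1"
    by (auto simp: eventually_sequentially)
  have int: "integrable N (\<lambda>u. norm (F u - s (k + k0) u))" for k
    using measurable_norm_diff_simple[OF F sf] less_trans[OF k0[of "k + k0"] ennreal_one_less_top]
    by (intro integrableI_bounded) auto
  show ?thesis
  proof (intro exI[of _ "\<lambda>k. s (k + k0)"] conjI allI)
    have "(\<lambda>k. \<integral>\<^sup>+u. ennreal (norm (F u - s (k + k0) u)) \<partial>N) \<longlonglongrightarrow> 0"
      using lim by (rule LIMSEQ_ignore_initial_segment)
    then have "(\<lambda>k. ennreal (\<integral>u. norm (F u - s (k + k0) u) \<partial>N)) \<longlonglongrightarrow> ennreal 0"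
      using int by (subst (asm) nn_integral_eq_integral) auto
    then show "(\<lambda>k. \<integral>u. norm (F u - s (k + k0) u) \<partial>N) \<longlonglongrightarrow> 0"
      by (subst (asm) tendsto_ennreal_iff) auto
    show "(\<lambda>k. Bochner_Integration.simple_bochner_integral N (s (k + k0))) \<longlonglongrightarrow> y"
      using y by (rule LIMSEQ_ignore_initial_segment)
  qed (rule int s sf)+
qed

lemma simple_bochner_integral_expand:
  fixes s :: "'a \<Rightarrow> 'x::real_normed_vector"
  assumes "finite_measure N" and "simple_function N s"
  shows "Bochner_Integration.simple_bochner_integral N s =
    (\<Sum>c\<in>s ` space N. (\<integral>u. indicat_real {v\<in>space N. s v = c} u \<partial>N) *\<^sub>R c)"
  unfolding simple_bochner_integral_def
  using simple_function_level_set[OF assms(2)]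
  by (intro sum.cong refl arg_cong2[where f = scaleR]) (auto simp: Int_def conj_commute intro!: arg_cong[where f = "measure N"])

lemma norm_simple_bochner_integral_diff_le:
  fixes s :: "'a \<Rightarrow> 'x::real_normed_vector" and f :: "'j \<Rightarrow> 'a \<Rightarrow> real"
  assumes N: "finite_measure N" and s: "simple_function N s"
    and fin: "finite J" and f: "\<And>j. j \<in> J \<Longrightarrow> integrable N (f j)" and e: "integrable N e"
    and le: "\<And>u. u \<in> space N \<Longrightarrow> norm (s u - (\<Sum>j\<in>J. f j u *\<^sub>R z j)) \<le> e u"
  shows "norm (Bochner_Integration.simple_bochner_integral N s - (\<Sum>j\<in>J. (\<integral>u. f j u \<partial>N) *\<^sub>R z j))
    \<le> (\<integral>u. e u \<partial>N)"
proof -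
  interpret finite_measure N by fact
  \<comment> \<open>The values of \<open>s\<close> and the vectors \<open>- z j\<close> form one
    family over a disjoint sum, so the difference of the two integrals is a single finite
    sum.\<close>
  let ?I = "s ` space N <+> J"
  define h where "h = case_sum (\<lambda>c. indicat_real {v\<in>space N. s v = c}) f"
  define w where "w = case_sum (\<lambda>c. c) (\<lambda>j. - z j)"
  have finI: "finite (s ` space N)" using s by (rule simple_functionD)
  have split: "(\<Sum>i\<in>?I. a i *\<^sub>R w i) =
      (\<Sum>c\<in>s ` space N. a (Inl c) *\<^sub>R c) - (\<Sum>j\<in>J. a (Inr j) *\<^sub>R z j)" for a
    using finI fin by (simp add: sum.Plus w_def sum_negf o_def)
  have "norm (\<Sum>i\<in>?I. (\<integral>u. h i u \<partial>N) *\<^sub>R w i) \<le> (\<integral>u. e u \<partial>N)"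
  proof (rule norm_sum_integral_scaleR_le[OF _ _ e])
    show "finite ?I" using finI fin by simp
    show "integrable N (h i)" if "i \<in> ?I" for i
      using that f simple_function_level_set[OF s] by (auto simp: h_def emeasure_eq_measure)
    show "norm (\<Sum>i\<in>?I. h i u *\<^sub>R w i) \<le> e u" if u: "u \<in> space N" for u
      using le[OF u] unfolding split simple_function_expand[OF s u] by (simp add: h_def)
  qed
  then show ?thesis
    unfolding split simple_bochner_integral_expand[OF N s] by (simp add: h_def)
qed

text \<open>The main tool for everything about Bochner integrals: it holds for simple functions with
  the error enlarged by \<open>norm (F u - s k u)\<close>, and that enlargement vanishes in the
  limit. With \<open>J = {}\<close> it is a norm bound, with a singleton \<open>J\<close> a
  comparison with a constant vector.\<close>

lemma has_bochner_norm_diff_le: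
  fixes F :: "'a \<Rightarrow> 'x::banach" and f :: "'j \<Rightarrow> 'a \<Rightarrow> real"
  assumes N: "finite_measure N" and y: "has_bochner N F y"
    and fin: "finite J" and f: "\<And>j. j \<in> J \<Longrightarrow> integrable N (f j)" and e: "integrable N e"
    and le: "\<And>u. u \<in> space N \<Longrightarrow> norm (F u - (\<Sum>j\<in>J. f j u *\<^sub>R z j)) \<le> e u"
  shows "norm (y - (\<Sum>j\<in>J. (\<integral>u. f j u \<partial>N) *\<^sub>R z j)) \<le> (\<integral>u. e u \<partial>N)"
proof -
  from has_bochner_simple_approx[OF y] obtain s where s: "\<forall>k::nat. simple_function N (s k)"
    "\<forall>k. integrable N (\<lambda>u. norm (F u - s k u))"
    "(\<lambda>k. \<integral>u. norm (F u - s k u) \<partial>N) \<longlonglongrightarrow> 0"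
    "\<forall>k. Bochner_Integration.simple_bochner_integrable N (s k)"
    "(\<lambda>k. Bochner_Integration.simple_bochner_integral N (s k)) \<longlonglongrightarrow> y"
    by (elim exE conjE)
  note s = s[rule_format]
  have "norm (Bochner_Integration.simple_bochner_integral N (s k) - (\<Sum>j\<in>J. (\<integral>u. f j u \<partial>N) *\<^sub>R z j))
      \<le> (\<integral>u. e u \<partial>N) + (\<integral>u. norm (F u - s k u) \<partial>N)" for k
  proof -
    have "norm (s k u - (\<Sum>j\<in>J. f j u *\<^sub>R z j)) \<le> e u + norm (F u - s k u)" if "u \<in> space N" for u
    proof -
      have "norm (s k u - (\<Sum>j\<in>J. f j u *\<^sub>R z j)) =
          norm ((F u - (\<Sum>j\<in>J. f j u *\<^sub>R z j)) - (F u - s k u))" by simp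
      then show ?thesis using le[OF that]
          norm_triangle_ineq4[of "F u - (\<Sum>j\<in>J. f j u *\<^sub>R z j)" "F u - s k u"] by linarith
    qed
    from norm_simple_bochner_integral_diff_le[OF N s(1) fin f _ this]
    show ?thesis using e s(2) by (simp add: Bochner_Integration.integral_add)
  qed
  moreover have "(\<lambda>k. norm (Bochner_Integration.simple_bochner_integral N (s k) -
      (\<Sum>j\<in>J. (\<integral>u. f j u \<partial>N) *\<^sub>R z j))) \<longlonglongrightarrow> norm (y - (\<Sum>j\<in>J. (\<integral>u. f j u \<partial>N) *\<^sub>R z j))"
    using s(5) by (intro tendsto_intros)
  moreover have "(\<lambda>k. (\<integral>u. e u \<partial>N) + (\<integral>u. norm (F u - s k u) \<partial>N)) \<longlonglongrightarrow> (\<integral>u. e u \<partial>N) + 0"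
    using s(3) by (intro tendsto_intros)
  ultimately have "norm (y - (\<Sum>j\<in>J. (\<integral>u. f j u \<partial>N) *\<^sub>R z j)) \<le> (\<integral>u. e u \<partial>N) + 0"
    by (intro LIMSEQ_le) auto
  then show ?thesis by simp
qed

lemma has_bochner_norm_diff_simple_le:
  fixes F :: "'a \<Rightarrow> 'x::banach"
  assumes N: "finite_measure N" and y: "has_bochner N F y" and s: "simple_function N s"
    and int: "integrable N (\<lambda>u. norm (F u - s u))"
  shows "norm (y - Bochner_Integration.simple_bochner_integral N s) \<le> (\<integral>u. norm (F u - s u) \<partial>N)"
proof -
  interpret finite_measure N by fact
  have fin: "finite (s ` space N)" using s by (rule simple_functionD)
  define f where "f c = indicat_real {v \<in> space N. s v = c}" for c
  have f: "integrable N (f c)" for c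
    unfolding f_def using simple_function_level_set[OF s] by (intro integrable_real_indicator) (auto simp: emeasure_eq_measure)
  have eq: "F u - (\<Sum>c\<in>s ` space N. f c u *\<^sub>R c) = F u - s u" if "u \<in> space N" for u
    unfolding f_def using simple_function_expand[OF s that] by argo
  have "norm (y - (\<Sum>c\<in>s ` space N. (\<integral>u. f c u \<partial>N) *\<^sub>R c)) \<le> (\<integral>u. norm (F u - s u) \<partial>N)"
    by (rule has_bochner_norm_diff_le[OF N y fin f int]) (metis eq order_refl)
  then show ?thesis
    unfolding simple_bochner_integral_expand[OF N s] f_def .
qed

text \<open>Simple functions that witness one value \<open>y'\<close> also converge to any other
  value \<open>y\<close>, since the distance of \<open>y\<close> from a simple integral is at most
  the L1 distance of the integrands.\<close>

lemma has_bochner_unique: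
  fixes F :: "'a \<Rightarrow> 'x::banach"
  assumes N: "finite_measure N" and "has_bochner N F y" and "has_bochner N F y'"
  shows "y = y'"
proof -
  from has_bochner_simple_approx[OF assms(3)] obtain s where s: "\<forall>k::nat. simple_function N (s k)"
    "\<forall>k. integrable N (\<lambda>u. norm (F u - s k u))"
    "(\<lambda>k. \<integral>u. norm (F u - s k u) \<partial>N) \<longlonglongrightarrow> 0"
    "\<forall>k. Bochner_Integration.simple_bochner_integrable N (s k)"
    "(\<lambda>k. Bochner_Integration.simple_bochner_integral N (s k)) \<longlonglongrightarrow> y'"
    by (elim exE conjE)
  note s = s[rule_format]
  have "(\<lambda>k. y - Bochner_Integration.simple_bochner_integral N (s k)) \<longlonglongrightarrow> 0"
  proof (rule Lim_null_comparison[OF always_eventually s(3)], rule allI)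
    fix k
    show "norm (y - Bochner_Integration.simple_bochner_integral N (s k)) \<le> (\<integral>u. norm (F u - s k u) \<partial>N)"
      by (rule has_bochner_norm_diff_simple_le[OF N assms(2) s(1) s(2)])
  qed
  from LIMSEQ_unique[OF this tendsto_diff[OF tendsto_const s(5)]] have "y - y' = 0" by simp
  then show ?thesis by simp
qed

lemma bochner_integral_eqI:
  assumes "finite_measure N" and "has_bochner N F y"
  shows "bochner_integral N F = y"
  unfolding bochner_integral_def
  using assms(2) by (rule the_equality) (rule has_bochner_unique[OF assms(1) _ assms(2)])

section \<open>Congruence and linearity of Bochner integrals\<close>

lemma has_bochner_cong:
  assumes "\<And>u. u \<in> space N \<Longrightarrow> F u = G u"
  shows "has_bochner N F y \<longleftrightarrow> has_bochner N G y"
proof -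
  have "F \<in> borel_measurable N \<longleftrightarrow> G \<in> borel_measurable N"
    using assms by (rule measurable_cong)
  moreover have "(\<integral>\<^sup>+u. ennreal (norm (F u - s u)) \<partial>N) = (\<integral>\<^sup>+u. ennreal (norm (G u - s u)) \<partial>N)" for s
    by (rule nn_integral_cong) (simp add: assms)
  ultimately show ?thesis unfolding has_bochner_def by simp
qed

text \<open>Measurability of the sum is assumed because it is not automatic in a space without a
  countable base; in the application it comes from continuity.\<close>

lemma has_bochner_add:
  fixes F G :: "'a \<Rightarrow> 'x::banach"
  assumes N: "finite_measure N" and F: "has_bochner N F y" and G: "has_bochner N G y'"
    and meas: "(\<lambda>u. F u + G u) \<in> borel_measurable N"
  shows "has_bochner N (\<lambda>u. F u + G u) (y + y')"
proof -
  from has_bochner_simple_approx[OF F] obtain s where s: "\<forall>k::nat. simple_function N (s k)"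
    "\<forall>k. integrable N (\<lambda>u. norm (F u - s k u))"
    "(\<lambda>k. \<integral>u. norm (F u - s k u) \<partial>N) \<longlonglongrightarrow> 0"
    "\<forall>k. Bochner_Integration.simple_bochner_integrable N (s k)"
    "(\<lambda>k. Bochner_Integration.simple_bochner_integral N (s k)) \<longlonglongrightarrow> y"
    by (elim exE conjE)
  note s = s[rule_format]
  from has_bochner_simple_approx[OF G] obtain r where r: "\<forall>k::nat. simple_function N (r k)"
    "\<forall>k. integrable N (\<lambda>u. norm (G u - r k u))"
    "(\<lambda>k. \<integral>u. norm (G u - r k u) \<partial>N) \<longlonglongrightarrow> 0"
    "\<forall>k. Bochner_Integration.simple_bochner_integrable N (r k)"
    "(\<lambda>k. Bochner_Integration.simple_bochner_integral N (r k)) \<longlonglongrightarrow> y'"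
    by (elim exE conjE)
  note r = r[rule_format]
  have "(\<integral>\<^sup>+u. ennreal (norm (F u + G u - (s k u + r k u))) \<partial>N) \<le>
      ennreal ((\<integral>u. norm (F u - s k u) \<partial>N) + (\<integral>u. norm (G u - r k u) \<partial>N))" for k
  proof -
    have "(\<integral>\<^sup>+u. ennreal (norm (F u + G u - (s k u + r k u))) \<partial>N) \<le>
      (\<integral>\<^sup>+u. ennreal (norm (F u - s k u) + norm (G u - r k u)) \<partial>N)"
      by (intro nn_integral_mono ennreal_leI norm_diff_triangle_ineq)
    also have "\<dots> = ennreal (\<integral>u. norm (F u - s k u) + norm (G u - r k u) \<partial>N)"
      using s(2) r(2) by (intro nn_integral_eq_integral) auto
    finally show ?thesis using s(2) r(2) by (simp add: Bochner_Integration.integral_add)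
  qed
  moreover have "(\<lambda>k. ennreal ((\<integral>u. norm (F u - s k u) \<partial>N) + (\<integral>u. norm (G u - r k u) \<partial>N))) \<longlonglongrightarrow> 0"
    using tendsto_ennrealI[OF tendsto_add[OF s(3) r(3)]] by simp
  ultimately have "(\<lambda>k. \<integral>\<^sup>+u. ennreal (norm (F u + G u - (s k u + r k u))) \<partial>N) \<longlonglongrightarrow> 0"
    by (rule tendsto_sandwich[OF always_eventually[OF allI] always_eventually[OF allI] tendsto_const, OF zero_le])
  moreover have "(\<lambda>k. Bochner_Integration.simple_bochner_integral N (\<lambda>u. s k u + r k u)) \<longlonglongrightarrow> y + y'"
    unfolding simple_bochner_integral_add[OF s(4) r(4)] using s(5) r(5) by (rule tendsto_add)
  moreover have "Bochner_Integration.simple_bochner_integrable N (\<lambda>u. s k u + r k u)" for k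
    using simple_bochner_integrable_compose2[OF _ s(4) r(4), of "(+)"] by simp
  ultimately show ?thesis
    unfolding has_bochner_def using meas by (intro conjI exI[of _ "\<lambda>k u. s k u + r k u"] allI)
qed

lemma has_bochner_bounded_linear:
  fixes F :: "'a \<Rightarrow> 'x::banach" and T :: "'x \<Rightarrow> 'y::banach"
  assumes T: "bounded_linear T" and F: "has_bochner N F y"
  shows "has_bochner N (\<lambda>u. T (F u)) (T y)"
proof -
  interpret T: bounded_linear T by fact
  from has_bochner_simple_approx[OF F] obtain s where s: "\<forall>k::nat. simple_function N (s k)"
    "\<forall>k. integrable N (\<lambda>u. norm (F u - s k u))"
    "(\<lambda>k. \<integral>u. norm (F u - s k u) \<partial>N) \<longlonglongrightarrow> 0"
    "\<forall>k. Bochner_Integration.simple_bochner_integrable N (s k)"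
    "(\<lambda>k. Bochner_Integration.simple_bochner_integral N (s k)) \<longlonglongrightarrow> y"
    by (elim exE conjE)
  note s = s[rule_format]
  have meas: "(\<lambda>u. T (F u)) \<in> borel_measurable N"
    using F T.continuous_on[OF continuous_on_id] unfolding has_bochner_def
    by (auto intro: borel_measurable_continuous_on)
  have "(\<integral>\<^sup>+u. ennreal (norm (T (F u) - T (s k u))) \<partial>N) \<le>
      ennreal ((\<integral>u. norm (F u - s k u) \<partial>N) * onorm T)" for k
  proof -
    have "(\<integral>\<^sup>+u. ennreal (norm (T (F u) - T (s k u))) \<partial>N) \<le>
      (\<integral>\<^sup>+u. ennreal (norm (F u - s k u) * onorm T) \<partial>N)"
      using onorm[OF T] by (intro nn_integral_mono ennreal_leI) (simp add: T.diff[symmetric] mult.commute)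
    also have "\<dots> = ennreal (\<integral>u. norm (F u - s k u) * onorm T \<partial>N)"
      using s(2) onorm_pos_le[OF T] by (intro nn_integral_eq_integral) auto
    finally show ?thesis by simp
  qed
  moreover have "(\<lambda>k. ennreal ((\<integral>u. norm (F u - s k u) \<partial>N) * onorm T)) \<longlonglongrightarrow> 0"
    using tendsto_ennrealI[OF tendsto_mult_right[OF s(3), of "onorm T"]] by simp
  ultimately have "(\<lambda>k. \<integral>\<^sup>+u. ennreal (norm (T (F u) - T (s k u))) \<partial>N) \<longlonglongrightarrow> 0"
    by (rule tendsto_sandwich[OF always_eventually[OF allI] always_eventually[OF allI] tendsto_const, OF zero_le])
  moreover have "(\<lambda>k. Bochner_Integration.simple_bochner_integral N (\<lambda>u. T (s k u))) \<longlonglongrightarrow> T y"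
    unfolding simple_bochner_integral_linear[OF T.linear s(4)] using s(5) by (rule T.tendsto)
  moreover have "Bochner_Integration.simple_bochner_integrable N (\<lambda>u. T (s k u))" for k
    using simple_bochner_integrable_compose2[OF _ s(4) s(4), of "\<lambda>x y. T x"] by (simp add: T.zero)
  ultimately show ?thesis
    unfolding has_bochner_def using meas by (intro conjI exI[of _ "\<lambda>k u. T (s k u)"] allI)
qed

section \<open>Integrals over the orthant\<close>

lemma closed_orthant: "closed (orthant :: (real ^ 'n) set)"
proof -
  have eq: "orthant = (\<Inter>i. {u :: real ^ 'n. 0 \<le> u $ i})" by (auto simp: orthant_def)
  show ?thesis
    unfolding eq by (intro closed_INT ballI closed_Collect_le continuous_intros)
qed

lemma zero_in_orthant [simp]: "0 \<in> orthant"
  by (simp add: orthant_def)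

lemma orthant_add: "u \<in> orthant \<Longrightarrow> v \<in> orthant \<Longrightarrow> u + v \<in> orthant"
  by (simp add: orthant_def)

lemma space_orthant_measure: "orthant_measure N \<Longrightarrow> space N = orthant"
  by (simp add: orthant_measure_def)

lemma borel_measurable_orthant:
  assumes "orthant_measure N" and "continuous_on orthant f"
  shows "f \<in> borel_measurable N"
proof -
  have "f \<in> borel_measurable orthant_borel"
    unfolding orthant_borel_def using assms(2) by (rule borel_measurable_continuous_on_restrict)
  then show ?thesis
    using assms(1) by (simp add: orthant_measure_def cong: measurable_cong_sets)
qed

lemma integrable_orthant:
  fixes f :: "real ^ 'n \<Rightarrow> 'b::{banach, second_countable_topology}"
  assumes "orthant_measure N" and "finite_measure N" and "continuous_on orthant f"
    and "\<And>u. u \<in> orthant \<Longrightarrow> norm (f u) \<le> B"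
  shows "integrable N f"
  by (rule finite_measure.integrable_const_bound[OF assms(2), of _ B])
    (use assms borel_measurable_orthant[OF assms(1,3)] in \<open>auto simp: space_orthant_measure\<close>)

lemma orthant_measure_tail:
  fixes N :: "(real ^ 'n::finite) measure"
  assumes N: "orthant_measure N" and fin: "finite_measure N" and "0 < \<epsilon>"
  obtains R where "\<And>r. R \<le> r \<Longrightarrow> measure N {u \<in> space N. r < norm u} \<le> \<epsilon>"
proof -
  interpret finite_measure N by fact
  have [measurable]: "(\<lambda>u. norm u) \<in> borel_measurable N"
    by (rule borel_measurable_orthant[OF N]) (intro continuous_intros)
  define A where "A k = {u \<in> space N. real k < norm u}" for k
  have "(\<lambda>k. measure N (A k)) \<longlonglongrightarrow> measure N (\<Inter>k. A k)"
    by (rule finite_Lim_measure_decseq) (auto simp: A_def decseq_def)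
  moreover have "(\<Inter>k. A k) = {}"
  proof -
    have "u \<notin> (\<Inter>k. A k)" for u
    proof -
      obtain k where "norm u \<le> real k" using real_arch_simple by blast
      then have "u \<notin> A k" by (simp add: A_def)
      then show ?thesis by blast
    qed
    then show ?thesis by blast
  qed
  ultimately have "(\<lambda>k. measure N (A k)) \<longlonglongrightarrow> 0" by simp
  then have "\<forall>\<^sub>F k in sequentially. measure N (A k) < \<epsilon>"
    using \<open>0 < \<epsilon>\<close> by (rule order_tendstoD(2))
  then obtain k where k: "measure N (A k) < \<epsilon>" by (auto simp: eventually_sequentially)
  show thesis
  proof (rule that[of "real k"])
    fix r assume "real k \<le> r"
    then have "measure N {u \<in> space N. r < norm u} \<le> measure N (A k)"
      unfolding A_def by (intro finite_measure_mono) auto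
    then show "measure N {u \<in> space N. r < norm u} \<le> \<epsilon>" using k by simp
  qed
qed

section \<open>Finite sums with continuous coefficients as approximations\<close>

text \<open>Normalised tent functions around a finite net. They form a partition of unity on
  \<open>Q\<close> and stay continuous with sum at most 1 elsewhere, so they can be integrated over
  the whole orthant.\<close>

lemma compact_partition_approx:
  fixes F :: "'a::metric_space \<Rightarrow> 'x::real_normed_vector"
  assumes Q: "compact Q" and F: "continuous_on Q F" and "0 < \<epsilon>"
  obtains C \<phi> where "finite C" "C \<subseteq> Q" "\<And>c. continuous_on UNIV (\<phi> c)"
    "\<And>c u. (0::real) \<le> \<phi> c u" "\<And>u. (\<Sum>c\<in>C. \<phi> c u) \<le> 1" "\<And>c u. 1 < dist u c \<Longrightarrow> \<phi> c u = 0"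
    "\<And>u. u \<in> Q \<Longrightarrow> norm (F u - (\<Sum>c\<in>C. \<phi> c u *\<^sub>R F c)) \<le> \<epsilon>"
proof (cases "Q = {}")
  case True
  show thesis by (rule that[of "{}" "\<lambda>_ _. 0"]) (use True in auto)
next
  case False
  from compact_uniformly_continuous[OF F Q] obtain \<delta>' where \<delta>': "0 < \<delta>'"
    "\<And>u v. u \<in> Q \<Longrightarrow> v \<in> Q \<Longrightarrow> dist u v < \<delta>' \<Longrightarrow> dist (F u) (F v) < \<epsilon>"
    unfolding uniformly_continuous_on_def using \<open>0 < \<epsilon>\<close> by metis
  \<comment> \<open>The cap at 1 confines the supports to distance 1 from \<open>Q\<close>; this
    makes the coefficients compactly supported when \<open>Q\<close> is bounded.\<close>
  define \<delta> where "\<delta> = min \<delta>' 1"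
  have \<delta>: "0 < \<delta>" "\<delta> \<le> 1" "\<delta> \<le> \<delta>'" using \<delta>' by (auto simp: \<delta>_def)
  have cover: "Q \<subseteq> (\<Union>c\<in>Q. ball c \<delta>)" using \<delta>(1) by auto
  obtain C where C: "C \<subseteq> Q" "finite C" "Q \<subseteq> (\<Union>c\<in>C. ball c \<delta>)"
    using compactE_image[OF Q open_ball cover] .
  note C = C(2,1,3)
  define \<psi> where "\<psi> c u = max 0 (\<delta> - dist u c)" for c u :: 'a
  define \<Psi> where "\<Psi> u = (\<Sum>c\<in>C. \<psi> c u)" for u
  have \<psi>0: "0 \<le> \<psi> c u" for c u by (simp add: \<psi>_def)
  have cont: "continuous_on S (\<psi> c)" for c S unfolding \<psi>_def by (intro continuous_intros)
  have contP: "continuous_on S \<Psi>" for S unfolding \<Psi>_def by (intro continuous_intros cont)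
  obtain u0 where u0: "u0 \<in> Q" "\<And>u. u \<in> Q \<Longrightarrow> \<Psi> u0 \<le> \<Psi> u"
    using continuous_attains_inf[OF Q False contP] by blast
  define \<eta> where "\<eta> = \<Psi> u0"
  obtain c0 where c0: "c0 \<in> C" "dist u0 c0 < \<delta>" using C(3) u0(1) by (force simp: dist_commute)
  have "0 < \<psi> c0 u0" using c0 by (simp add: \<psi>_def)
  also have "\<psi> c0 u0 \<le> \<eta>" unfolding \<eta>_def \<Psi>_def using c0(1) C(1) \<psi>0 by (intro member_le_sum) auto
  finally have \<eta>: "0 < \<eta>" .
  \<comment> \<open>Since \<eta> is the minimum of \<Psi> over \<open>Q\<close>, the maximum equals
    \<open>\<Psi> u\<close> on \<open>Q\<close>, while off \<open>Q\<close> it keeps the denominator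
    away from 0.\<close>
  define \<phi> where "\<phi> c u = \<psi> c u / max (\<Psi> u) \<eta>" for c u
  have pos: "0 < max (\<Psi> u) \<eta>" for u using \<eta> by simp
  show thesis
  proof (rule that[of C \<phi>])
    show "continuous_on UNIV (\<phi> c)" for c
      unfolding \<phi>_def using pos by (intro continuous_intros cont contP) (metis less_irrefl)
    show \<phi>0: "0 \<le> \<phi> c u" for c u unfolding \<phi>_def using pos[of u] \<psi>0 by simp
    have sum: "(\<Sum>c\<in>C. \<phi> c u) = \<Psi> u / max (\<Psi> u) \<eta>" for u
      unfolding \<phi>_def sum_divide_distrib[symmetric] \<Psi>_def ..
    show "(\<Sum>c\<in>C. \<phi> c u) \<le> 1" for u unfolding sum using pos[of u] by (simp add: divide_le_eq)
    show "\<phi> c u = 0" if "1 < dist u c" for c u using that \<delta> by (simp add: \<phi>_def \<psi>_def)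
    fix u assume u: "u \<in> Q"
    have "max (\<Psi> u) \<eta> = \<Psi> u" using u0(2)[OF u] by (simp add: \<eta>_def max_def)
    then have one: "(\<Sum>c\<in>C. \<phi> c u) = 1" using sum[of u] pos[of u] by simp
    have "F u - (\<Sum>c\<in>C. \<phi> c u *\<^sub>R F c) = (\<Sum>c\<in>C. \<phi> c u *\<^sub>R (F u - F c))"
      using one by (simp add: scaleR_diff_right sum_subtractf scaleR_sum_left[symmetric])
    also have "norm \<dots> \<le> (\<Sum>c\<in>C. \<phi> c u * \<epsilon>)"
    proof (rule order_trans[OF norm_sum], rule sum_mono)
      fix c assume c: "c \<in> C"
      show "norm (\<phi> c u *\<^sub>R (F u - F c)) \<le> \<phi> c u * \<epsilon>"
      proof (cases "dist u c < \<delta>")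
        case True
        then have "norm (F u - F c) \<le> \<epsilon>" using \<delta>'(2)[OF u, of c] \<delta> c C(2) by (auto simp: dist_norm)
        then show ?thesis using \<phi>0 by (simp add: mult_left_mono)
      next
        case False
        then have "\<phi> c u = 0" by (simp add: \<phi>_def \<psi>_def)
        then show ?thesis by simp
      qed
    qed
    also have "\<dots> = \<epsilon>" using one by (simp add: sum_distrib_right[symmetric])
    finally show "norm (F u - (\<Sum>c\<in>C. \<phi> c u *\<^sub>R F c)) \<le> \<epsilon>" .
  qed (use C in auto)
qed

text \<open>One approximation has to serve several measures at once, because differences of Bochner
  integrals at different times are to be estimated. By tightness a common large ball carries almost
  all the mass of each of them; outside it the crude error \<open>2 * B\<close> is enough.\<close>

lemma orthant_partition_approx:
  fixes F :: "real ^ 'n::finite \<Rightarrow> 'x::real_normed_vector" and N :: "'j \<Rightarrow> (real ^ 'n) measure"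
  assumes J: "finite J"
    and N: "\<And>j. j \<in> J \<Longrightarrow> orthant_measure (N j)" "\<And>j. j \<in> J \<Longrightarrow> finite_measure (N j)"
    and F: "continuous_on orthant F" "\<And>u. u \<in> orthant \<Longrightarrow> norm (F u) \<le> B" and "0 < \<epsilon>"
  obtains C \<phi> R e where "finite C" "C \<subseteq> orthant" "\<And>c. continuous_on UNIV (\<phi> c)"
    "\<And>c u. (0::real) \<le> \<phi> c u" "\<And>u. (\<Sum>c\<in>C. \<phi> c u) \<le> 1"
    "\<And>c u. c \<in> C \<Longrightarrow> R < norm u \<Longrightarrow> \<phi> c u = 0"
    "\<And>u. u \<in> orthant \<Longrightarrow> norm (F u - (\<Sum>c\<in>C. \<phi> c u *\<^sub>R F c)) \<le> e u"
    "\<And>j. j \<in> J \<Longrightarrow> integrable (N j) e" "\<And>j. j \<in> J \<Longrightarrow> (\<integral>u. e u \<partial>N j) \<le> \<epsilon>"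
proof -
  have B: "0 \<le> B" using F(2)[OF zero_in_orthant] norm_ge_zero order_trans by blast
  define m where "m = (\<Sum>j\<in>J. measure (N j) (space (N j)))"
  have m: "0 \<le> m" unfolding m_def by (simp add: sum_nonneg)
  define \<epsilon>1 where "\<epsilon>1 = \<epsilon> / (2 * (m + 1))"
  have \<epsilon>1: "0 < \<epsilon>1" "\<epsilon>1 * m \<le> \<epsilon> / 2" using \<open>0 < \<epsilon>\<close> m by (auto simp: \<epsilon>1_def field_simps)
  define \<epsilon>2 where "\<epsilon>2 = \<epsilon> / (2 * (2 * B + 1))"
  have \<epsilon>2: "0 < \<epsilon>2" "2 * B * \<epsilon>2 \<le> \<epsilon> / 2" using \<open>0 < \<epsilon>\<close> B by (auto simp: \<epsilon>2_def field_simps)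
  have "\<exists>R. \<forall>r\<ge>R. measure (N j) {u \<in> space (N j). r < norm u} \<le> \<epsilon>2" if "j \<in> J" for j
    using orthant_measure_tail[OF N[OF that] \<epsilon>2(1)] by metis
  then obtain R where R: "\<And>j r. j \<in> J \<Longrightarrow> R j \<le> r \<Longrightarrow> measure (N j) {u \<in> space (N j). r < norm u} \<le> \<epsilon>2"
    by metis
  define r where "r = (\<Sum>j\<in>J. \<bar>R j\<bar>)"
  have r: "R j \<le> r" if "j \<in> J" for j
    using member_le_sum[of j J "\<lambda>j. \<bar>R j\<bar>"] J that by (auto simp: r_def)
  define Q where "Q = (orthant :: (real ^ 'n) set) \<inter> cball 0 r"
  have Q: "compact Q" unfolding Q_def by (rule closed_Int_compact[OF closed_orthant compact_cball])
  have FQ: "continuous_on Q F" using F(1) by (rule continuous_on_subset) (auto simp: Q_def)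
  show thesis
  proof (rule compact_partition_approx[OF Q FQ \<epsilon>1(1)])
    fix C :: "(real ^ 'n) set" and \<phi> :: "real ^ 'n \<Rightarrow> real ^ 'n \<Rightarrow> real"
    assume C: "finite C" "C \<subseteq> Q" "\<And>c. continuous_on UNIV (\<phi> c)"
    "\<And>c u. (0::real) \<le> \<phi> c u" "\<And>u. (\<Sum>c\<in>C. \<phi> c u) \<le> 1" "\<And>c u. 1 < dist u c \<Longrightarrow> \<phi> c u = 0"
    "\<And>u. u \<in> Q \<Longrightarrow> norm (F u - (\<Sum>c\<in>C. \<phi> c u *\<^sub>R F c)) \<le> \<epsilon>1"
    \<comment> \<open>The first term is the uniform error on \<open>Q\<close> and the second the
      crude error outside. The choices of \<epsilon>1 and \<epsilon>2 make each contribute at most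
      \<open>\<epsilon> / 2\<close> to the integral.\<close>
    define e where "e u = \<epsilon>1 + 2 * B * indicat_real {u. r < norm u} u" for u :: "real ^ 'n"
    have ind: "integrable (N j) (indicat_real {u. r < norm u})"
      "(\<integral>u. indicat_real {u. r < norm u} u \<partial>N j) \<le> \<epsilon>2" if j: "j \<in> J" for j
    proof -
      interpret finite_measure "N j" using N j by auto
      have [measurable]: "(\<lambda>u. norm u) \<in> borel_measurable (N j)"
        by (rule borel_measurable_orthant[OF N(1)[OF j]]) (intro continuous_intros)
      have [measurable]: "{u \<in> space (N j). r < norm u} \<in> sets (N j)" by measurable
      have eq: "indicat_real {u. r < norm u} u = indicat_real {u \<in> space (N j). r < norm u} u"
        if "u \<in> space (N j)" for u using that by (auto simp: indicator_def)
      show "integrable (N j) (indicat_real {u. r < norm u})"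
        by (subst Bochner_Integration.integrable_cong[OF refl eq]) (auto simp: emeasure_eq_measure)
      show "(\<integral>u. indicat_real {u. r < norm u} u \<partial>N j) \<le> \<epsilon>2"
        by (subst Bochner_Integration.integral_cong[OF refl eq]) (use R[OF j r[OF j]] in auto)
    qed
    show thesis
    proof (rule that[of C \<phi> "r + 1" e])
      show "C \<subseteq> orthant" using C(2) by (auto simp: Q_def)
      show "\<phi> c u = 0" if "c \<in> C" "r + 1 < norm u" for c u
      proof (rule C(6))
        have "norm c \<le> r" using that(1) C(2) by (auto simp: Q_def)
        then show "1 < dist u c" using that(2) norm_triangle_ineq2[of u c] by (simp add: dist_norm)
      qed
      show "norm (F u - (\<Sum>c\<in>C. \<phi> c u *\<^sub>R F c)) \<le> e u" if u: "u \<in> orthant" for u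
      proof (cases "u \<in> Q")
        case True
        then show ?thesis using C(7)[OF True] B by (auto simp: e_def Q_def)
      next
        case False
        have "norm (\<Sum>c\<in>C. \<phi> c u *\<^sub>R F c) \<le> (\<Sum>c\<in>C. \<phi> c u * B)"
        proof (rule order_trans[OF norm_sum], rule sum_mono)
          fix c assume "c \<in> C"
          then have "norm (F c) \<le> B" using C(2) F(2) by (auto simp: Q_def)
          then show "norm (\<phi> c u *\<^sub>R F c) \<le> \<phi> c u * B" using C(4) by (simp add: mult_left_mono)
        qed
        also have "\<dots> \<le> B" using mult_right_mono[OF C(5) B] by (simp add: sum_distrib_right)
        finally have "norm (F u - (\<Sum>c\<in>C. \<phi> c u *\<^sub>R F c)) \<le> 2 * B"
          using F(2)[OF u] norm_triangle_ineq4[of "F u" "\<Sum>c\<in>C. \<phi> c u *\<^sub>R F c"] by linarith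
        then show ?thesis using False u \<epsilon>1 by (simp add: e_def Q_def not_le)
      qed
      fix j assume j: "j \<in> J"
      interpret finite_measure "N j" using N j by auto
      show "integrable (N j) e" unfolding e_def using ind(1)[OF j] by auto
      have "(\<integral>u. e u \<partial>N j) = \<epsilon>1 * measure (N j) (space (N j)) +
          2 * B * (\<integral>u. indicat_real {u. r < norm u} u \<partial>N j)"
        unfolding e_def using ind(1)[OF j] by (subst Bochner_Integration.integral_add) auto
      also have "\<dots> \<le> \<epsilon>1 * m + 2 * B * \<epsilon>2"
        using \<epsilon>1(1) B ind(2)[OF j] j J
        by (intro add_mono mult_left_mono) (auto simp: m_def intro!: member_le_sum)
      also have "\<dots> \<le> \<epsilon>" using \<epsilon>1 \<epsilon>2 by simp
      finally show "(\<integral>u. e u \<partial>N j) \<le> \<epsilon>" .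
    qed (use C in auto)
  qed
qed

section \<open>Existence of Bochner integrals of bounded continuous functions\<close>

text \<open>Simple functions at L1 distance \<open>1 / (k + 1)\<close> from \<open>F\<close> have
  integrals that form a Cauchy sequence, so completeness of the target space provides the
  value.\<close>

lemma has_bochner_exists_if_simple_approx:
  fixes F :: "'a \<Rightarrow> 'x::banach"
  assumes N: "finite_measure N" and F: "F \<in> borel_measurable N"
    and approx: "\<And>\<epsilon>. 0 < \<epsilon> \<Longrightarrow> \<exists>s. simple_function N s \<and>
      (\<integral>\<^sup>+u. ennreal (norm (F u - s u)) \<partial>N) \<le> ennreal \<epsilon>"
  shows "\<exists>y. has_bochner N F y"
proof -
  have "\<exists>s. simple_function N s \<and>
      (\<integral>\<^sup>+u. ennreal (norm (F u - s u)) \<partial>N) \<le> ennreal (inverse (real (Suc k)))" for k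
    by (rule approx) simp
  then obtain s where s: "\<And>k. simple_function N (s k)" and
    le: "\<And>k. (\<integral>\<^sup>+u. ennreal (norm (F u - s k u)) \<partial>N) \<le> ennreal (inverse (real (Suc k)))"
    by metis
  have int: "integrable N (\<lambda>u. norm (F u - s k u))" for k
    using measurable_norm_diff_simple[OF F s] order_le_less_trans[OF le[of k] ennreal_less_top]
    by (intro integrableI_bounded) auto
  have le': "(\<integral>u. norm (F u - s k u) \<partial>N) \<le> inverse (real (Suc k))" for k
    using le[of k] nn_integral_eq_integral[OF int] by simp
  define Y where "Y k = Bochner_Integration.simple_bochner_integral N (s k)" for k
  have dist: "norm (Y k - Y l) \<le> inverse (real (Suc k)) + inverse (real (Suc l))" for k l
  proof -
    define f where "f c = indicat_real {v \<in> space N. s l v = c}" for c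
    interpret finite_measure N by fact
    have fin: "finite (s l ` space N)" using s by (rule simple_functionD)
    have f: "integrable N (f c)" for c
      unfolding f_def using simple_function_level_set[OF s]
      by (intro integrable_real_indicator) (auto simp: emeasure_eq_measure)
    have "norm (Y k - (\<Sum>c\<in>s l ` space N. (\<integral>u. f c u \<partial>N) *\<^sub>R c)) \<le>
        (\<integral>u. norm (F u - s k u) + norm (F u - s l u) \<partial>N)"
      unfolding Y_def
    proof (rule norm_simple_bochner_integral_diff_le[OF N s fin f])
      show "integrable N (\<lambda>u. norm (F u - s k u) + norm (F u - s l u))" using int by simp
      fix u assume u: "u \<in> space N"
      have "norm (s k u - s l u) \<le> norm (F u - s k u) + norm (F u - s l u)"
        using norm_triangle_ineq4[of "F u - s l u" "F u - s k u"] by simp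
      then show "norm (s k u - (\<Sum>c\<in>s l ` space N. f c u *\<^sub>R c)) \<le> norm (F u - s k u) + norm (F u - s l u)"
        unfolding f_def simple_function_expand[OF s u, of l, symmetric] .
    qed
    also have "(\<Sum>c\<in>s l ` space N. (\<integral>u. f c u \<partial>N) *\<^sub>R c) = Y l"
      unfolding Y_def f_def simple_bochner_integral_expand[OF N s] ..
    finally show ?thesis using le'[of k] le'[of l] int by (simp add: Bochner_Integration.integral_add)
  qed
  have "Cauchy Y"
  proof (rule metric_CauchyI)
    fix \<epsilon> :: real assume "0 < \<epsilon>"
    then obtain n where n: "inverse (real (Suc n)) < \<epsilon> / 2"
      using reals_Archimedean[of "\<epsilon> / 2"] by auto
    have "dist (Y k) (Y l) < \<epsilon>" if "k \<ge> n" "l \<ge> n" for k l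
    proof -
      have "inverse (real (Suc k)) \<le> inverse (real (Suc n))" "inverse (real (Suc l)) \<le> inverse (real (Suc n))"
        using that by (auto intro!: le_imp_inverse_le)
      then show ?thesis using dist[of k l] n unfolding dist_norm by linarith
    qed
    then show "\<exists>M. \<forall>k\<ge>M. \<forall>l\<ge>M. dist (Y k) (Y l) < \<epsilon>" by blast
  qed
  then obtain y where y: "Y \<longlonglongrightarrow> y" using Cauchy_convergent_iff convergent_def by blast
  have "(\<lambda>k. ennreal (inverse (real (Suc k)))) \<longlonglongrightarrow> ennreal 0"
    by (rule tendsto_ennrealI[OF LIMSEQ_inverse_real_of_nat])
  then have "(\<lambda>k. ennreal (inverse (real (Suc k)))) \<longlonglongrightarrow> 0" by simp
  with le have "(\<lambda>k. \<integral>\<^sup>+u. ennreal (norm (F u - s k u)) \<partial>N) \<longlonglongrightarrow> 0"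
    by (rule tendsto_sandwich[OF always_eventually[OF allI] always_eventually[OF allI] tendsto_const, OF zero_le])
  with y F s N have "has_bochner N F y"
    unfolding has_bochner_def Y_def by (intro conjI exI[of _ s] allI simple_bochner_integrable_finite_measure)
  then show ?thesis ..
qed

lemma integral_sum_abs_le_const:
  assumes "finite C" and "\<And>c. c \<in> C \<Longrightarrow> (\<integral>u. \<bar>f c u\<bar> \<partial>N) \<le> (\<epsilon>::real)"
    and "\<And>c. c \<in> C \<Longrightarrow> integrable N (f c)"
  shows "(\<integral>u. (\<Sum>c\<in>C. \<bar>f c u\<bar> * w c) \<partial>N) \<le> \<epsilon> * (\<Sum>c\<in>C. \<bar>w c\<bar>)"
proof -
  have "(\<integral>u. (\<Sum>c\<in>C. \<bar>f c u\<bar> * w c) \<partial>N) = (\<Sum>c\<in>C. (\<integral>u. \<bar>f c u\<bar> \<partial>N) * w c)"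
    using assms by (subst Bochner_Integration.integral_sum) auto
  also have "\<dots> \<le> (\<Sum>c\<in>C. \<epsilon> * \<bar>w c\<bar>)"
  proof (rule sum_mono)
    fix c assume c: "c \<in> C"
    have "(\<integral>u. \<bar>f c u\<bar> \<partial>N) * w c \<le> (\<integral>u. \<bar>f c u\<bar> \<partial>N) * \<bar>w c\<bar>"
      by (intro mult_left_mono) auto
    also have "\<dots> \<le> \<epsilon> * \<bar>w c\<bar>" using assms(2)[OF c] by (rule mult_right_mono) simp
    finally show "(\<integral>u. \<bar>f c u\<bar> \<partial>N) * w c \<le> \<epsilon> * \<bar>w c\<bar>" .
  qed
  finally show ?thesis by (simp add: sum_distrib_left)
qed

text \<open>Continuity on the orthant replaces separability of the target: \<open>F\<close> is close
  to a finite sum with continuous scalar coefficients, and those are close in L1 to simple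
  functions.\<close>

lemma has_bochner_orthant_exists:
  fixes F :: "real ^ 'n::finite \<Rightarrow> 'x::banach"
  assumes N: "orthant_measure N" "finite_measure N"
    and F: "continuous_on orthant F" "\<And>u. u \<in> orthant \<Longrightarrow> norm (F u) \<le> B"
  shows "\<exists>y. has_bochner N F y"
proof (rule has_bochner_exists_if_simple_approx[OF N(2) borel_measurable_orthant[OF N(1) F(1)]])
  fix \<epsilon> :: real assume "0 < \<epsilon>"
  then have half: "0 < \<epsilon> / 2" by simp
  have N1: "finite {N}" "\<And>M. M \<in> {N} \<Longrightarrow> orthant_measure M" "\<And>M. M \<in> {N} \<Longrightarrow> finite_measure M"
    using N by auto
  show "\<exists>s. simple_function N s \<and> (\<integral>\<^sup>+u. ennreal (norm (F u - s u)) \<partial>N) \<le> ennreal \<epsilon>"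
  proof (rule orthant_partition_approx[of "{N}" "\<lambda>M. M", OF N1 F half])
    fix C :: "(real ^ 'n) set" and \<phi> :: "real ^ 'n \<Rightarrow> real ^ 'n \<Rightarrow> real" and R and e :: "real ^ 'n \<Rightarrow> real"
    assume C: "finite C" "C \<subseteq> orthant" "\<And>c. continuous_on UNIV (\<phi> c)"
    "\<And>c u. (0::real) \<le> \<phi> c u" "\<And>u. (\<Sum>c\<in>C. \<phi> c u) \<le> 1"
    "\<And>c u. c \<in> C \<Longrightarrow> R < norm u \<Longrightarrow> \<phi> c u = 0"
    and approx: "\<And>u. u \<in> orthant \<Longrightarrow> norm (F u - (\<Sum>c\<in>C. \<phi> c u *\<^sub>R F c)) \<le> e u"
    and e': "\<And>M. M \<in> {N} \<Longrightarrow> integrable M e" "\<And>M. M \<in> {N} \<Longrightarrow> (\<integral>u. e u \<partial>M) \<le> \<epsilon> / 2"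
    have e: "integrable N e" "(\<integral>u. e u \<partial>N) \<le> \<epsilon> / 2" using e' by auto
    have int: "integrable N (\<phi> c)" if "c \<in> C" for c
    proof (rule integrable_orthant[OF N])
      show "continuous_on orthant (\<phi> c)" using C(3) by (rule continuous_on_subset) simp
      show "norm (\<phi> c u) \<le> 1" for u
        using order_trans[OF member_le_sum[of c C "\<lambda>c. \<phi> c u"] C(5)[of u]] C(1,4) that by simp
    qed
    define W where "W = (\<Sum>c\<in>C. \<bar>norm (F c)\<bar>)"
    have W: "0 \<le> W" unfolding W_def by (simp add: sum_nonneg)
    \<comment> \<open>Half of \<epsilon> is spent on the partition of unity; the other half bounds
      the cost \<open>\<delta> * W\<close> of making the coefficients simple.\<close>
    define \<delta> where "\<delta> = \<epsilon> / (2 * (W + 1))"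
    have \<delta>: "0 < \<delta>" "\<delta> * W \<le> \<epsilon> / 2" using \<open>0 < \<epsilon>\<close> W by (auto simp: \<delta>_def field_simps)
    have "\<exists>g. Bochner_Integration.simple_bochner_integrable N g \<and> integrable N g \<and>
      (\<integral>u. \<bar>\<phi> c u - g u\<bar> \<partial>N) \<le> \<delta>" if "c \<in> C" for c
      using integrable_L1_simple_approx[OF int[OF that] \<delta>(1)] by metis
    then obtain g where g: "\<And>c. c \<in> C \<Longrightarrow> Bochner_Integration.simple_bochner_integrable N (g c)"
      "\<And>c. c \<in> C \<Longrightarrow> integrable N (g c)"
      "\<And>c. c \<in> C \<Longrightarrow> (\<integral>u. \<bar>\<phi> c u - g c u\<bar> \<partial>N) \<le> \<delta>"
      by metis
    define s where "s u = (\<Sum>c\<in>C. g c u *\<^sub>R F c)" for u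
    have sf: "simple_function N s"
      using simple_bochner_sum_scaleR(1)[of C N g F] C(1) g(1) unfolding s_def
      by (auto elim: simple_bochner_integrable.cases)
    have "(\<integral>\<^sup>+u. ennreal (norm (F u - s u)) \<partial>N) \<le>
        (\<integral>\<^sup>+u. ennreal (e u + (\<Sum>c\<in>C. \<bar>\<phi> c u - g c u\<bar> * norm (F c))) \<partial>N)"
    proof (intro nn_integral_mono ennreal_leI)
      fix u assume "u \<in> space N"
      then have u: "u \<in> orthant" using N by (simp add: space_orthant_measure)
      have "F u - s u = (F u - (\<Sum>c\<in>C. \<phi> c u *\<^sub>R F c)) + (\<Sum>c\<in>C. (\<phi> c u - g c u) *\<^sub>R F c)"
        unfolding s_def by (simp add: scaleR_diff_left sum_subtractf)
      also have "norm \<dots> \<le> e u + norm (\<Sum>c\<in>C. (\<phi> c u - g c u) *\<^sub>R F c)"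
        using norm_triangle_ineq approx[OF u] by (meson add_right_mono order_trans)
      also have "norm (\<Sum>c\<in>C. (\<phi> c u - g c u) *\<^sub>R F c) \<le> (\<Sum>c\<in>C. \<bar>\<phi> c u - g c u\<bar> * norm (F c))"
        by (rule order_trans[OF norm_sum]) simp
      finally show "norm (F u - s u) \<le> e u + (\<Sum>c\<in>C. \<bar>\<phi> c u - g c u\<bar> * norm (F c))" by simp
    qed
    also have "\<dots> = ennreal (\<integral>u. e u + (\<Sum>c\<in>C. \<bar>\<phi> c u - g c u\<bar> * norm (F c)) \<partial>N)"
    proof (rule nn_integral_eq_integral)
      show "integrable N (\<lambda>u. e u + (\<Sum>c\<in>C. \<bar>\<phi> c u - g c u\<bar> * norm (F c)))"
        using e(1) int g(2) by auto
      show "AE u in N. 0 \<le> e u + (\<Sum>c\<in>C. \<bar>\<phi> c u - g c u\<bar> * norm (F c))"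
      proof (rule AE_I2)
        fix u assume "u \<in> space N"
        then have "0 \<le> e u" using approx[of u] N norm_ge_zero order_trans
          by (metis space_orthant_measure)
        then show "0 \<le> e u + (\<Sum>c\<in>C. \<bar>\<phi> c u - g c u\<bar> * norm (F c))"
          by (simp add: sum_nonneg)
      qed
    qed
    also have "(\<integral>u. e u + (\<Sum>c\<in>C. \<bar>\<phi> c u - g c u\<bar> * norm (F c)) \<partial>N) \<le> \<epsilon>"
    proof -
      have "(\<integral>u. e u + (\<Sum>c\<in>C. \<bar>\<phi> c u - g c u\<bar> * norm (F c)) \<partial>N) =
          (\<integral>u. e u \<partial>N) + (\<integral>u. (\<Sum>c\<in>C. \<bar>\<phi> c u - g c u\<bar> * norm (F c)) \<partial>N)"
        using e(1) int g(2) by (intro Bochner_Integration.integral_add) auto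
      also have "(\<integral>u. (\<Sum>c\<in>C. \<bar>\<phi> c u - g c u\<bar> * norm (F c)) \<partial>N) \<le> \<delta> * W"
        unfolding W_def using C(1) g(3) int g(2) by (intro integral_sum_abs_le_const) auto
      finally show ?thesis using \<delta>(2) e(2) by simp
    qed
    finally have "(\<integral>\<^sup>+u. ennreal (norm (F u - s u)) \<partial>N) \<le> ennreal \<epsilon>" by (simp add: ennreal_leI)
    with sf show "\<exists>s. simple_function N s \<and> (\<integral>\<^sup>+u. ennreal (norm (F u - s u)) \<partial>N) \<le> ennreal \<epsilon>"
      by blast
  qed
qed

section \<open>Real exponential polynomials\<close>

text \<open>The set of exponents is a parameter because polynomials in the functions
  \<open>exp (- u $ i)\<close> have exponents with vanishing coordinates; they enter the class for
  \<open>neg_orthant\<close> only after multiplication by a strictly decaying exponential.\<close>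

definition real_exp_polys :: "(real ^ 'n) set \<Rightarrow> (real ^ 'n::finite \<Rightarrow> real) set" where
  "real_exp_polys S = {p. \<exists>(m::nat) c s. (\<forall>j<m. s j \<in> S) \<and> p = (\<lambda>r. \<Sum>j<m. c j * exp (s j \<bullet> r))}"

lemma real_exp_polysI:
  assumes J: "finite J" and s: "\<And>j. j \<in> J \<Longrightarrow> s j \<in> S"
    and p: "\<And>r. p r = (\<Sum>j\<in>J. c j * exp (s j \<bullet> r))"
  shows "p \<in> real_exp_polys S"
proof -
  obtain h where h: "bij_betw h {0..<card J} J" using ex_bij_betw_nat_finite[OF J] by blast
  have "p = (\<lambda>r. \<Sum>j<card J. c (h j) * exp (s (h j) \<bullet> r))"
  proof
    fix r
    show "p r = (\<Sum>j<card J. c (h j) * exp (s (h j) \<bullet> r))"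
      using sum.reindex_bij_betw[OF h, of "\<lambda>j. c j * exp (s j \<bullet> r)"] p[of r]
      by (simp add: atLeast0LessThan)
  qed
  moreover have "s (h j) \<in> S" if "j < card J" for j
    using s bij_betwE[OF h] that by auto
  ultimately show ?thesis
    unfolding real_exp_polys_def by (auto intro!: exI[of _ "card J"] exI[of _ "\<lambda>j. c (h j)"] exI[of _ "\<lambda>j. s (h j)"])
qed

lemma real_exp_polysE:
  assumes "p \<in> real_exp_polys S"
  obtains m c s where "\<forall>j<m::nat. s j \<in> S" "p = (\<lambda>r. \<Sum>j<m. c j * exp (s j \<bullet> r))"
  using assms unfolding real_exp_polys_def by auto

lemma real_exp_polys_add:
  assumes "p \<in> real_exp_polys S" and "q \<in> real_exp_polys S"
  shows "(\<lambda>r. p r + q r) \<in> real_exp_polys S"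
proof -
  obtain m c s where p: "\<forall>j<m::nat. s j \<in> S" "p = (\<lambda>r. \<Sum>j<m. c j * exp (s j \<bullet> r))"
    using assms(1) by (rule real_exp_polysE)
  note p = p(1)[rule_format] p(2)
  obtain n d t where q: "\<forall>j<n::nat. t j \<in> S" "q = (\<lambda>r. \<Sum>j<n. d j * exp (t j \<bullet> r))"
    using assms(2) by (rule real_exp_polysE)
  note q = q(1)[rule_format] q(2)
  show ?thesis
  proof (rule real_exp_polysI[of "{..<m} <+> {..<n}" "case_sum s t" S _ "case_sum c d"])
    show "p r + q r = (\<Sum>j\<in>{..<m} <+> {..<n}. case_sum c d j * exp (case_sum s t j \<bullet> r))" for r
      unfolding p(2) q(2) by (simp add: sum.Plus)
  qed (use p q in auto)
qed

lemma real_exp_polys_mult: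
  assumes "p \<in> real_exp_polys S" and "q \<in> real_exp_polys T"
    and ST: "\<And>s t. s \<in> S \<Longrightarrow> t \<in> T \<Longrightarrow> s + t \<in> U"
  shows "(\<lambda>r. p r * q r) \<in> real_exp_polys U"
proof -
  obtain m c s where p: "\<forall>j<m::nat. s j \<in> S" "p = (\<lambda>r. \<Sum>j<m. c j * exp (s j \<bullet> r))"
    using assms(1) by (rule real_exp_polysE)
  note p = p(1)[rule_format] p(2)
  obtain n d t where q: "\<forall>j<n::nat. t j \<in> T" "q = (\<lambda>r. \<Sum>j<n. d j * exp (t j \<bullet> r))"
    using assms(2) by (rule real_exp_polysE)
  note q = q(1)[rule_format] q(2)
  show ?thesis
  proof (rule real_exp_polysI[of "{..<m} \<times> {..<n}" "\<lambda>(i, j). s i + t j" U _ "\<lambda>(i, j). c i * d j"])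
    show "p r * q r = (\<Sum>k\<in>{..<m} \<times> {..<n}. (case k of (i, j) \<Rightarrow> c i * d j) *
        exp ((case k of (i, j) \<Rightarrow> s i + t j) \<bullet> r))" for r
      unfolding p(2) q(2) sum_product sum.cartesian_product
      by (intro sum.cong) (auto simp: inner_add_left exp_add)
  qed (use p q ST in auto)
qed

lemma real_exp_polys_monomial: "s \<in> S \<Longrightarrow> (\<lambda>r. c * exp (s \<bullet> r)) \<in> real_exp_polys S"
  by (rule real_exp_polysI[of "{()}" "\<lambda>_. s" S _ "\<lambda>_. c"]) auto

text \<open>Each coordinate \<open>exp (- u $ i)\<close> is an exponential with exponent
  \<open>- axis i 1\<close>, and the exponents of a product add up, so the closed nonpositive cone
  is never left.\<close>

lemma real_polynomial_of_exp:
  fixes g :: "real ^ 'n::finite \<Rightarrow> real"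
  assumes "real_polynomial_function g"
  shows "(\<lambda>u. g (\<chi> i. exp (- (u $ i)))) \<in> real_exp_polys {s. \<forall>i. s $ i \<le> 0}"
  using assms
proof induction
  case (linear f)
  interpret bounded_linear f by fact
  show ?case
  proof (rule real_exp_polysI[of UNIV "\<lambda>i. - axis i 1" _ _ "\<lambda>i. f (axis i 1)"])
    fix u :: "real ^ 'n"
    have "(\<chi> i. exp (- (u $ i))) = (\<Sum>i\<in>UNIV. exp (- (u $ i)) *\<^sub>R axis i 1)"
      by (subst basis_expansion[symmetric]) (simp add: scalar_mult_eq_scaleR)
    then have "f (\<chi> i. exp (- (u $ i))) = (\<Sum>i\<in>UNIV. exp (- (u $ i)) *\<^sub>R f (axis i 1))"
      by (simp add: sum scale)
    then show "f (\<chi> i. exp (- (u $ i))) = (\<Sum>i\<in>UNIV. f (axis i 1) * exp (- axis i 1 \<bullet> u))"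
      by (simp add: inner_axis' mult.commute)
  qed (auto simp: axis_def)
next
  case (const c)
  show ?case using real_exp_polys_monomial[of 0 "{s. \<forall>i. s $ i \<le> 0}" c] by simp
next
  case (add f g)
  then show ?case by (intro real_exp_polys_add)
next
  case (mult f g)
  show ?case
    by (rule real_exp_polys_mult[OF mult.IH]) (simp add: add_nonpos_nonpos)
qed

lemma exp_neg_orthant_le_1:
  assumes "s \<in> neg_orthant" and "u \<in> orthant"
  shows "exp (s \<bullet> u) \<le> 1"
proof -
  have "s \<bullet> u \<le> 0"
    using assms unfolding inner_vec_def neg_orthant_def orthant_def
    by (auto intro!: sum_nonpos mult_nonpos_nonneg simp: less_imp_le)
  then show ?thesis by simp
qed

text \<open>In the coordinates \<open>x\<^sub>i = exp (- u\<^sub>i)\<close> the function \<open>f / (x\<^sub>1 \<cdots> x\<^sub>n)\<close> is continuous on the unit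
  cube, and \<open>x\<^sub>1 \<cdots> x\<^sub>n\<close> times an approximating polynomial only involves strictly negative exponents.\<close>

lemma compact_support_approx_exp_poly:
  fixes f :: "real ^ 'n::finite \<Rightarrow> real"
  assumes cont: "continuous_on UNIV f" and supp: "\<And>u. R < norm u \<Longrightarrow> f u = 0" and "0 < \<epsilon>"
  obtains p where "p \<in> real_exp_polys neg_orthant" "\<And>u. u \<in> orthant \<Longrightarrow> \<bar>f u - p u\<bar> \<le> \<epsilon>"
proof -
  \<comment> \<open>The margin 1 puts the truncation level strictly above \<open>R\<close>, so
    \<open>f\<close> vanishes wherever a coordinate reaches \<open>R'\<close>.\<close>
  define R' where "R' = max R 0 + 1"
  define \<eta> where "\<eta> = exp (- R')"
  have \<eta>: "0 < \<eta>" by (simp add: \<eta>_def)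
  \<comment> \<open>\<open>w\<close> inverts \<open>X\<close> as long as no coordinate exceeds
    \<open>R'\<close>. The cut-off at \<eta> keeps the logarithm continuous on the faces
    \<open>x $ i = 0\<close> of the cube, which correspond to infinity in the orthant.\<close>
  define w :: "real ^ 'n \<Rightarrow> real ^ 'n" where "w x = (\<chi> i. - ln (max (x $ i) \<eta>))" for x
  define X :: "real ^ 'n \<Rightarrow> real ^ 'n" where "X u = (\<chi> i. exp (- (u $ i)))" for u
  define f' where "f' x = f (w x) / (\<Prod>i\<in>UNIV. max (x $ i) \<eta>)" for x
  have pos: "0 < max (x $ i) \<eta>" for x :: "real ^ 'n" and i using \<eta> by simp
  have ppos: "(\<Prod>i\<in>UNIV. max (x $ i) \<eta>) \<noteq> 0" for x :: "real ^ 'n"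
    using pos by (metis (no_types, lifting) less_irrefl prod_pos)
  have "continuous_on (cbox 0 1) w"
    unfolding w_def using pos by (intro continuous_intros) (metis less_irrefl)
  then have "continuous_on (cbox 0 1) (\<lambda>x. f (w x))"
    by (rule continuous_on_compose2[OF cont]) simp
  then have cf: "continuous_on (cbox 0 1) f'"
    unfolding f'_def using ppos by (intro continuous_intros) auto
  obtain g where g: "real_polynomial_function g" "\<And>x. x \<in> cbox 0 1 \<Longrightarrow> \<bar>f' x - g x\<bar> < \<epsilon>"
    using Stone_Weierstrass_real_polynomial_function[OF compact_cbox cf \<open>0 < \<epsilon>\<close>] by blast
  define e where "e = (- 1 :: real ^ 'n)"
  have e: "exp (e \<bullet> u) = (\<Prod>i\<in>UNIV. exp (- (u $ i)))" for u
    by (simp add: e_def inner_vec_def exp_sum)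
  have en: "e \<in> neg_orthant" by (simp add: e_def neg_orthant_def)
  show thesis
  proof (rule that[of "\<lambda>u. 1 * exp (e \<bullet> u) * g (X u)"])
    show "(\<lambda>u. 1 * exp (e \<bullet> u) * g (X u)) \<in> real_exp_polys neg_orthant"
      unfolding X_def
    proof (rule real_exp_polys_mult[OF real_exp_polys_monomial real_polynomial_of_exp[OF g(1)], OF en])
      show "s + t \<in> neg_orthant" if "s \<in> neg_orthant" "t \<in> {s. \<forall>i. s $ i \<le> 0}" for s t :: "real ^ 'n"
        using that by (auto simp: neg_orthant_def intro: add_neg_nonpos)
    qed
    fix u :: "real ^ 'n" assume u: "u \<in> orthant"
    have Xc: "X u \<in> cbox 0 1" using u by (auto simp: X_def mem_box_cart orthant_def)
    \<comment> \<open>If a coordinate of \<open>u\<close> exceeds \<open>R'\<close>, both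
      \<open>u\<close> and the truncated point \<open>w (X u)\<close> lie where \<open>f\<close> is
      zero; otherwise nothing was cut off and the product cancels.\<close>
    have f': "f u = exp (e \<bullet> u) * f' (X u)"
    proof (cases "\<forall>i. u $ i \<le> R'")
      case True
      then have "max (X u $ i) \<eta> = exp (- (u $ i))" for i by (auto simp: X_def \<eta>_def intro: max_absorb1)
      then show ?thesis by (simp add: f'_def w_def e)
    next
      case False
      then obtain i where i: "R' < u $ i" by (auto simp: not_le)
      have "R < u $ i" using i by (auto simp: R'_def)
      then have "R < norm u" using component_le_norm_cart[of u i] by linarith
      then have "f u = 0" by (rule supp)
      moreover have "max (X u $ i) \<eta> = \<eta>" using i by (auto simp: X_def \<eta>_def max_def)
      then have "w (X u) $ i = R'" by (simp add: w_def \<eta>_def)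
      then have "R < norm (w (X u))" using component_le_norm_cart[of "w (X u)" i] by (auto simp: R'_def)
      then have "f (w (X u)) = 0" by (rule supp)
      ultimately show ?thesis by (simp add: f'_def)
    qed
    have "\<bar>f u - 1 * exp (e \<bullet> u) * g (X u)\<bar> = exp (e \<bullet> u) * \<bar>f' (X u) - g (X u)\<bar>"
      unfolding f' by (simp add: right_diff_distrib[symmetric] abs_mult)
    also have "\<dots> \<le> 1 * \<epsilon>"
      using exp_neg_orthant_le_1[OF en u] g(2)[OF Xc] by (intro mult_mono) auto
    finally show "\<bar>f u - 1 * exp (e \<bullet> u) * g (X u)\<bar> \<le> \<epsilon>" by simp
  qed
qed

lemma real_exp_poly_bounded:
  assumes "p \<in> real_exp_polys neg_orthant"
  obtains B where "\<And>u. u \<in> orthant \<Longrightarrow> \<bar>p u\<bar> \<le> B"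
proof -
  obtain m c s where p: "\<forall>j<m::nat. s j \<in> neg_orthant" "p = (\<lambda>r. \<Sum>j<m. c j * exp (s j \<bullet> r))"
    using assms by (rule real_exp_polysE)
  note p = p(1)[rule_format] p(2)
  show thesis
  proof (rule that[of "\<Sum>j<m. \<bar>c j\<bar>"])
    fix u :: "real ^ 'a" assume u: "u \<in> orthant"
    have "\<bar>p u\<bar> \<le> (\<Sum>j<m. \<bar>c j * exp (s j \<bullet> u)\<bar>)" unfolding p(2) by (rule sum_abs)
    also have "\<dots> \<le> (\<Sum>j<m. \<bar>c j\<bar>)"
      using exp_neg_orthant_le_1[OF p(1) u] by (intro sum_mono) (simp add: abs_mult mult_left_le)
    finally show "\<bar>p u\<bar> \<le> (\<Sum>j<m. \<bar>c j\<bar>)" .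
  qed
qed

lemma real_exp_poly_continuous: "p \<in> real_exp_polys S \<Longrightarrow> continuous_on T p"
  by (erule real_exp_polysE) (auto intro!: continuous_intros)

lemma real_exp_poly_integrable:
  assumes "orthant_measure N" and "finite_measure N" and "p \<in> real_exp_polys neg_orthant"
  shows "integrable N p"
  using real_exp_poly_bounded[OF assms(3)]
  by (metis assms integrable_orthant real_exp_poly_continuous real_norm_def)

text \<open>The hypothesis \<open>bound\<close> says that the total variation of the signed measure \<open>\<Sum> a\<^sub>j N\<^sub>j\<close> is at
  most \<open>C\<close>.\<close>

lemma norm_sum_bochner_le_of_exp_poly_bound:
  fixes F :: "real ^ 'n::finite \<Rightarrow> 'x::banach" and N :: "'j \<Rightarrow> (real ^ 'n) measure"
  assumes J: "finite J"
    and N: "\<And>j. j \<in> J \<Longrightarrow> orthant_measure (N j)" "\<And>j. j \<in> J \<Longrightarrow> finite_measure (N j)"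
    and bound: "\<And>p B. p \<in> real_exp_polys neg_orthant \<Longrightarrow> (\<And>u. u \<in> orthant \<Longrightarrow> \<bar>p u\<bar> \<le> B) \<Longrightarrow>
      \<bar>\<Sum>j\<in>J. a j * (\<integral>u. p u \<partial>N j)\<bar> \<le> C * B"
    and "0 \<le> C"
    and F: "continuous_on orthant F" "\<And>u. u \<in> orthant \<Longrightarrow> norm (F u) \<le> B"
    and y: "\<And>j. j \<in> J \<Longrightarrow> has_bochner (N j) F (y j)"
  shows "norm (\<Sum>j\<in>J. a j *\<^sub>R y j) \<le> C * B"
proof (rule field_le_epsilon)
  fix \<delta> :: real assume "0 < \<delta>"
  have B: "0 \<le> B" using F(2)[OF zero_in_orthant] norm_ge_zero order_trans by blast
  define A where "A = (\<Sum>j\<in>J. \<bar>a j\<bar>)"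
  define A' where "A' = (\<Sum>j\<in>J. \<bar>a j\<bar> * measure (N j) (space (N j)))"
  have A: "0 \<le> A" "0 \<le> A'" unfolding A_def A'_def by (auto intro!: sum_nonneg)
  \<comment> \<open>The summands of \<open>D\<close> are the factors with which \<epsilon> enters
    the final estimate: from the norm \<open>1 + \<epsilon>\<close> of \<open>p\<close>, from
    replacing \<open>f\<close> by \<open>p\<close>, and from the partition of unity.\<close>
  define D where "D = B * C + B * A' + A + 1"
  have D: "0 < D" using A B \<open>0 \<le> C\<close> unfolding D_def by (simp add: add_nonneg_pos)
  define \<epsilon> where "\<epsilon> = \<delta> / D"
  have \<epsilon>: "0 < \<epsilon>" using D \<open>0 < \<delta>\<close> by (simp add: \<epsilon>_def)
  have \<epsilon>D: "\<epsilon> * (B * C + B * A' + A) \<le> \<delta>"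
  proof -
    have "\<epsilon> * (B * C + B * A' + A) \<le> \<epsilon> * D" using \<epsilon> by (intro mult_left_mono) (auto simp: D_def)
    then show ?thesis using D by (simp add: \<epsilon>_def)
  qed
  show "norm (\<Sum>j\<in>J. a j *\<^sub>R y j) \<le> C * B + \<delta>"
  proof (rule orthant_partition_approx[OF J N F \<epsilon>])
    fix P :: "(real ^ 'n) set" and \<phi> :: "real ^ 'n \<Rightarrow> real ^ 'n \<Rightarrow> real" and R and e :: "real ^ 'n \<Rightarrow> real"
    assume P: "finite P" "P \<subseteq> orthant" "\<And>c. continuous_on UNIV (\<phi> c)"
    "\<And>c u. (0::real) \<le> \<phi> c u" "\<And>u. (\<Sum>c\<in>P. \<phi> c u) \<le> 1"
    "\<And>c u. c \<in> P \<Longrightarrow> R < norm u \<Longrightarrow> \<phi> c u = 0"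
    and approx: "\<And>u. u \<in> orthant \<Longrightarrow> norm (F u - (\<Sum>c\<in>P. \<phi> c u *\<^sub>R F c)) \<le> e u"
    and e: "\<And>j. j \<in> J \<Longrightarrow> integrable (N j) e" "\<And>j. j \<in> J \<Longrightarrow> (\<integral>u. e u \<partial>N j) \<le> \<epsilon>"
    have int: "integrable (N j) (\<phi> c)" if "c \<in> P" "j \<in> J" for c j
    proof (rule integrable_orthant[OF N, OF that(2) that(2)])
      show "continuous_on orthant (\<phi> c)" using P(3) by (rule continuous_on_subset) simp
      show "norm (\<phi> c u) \<le> 1" for u
        using order_trans[OF member_le_sum[of c P "\<lambda>c. \<phi> c u"] P(5)[of u]] P(1,4) that by simp
    qed
    define L where "L f = (\<Sum>j\<in>J. a j * (\<integral>u. f u \<partial>N j))" for f :: "real ^ 'n \<Rightarrow> real"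
    \<comment> \<open>The signs turn \<open>L f\<close> into the sum of all
      \<open>\<bar>L (\<phi> c)\<bar>\<close>, while \<open>f\<close> is still bounded by 1 because
      the \<phi> sum to at most 1. One scalar test function thus controls the whole vector
      sum.\<close>
    define \<theta> where "\<theta> c = sgn (L (\<phi> c))" for c
    define f where "f u = (\<Sum>c\<in>P. \<theta> c * \<phi> c u)" for u
    have \<theta>: "\<bar>\<theta> c\<bar> \<le> 1" for c by (simp add: \<theta>_def sgn_if)
    have f1: "\<bar>f u\<bar> \<le> 1" for u
    proof -
      have "\<bar>f u\<bar> \<le> (\<Sum>c\<in>P. \<bar>\<theta> c * \<phi> c u\<bar>)" unfolding f_def by (rule sum_abs)
      also have "\<dots> \<le> (\<Sum>c\<in>P. \<phi> c u)"
        using \<theta> P(4) by (intro sum_mono) (simp add: abs_mult mult_left_le_one_le)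
      finally show ?thesis using P(5)[of u] by simp
    qed
    have "continuous_on UNIV f" unfolding f_def using P(3) by (intro continuous_intros)
    moreover have "f u = 0" if "R < norm u" for u unfolding f_def using P(6)[OF _ that] by simp
    ultimately obtain p where p: "p \<in> real_exp_polys neg_orthant" "\<And>u. u \<in> orthant \<Longrightarrow> \<bar>f u - p u\<bar> \<le> \<epsilon>"
      using compact_support_approx_exp_poly[OF _ _ \<epsilon>, of f R] by blast
    have "\<bar>p u\<bar> \<le> 1 + \<epsilon>" if "u \<in> orthant" for u
      using p(2)[OF that] f1[of u] by linarith
    then have Lp: "\<bar>L p\<bar> \<le> C * (1 + \<epsilon>)" unfolding L_def by (rule bound[OF p(1)])
    have fint: "integrable (N j) f" if "j \<in> J" for j unfolding f_def using int that by auto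
    have pint: "integrable (N j) p" if "j \<in> J" for j
      using real_exp_poly_integrable[OF N[OF that] p(1)] by simp
    have Lf: "L f = (\<Sum>c\<in>P. \<bar>L (\<phi> c)\<bar>)"
    proof -
      have "L f = (\<Sum>j\<in>J. \<Sum>c\<in>P. \<theta> c * (a j * (\<integral>u. \<phi> c u \<partial>N j)))"
        unfolding L_def f_def using int
        by (intro sum.cong refl) (simp add: sum_distrib_left Bochner_Integration.integral_sum algebra_simps)
      also have "\<dots> = (\<Sum>c\<in>P. \<theta> c * L (\<phi> c))"
        unfolding L_def by (subst sum.swap) (simp add: sum_distrib_left)
      also have "\<dots> = (\<Sum>c\<in>P. \<bar>L (\<phi> c)\<bar>)"
        unfolding \<theta>_def by (intro sum.cong refl) (simp add: linordered_idom_class.abs_sgn mult.commute)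
      finally show ?thesis .
    qed
    have "\<bar>L f - L p\<bar> \<le> \<epsilon> * A'"
    proof -
      have "L f - L p = (\<Sum>j\<in>J. a j * (\<integral>u. f u - p u \<partial>N j))"
        unfolding L_def using fint pint by (simp add: sum_subtractf[symmetric] right_diff_distrib)
      also have "\<bar>\<dots>\<bar> \<le> (\<Sum>j\<in>J. \<bar>a j\<bar> * (\<epsilon> * measure (N j) (space (N j))))"
      proof (rule order_trans[OF sum_abs], rule sum_mono)
        fix j assume j: "j \<in> J"
        interpret finite_measure "N j" using N(2)[OF j] .
        have "\<bar>\<integral>u. f u - p u \<partial>N j\<bar> \<le> (\<integral>u. \<bar>f u - p u\<bar> \<partial>N j)" by (rule integral_abs_bound)
        also have "\<dots> \<le> (\<integral>u. \<epsilon> \<partial>N j)"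
          using fint pint j p(2) space_orthant_measure[OF N(1)[OF j]] by (intro integral_mono) auto
        finally have "\<bar>\<integral>u. f u - p u \<partial>N j\<bar> \<le> \<epsilon> * measure (N j) (space (N j))" by (simp add: mult.commute)
        then show "\<bar>a j * (\<integral>u. f u - p u \<partial>N j)\<bar> \<le> \<bar>a j\<bar> * (\<epsilon> * measure (N j) (space (N j)))"
          by (simp add: abs_mult mult_left_mono)
      qed
      also have "\<dots> = \<epsilon> * A'" by (simp add: A'_def sum_distrib_left algebra_simps)
      finally show ?thesis .
    qed
    with Lp Lf have sumL: "(\<Sum>c\<in>P. \<bar>L (\<phi> c)\<bar>) \<le> C * (1 + \<epsilon>) + \<epsilon> * A'" by linarith
    have "norm (\<Sum>c\<in>P. L (\<phi> c) *\<^sub>R F c) \<le> (\<Sum>c\<in>P. \<bar>L (\<phi> c)\<bar> * B)"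
    proof (rule order_trans[OF norm_sum], rule sum_mono)
      fix c assume "c \<in> P"
      then have "norm (F c) \<le> B" using F(2) P(2) by auto
      then show "norm (L (\<phi> c) *\<^sub>R F c) \<le> \<bar>L (\<phi> c)\<bar> * B" by (simp add: mult_left_mono)
    qed
    also have "\<dots> \<le> (C * (1 + \<epsilon>) + \<epsilon> * A') * B"
      using sumL B by (simp add: sum_distrib_right[symmetric] mult_right_mono)
    finally have 1: "norm (\<Sum>c\<in>P. L (\<phi> c) *\<^sub>R F c) \<le> (C * (1 + \<epsilon>) + \<epsilon> * A') * B" .
    \<comment> \<open>Interchanging the sums turns the discrepancy into one comparison for each
      measure \<open>N j\<close>, and each of these costs at most \<epsilon>.\<close>
    have "(\<Sum>j\<in>J. a j *\<^sub>R y j) - (\<Sum>c\<in>P. L (\<phi> c) *\<^sub>R F c) =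
        (\<Sum>j\<in>J. a j *\<^sub>R (y j - (\<Sum>c\<in>P. (\<integral>u. \<phi> c u \<partial>N j) *\<^sub>R F c)))"
      unfolding L_def scaleR_sum_left
      by (subst sum.swap) (simp add: scaleR_diff_right scaleR_sum_right sum_subtractf)
    also have "norm \<dots> \<le> (\<Sum>j\<in>J. \<bar>a j\<bar> * \<epsilon>)"
    proof (rule order_trans[OF norm_sum], rule sum_mono)
      fix j assume j: "j \<in> J"
      have "norm (y j - (\<Sum>c\<in>P. (\<integral>u. \<phi> c u \<partial>N j) *\<^sub>R F c)) \<le> (\<integral>u. e u \<partial>N j)"
        using int[OF _ j] approx space_orthant_measure[OF N(1)[OF j]]
        by (intro has_bochner_norm_diff_le[OF N(2)[OF j] y[OF j] P(1) _ e(1)[OF j]]) auto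
      with e(2)[OF j] show "norm (a j *\<^sub>R (y j - (\<Sum>c\<in>P. (\<integral>u. \<phi> c u \<partial>N j) *\<^sub>R F c))) \<le> \<bar>a j\<bar> * \<epsilon>"
        by (simp add: mult_left_mono)
    qed
    also have "\<dots> = \<epsilon> * A" by (simp add: A_def sum_distrib_left mult.commute)
    finally have "norm (\<Sum>j\<in>J. a j *\<^sub>R y j) \<le> (C * (1 + \<epsilon>) + \<epsilon> * A') * B + \<epsilon> * A"
      using 1 norm_triangle_ineq2[of "\<Sum>j\<in>J. a j *\<^sub>R y j" "\<Sum>c\<in>P. L (\<phi> c) *\<^sub>R F c"] by linarith
    also have "\<dots> = C * B + \<epsilon> * (B * C + B * A' + A)" by (simp add: algebra_simps)
    finally show "norm (\<Sum>j\<in>J. a j *\<^sub>R y j) \<le> C * B + \<delta>" using \<epsilon>D by linarith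
  qed
qed

lemma has_bochner_integral_real:
  fixes f :: "'a \<Rightarrow> real"
  assumes "integrable N f"
  shows "has_bochner N f (\<integral>u. f u \<partial>N)"
  using has_bochner_integral_integrable[OF assms]
  unfolding has_bochner_integral.simps has_bochner_def by auto

section \<open>Uniqueness of measures with given Laplace transforms\<close>

text \<open>This is the total variation estimate with constant 0 for the signed measure
  \<open>N - N'\<close>, indexed by the booleans.\<close>

lemma integral_eq_of_exp_polys:
  fixes f :: "real ^ 'n::finite \<Rightarrow> real"
  assumes N: "orthant_measure N" "finite_measure N" and N': "orthant_measure N'" "finite_measure N'"
    and eq: "\<And>p. p \<in> real_exp_polys neg_orthant \<Longrightarrow> (\<integral>u. p u \<partial>N) = (\<integral>u. p u \<partial>N')"
    and f: "continuous_on orthant f" "\<And>u. u \<in> orthant \<Longrightarrow> \<bar>f u\<bar> \<le> B"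
  shows "(\<integral>u. f u \<partial>N) = (\<integral>u. f u \<partial>N')"
proof -
  define M where "M b = (if b then N else N')" for b
  define a where "a b = (if b then 1 else - 1 :: real)" for b
  have "norm (\<Sum>b\<in>UNIV. a b *\<^sub>R (\<integral>u. f u \<partial>M b)) \<le> 0 * B"
  proof (rule norm_sum_bochner_le_of_exp_poly_bound)
    show "has_bochner (M b) f (\<integral>u. f u \<partial>M b)" for b
      using integrable_orthant[OF N f(1), of B] integrable_orthant[OF N' f(1), of B] f(2)
      by (intro has_bochner_integral_real) (auto simp: M_def)
    show "norm (f u) \<le> B" if "u \<in> orthant" for u using f(2)[OF that] by simp
  qed (use f(1) N N' eq in \<open>auto simp: M_def a_def UNIV_bool\<close>)
  then show ?thesis by (simp add: M_def a_def UNIV_bool)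
qed

text \<open>The bounded continuous functions \<open>max 0 (1 - k * infdist u A)\<close> converge to
  the indicator of a closed set \<open>A\<close>. Hence the measures agree on closed subsets of the
  orthant, and closed sets are an intersection-stable generator.\<close>

lemma measure_eq_of_exp_polys:
  fixes N N' :: "(real ^ 'n::finite) measure"
  assumes N: "orthant_measure N" "finite_measure N" and N': "orthant_measure N'" "finite_measure N'"
    and eq: "\<And>p. p \<in> real_exp_polys neg_orthant \<Longrightarrow> (\<integral>u. p u \<partial>N) = (\<integral>u. p u \<partial>N')"
  shows "N = N'"
proof -
  have sets: "sets M = sets orthant_borel" "space M = orthant" if "orthant_measure M" for M :: "(real ^ 'n) measure"
    using that by (auto simp: orthant_measure_def)
  have meas: "(\<lambda>u. u) \<in> measurable M borel" if "orthant_measure M" for M :: "(real ^ 'n) measure"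
    using borel_measurable_orthant[OF that, of "\<lambda>u. u"] by (simp add: continuous_on_id)
  have closed_set: "closed A \<Longrightarrow> A \<inter> orthant \<in> sets M" if "orthant_measure M" for M :: "(real ^ 'n) measure" and A
    unfolding sets(1)[OF that] orthant_borel_def sets_restrict_space Int_commute[of A]
    by (intro imageI borel_closed)
  have lim: "(\<lambda>k. \<integral>u. max 0 (1 - real k * infdist u A) \<partial>M) \<longlonglongrightarrow> measure M (A \<inter> orthant)"
    if M: "orthant_measure M" "finite_measure M" and A: "closed A" "A \<noteq> {}" for M :: "(real ^ 'n) measure" and A
  proof -
    interpret finite_measure M by (rule M(2))
    have "(\<lambda>k. \<integral>u. max 0 (1 - real k * infdist u A) \<partial>M) \<longlonglongrightarrow> (\<integral>u. indicat_real (A \<inter> orthant) u \<partial>M)"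
    proof (rule integral_dominated_convergence[where w = "\<lambda>_. 1"])
      show "indicat_real (A \<inter> orthant) \<in> borel_measurable M"
        using closed_set[OF M(1) A(1)] by (rule borel_measurable_indicator)
      show "(\<lambda>u. max 0 (1 - real k * infdist u A)) \<in> borel_measurable M" for k
        by (rule borel_measurable_orthant[OF M(1)]) (intro continuous_intros)
      show "AE u in M. (\<lambda>k. max 0 (1 - real k * infdist u A)) \<longlonglongrightarrow> indicat_real (A \<inter> orthant) u"
      proof (rule AE_I2)
        fix u assume "u \<in> space M"
        then have u: "u \<in> orthant" using sets(2)[OF M(1)] by simp
        show "(\<lambda>k. max 0 (1 - real k * infdist u A)) \<longlonglongrightarrow> indicat_real (A \<inter> orthant) u"
        proof (cases "u \<in> A")
          case True
          then show ?thesis using u by simp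
        next
          case False
          then have pos: "0 < infdist u A" using A in_closed_iff_infdist_zero infdist_nonneg
            by (metis less_eq_real_def)
          obtain k0 :: nat where k0: "1 / infdist u A < real k0" using reals_Archimedean2 by blast
          have "max 0 (1 - real k * infdist u A) = 0" if "k \<ge> k0" for k
          proof -
            have "1 / infdist u A < real k" using k0 that by (meson less_le_trans of_nat_mono)
            then show ?thesis using pos by (simp add: field_simps)
          qed
          then have "\<forall>\<^sub>F k in sequentially. max 0 (1 - real k * infdist u A) = 0"
            by (auto simp: eventually_sequentially)
          then show ?thesis using False by (simp add: tendsto_eventually)
        qed
      qed
      show "AE u in M. norm (max 0 (1 - real k * infdist u A)) \<le> 1" for k
        by (simp add: infdist_nonneg)
    qed simp
    also have "(\<integral>u. indicat_real (A \<inter> orthant) u \<partial>M) = measure M (A \<inter> orthant)"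
      using closed_set[OF M(1) A(1)] by simp
    finally show ?thesis .
  qed
  have closed_eq: "measure N (A \<inter> orthant) = measure N' (A \<inter> orthant)" if A: "closed A" for A
  proof (cases "A = {}")
    case False
    have "(\<integral>u. max 0 (1 - real k * infdist u A) \<partial>N) = (\<integral>u. max 0 (1 - real k * infdist u A) \<partial>N')" for k
    proof (rule integral_eq_of_exp_polys[OF N N' eq, of _ 1])
      show "continuous_on orthant (\<lambda>u. max 0 (1 - real k * infdist u A))" by (intro continuous_intros)
      show "\<bar>max 0 (1 - real k * infdist u A)\<bar> \<le> 1" for u using infdist_nonneg[of u A] by auto
    qed
    with lim[OF N A False] lim[OF N' A False] show ?thesis using LIMSEQ_unique by fastforce
  qed simp
  \<comment> \<open>The measures are pushed to the whole space, where the Borel sets are generated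
    by closed sets; every measurable set of \<open>N\<close> is a trace on the orthant, so nothing
    is lost.\<close>
  define D where "D M = distr M borel (\<lambda>u. u)" for M :: "(real ^ 'n) measure"
  have DA: "emeasure (D M) A = emeasure M (A \<inter> orthant)" if "orthant_measure M" "A \<in> sets borel" for M A
    unfolding D_def using that meas by (simp add: emeasure_distr sets(2))
  interpret N: finite_measure N by (rule N(2))
  interpret N': finite_measure N' by (rule N'(2))
  have "D N = D N'"
  proof (rule measure_eqI_generator_eq[where E = "Collect closed" and \<Omega> = UNIV and A = "\<lambda>_. UNIV"])
    show "Int_stable (Collect closed)" by (auto simp: Int_stable_def)
    show "sets (D N) = sigma_sets UNIV (Collect closed)" "sets (D N') = sigma_sets UNIV (Collect closed)"
      unfolding D_def sets_distr borel_eq_closed by simp_all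
    show "emeasure (D N) X = emeasure (D N') X" if "X \<in> Collect closed" for X
      using that closed_eq[of X] by (simp add: DA N N' N.emeasure_eq_measure N'.emeasure_eq_measure borel_closed)
    show "emeasure (D N) UNIV \<noteq> \<infinity>" for i :: nat using DA[OF N(1)] by simp
  qed auto
  show ?thesis
  proof (rule measure_eqI)
    show "sets N = sets N'" using sets(1)[OF N(1)] sets(1)[OF N'(1)] by simp
    fix A assume "A \<in> sets N"
    then obtain B where B: "B \<in> sets borel" "A = B \<inter> orthant"
      unfolding sets(1)[OF N(1)] orthant_borel_def sets_restrict_space by auto
    show "emeasure N A = emeasure N' A"
      unfolding B(2) using DA[OF N(1) B(1)] DA[OF N'(1) B(1)] \<open>D N = D N'\<close> by simp
  qed
qed

lemma prob_space_finite: "prob_space N \<Longrightarrow> finite_measure N"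
  by (simp add: prob_space_def)

lemma integral_exp_poly_laplace:
  assumes N: "has_laplace_exponent N \<phi>" and s: "\<And>j. j \<in> J \<Longrightarrow> s j \<in> neg_orthant"
  shows "(\<integral>u. (\<Sum>j\<in>J. c j * exp (s j \<bullet> u)) \<partial>N) = (\<Sum>j\<in>J. c j * exp (\<phi> (s j)))"
proof -
  have N': "orthant_measure N" "finite_measure N"
    using N by (auto simp: has_laplace_exponent_def prob_space_finite)
  have "integrable N (\<lambda>u. exp (s j \<bullet> u))" if "j \<in> J" for j
    using real_exp_poly_integrable[OF N' real_exp_polys_monomial[OF s[OF that], of 1]] by simp
  then have "(\<integral>u. (\<Sum>j\<in>J. c j * exp (s j \<bullet> u)) \<partial>N) = (\<Sum>j\<in>J. c j * (\<integral>u. exp (s j \<bullet> u) \<partial>N))"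
    by (subst Bochner_Integration.integral_sum) auto
  also have "\<dots> = (\<Sum>j\<in>J. c j * exp (\<phi> (s j)))"
    using N s by (auto simp: has_laplace_exponent_def)
  finally show ?thesis .
qed

text \<open>Exponential polynomials are integrated termwise, so the Laplace exponent determines all
  their integrals. This gives meaning to the description in \<open>conv_semigroup\<close>.\<close>

lemma laplace_unique:
  assumes N: "has_laplace_exponent N \<phi>" and N': "has_laplace_exponent N' \<phi>"
  shows "N = N'"
proof (rule measure_eq_of_exp_polys)
  show "orthant_measure N" "finite_measure N" "orthant_measure N'" "finite_measure N'"
    using N N' by (auto simp: has_laplace_exponent_def prob_space_finite)
  fix p :: "real ^ 'a \<Rightarrow> real" assume "p \<in> real_exp_polys neg_orthant"
  then obtain m c s where p: "\<forall>j<m::nat. s j \<in> neg_orthant" "p = (\<lambda>r. \<Sum>j<m. c j * exp (s j \<bullet> r))"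
    by (rule real_exp_polysE)
  note p = p(1)[rule_format] p(2)
  show "(\<integral>u. p u \<partial>N) = (\<integral>u. p u \<partial>N')"
    unfolding p(2) using integral_exp_poly_laplace[OF N, of "{..<m}" s c]
      integral_exp_poly_laplace[OF N', of "{..<m}" s c] p(1) by simp
qed

lemma conv_semigroup_eq:
  assumes "has_laplace_exponent N (\<lambda>z. t * \<psi> z)"
  shows "conv_semigroup \<psi> t = N"
  unfolding conv_semigroup_def using assms by (rule the_equality) (rule laplace_unique[OF _ assms])

section \<open>Operator semigroups\<close>

lemma C0_semigroupD:
  assumes "bounded_C0_semigroup U" and "0 \<le> t"
  shows "bounded_linear (U t)" and "U t (c *\<^sub>C x) = c *\<^sub>C U t x"
    and "U 0 x = x" and "0 \<le> s \<Longrightarrow> U (s + t) x = U s (U t x)"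
    and "continuous_on {0..} (\<lambda>t. U t x)"
  using assms unfolding bounded_C0_semigroup_def by auto

lemma C0_semigroup_bound:
  assumes "bounded_C0_semigroup U"
  obtains M where "0 < M" "\<forall>t\<ge>0. \<forall>x. norm (U t x) \<le> M * norm x"
proof -
  obtain M where M: "\<And>t. 0 \<le> t \<Longrightarrow> onorm (U t) \<le> M"
    using assms unfolding bounded_C0_semigroup_def by auto
  show thesis
  proof (rule that[of "\<bar>M\<bar> + 1"], simp, intro allI impI)
    fix t :: real and x assume t: "0 \<le> t"
    have "norm (U t x) \<le> onorm (U t) * norm x"
      using C0_semigroupD(1)[OF assms t] by (rule onorm)
    also have "\<dots> \<le> (\<bar>M\<bar> + 1) * norm x"
      using M[OF t] by (intro mult_right_mono) auto
    finally show "norm (U t x) \<le> (\<bar>M\<bar> + 1) * norm x" .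
  qed
qed

text \<open>The uniform bound absorbs the motion of the vector, \<open>U (g s) (v s - v a)\<close>,
  and strong continuity at the fixed vector \<open>v a\<close> handles the motion of time.\<close>

lemma C0_semigroup_continuous_compose:
  fixes g :: "'a::topological_space \<Rightarrow> real"
  assumes U: "bounded_C0_semigroup U" and g: "continuous_on S g" "\<And>s. s \<in> S \<Longrightarrow> 0 \<le> g s"
    and v: "continuous_on S v"
  shows "continuous_on S (\<lambda>s. U (g s) (v s))"
  unfolding continuous_on_def
proof
  fix a assume a: "a \<in> S"
  obtain M where M: "0 < M" "\<forall>t\<ge>0. \<forall>x. norm (U t x) \<le> M * norm x"
    using C0_semigroup_bound[OF U] by blast
  have "continuous_on S (\<lambda>s. U (g s) (v a))"
    by (rule continuous_on_compose2[OF C0_semigroupD(5)[OF U order_refl] g(1)]) (use g(2) in auto)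
  then have lim: "((\<lambda>s. U (g s) (v a)) \<longlongrightarrow> U (g a) (v a)) (at a within S)"
    using a by (simp add: continuous_on_def)
  have "((\<lambda>s. M * norm (v s - v a)) \<longlongrightarrow> M * norm (v a - v a)) (at a within S)"
    using v a by (intro tendsto_intros) (simp add: continuous_on_def)
  then have "((\<lambda>s. M * norm (v s - v a)) \<longlongrightarrow> 0) (at a within S)" by simp
  then have "((\<lambda>s. U (g s) (v s) - U (g s) (v a)) \<longlongrightarrow> 0) (at a within S)"
  proof (rule Lim_null_comparison[rotated])
    show "\<forall>\<^sub>F s in at a within S. norm (U (g s) (v s) - U (g s) (v a)) \<le> M * norm (v s - v a)"
      unfolding eventually_at_filter
    proof (rule always_eventually, intro allI impI)
      fix s assume "s \<in> S"
      then have s: "0 \<le> g s" by (rule g(2))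
      interpret bounded_linear "U (g s)" using C0_semigroupD(1)[OF U s] .
      show "norm (U (g s) (v s) - U (g s) (v a)) \<le> M * norm (v s - v a)"
        using M(2) s by (simp add: diff[symmetric])
    qed
  qed
  from tendsto_add[OF this lim] show "((\<lambda>s. U (g s) (v s)) \<longlongrightarrow> U (g a) (v a)) (at a within S)" by simp
qed

section \<open>A generator determines its semigroup\<close>

lemma zero_right_derivative_const:
  fixes w :: "real \<Rightarrow> 'x::real_normed_vector"
  assumes cont: "continuous_on {0..t} w" and t: "0 \<le> t"
    and deriv: "\<And>s. 0 \<le> s \<Longrightarrow> s < t \<Longrightarrow> ((\<lambda>h. (w (s + h) - w s) /\<^sub>R h) \<longlongrightarrow> 0) (at_right 0)"
  shows "w t = w 0"
proof -
  have le: "norm (w t - w 0) \<le> \<epsilon> * t" if \<epsilon>: "0 < \<epsilon>" for \<epsilon>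
  proof -
    define S where "S = {s \<in> {0..t}. \<forall>r\<in>{0..s}. norm (w r - w 0) \<le> \<epsilon> * r}"
    have S0: "0 \<in> S" using t by (simp add: S_def)
    have bdd: "bdd_above S" by (rule bdd_aboveI[of _ t]) (simp add: S_def)
    define c where "c = Sup S"
    have "s \<le> t" if "s \<in> S" for s using that by (simp add: S_def)
    then have "Sup S \<le> t" using S0 by (intro cSup_least) auto
    then have c: "0 \<le> c" "c \<le> t"
      unfolding c_def using cSup_upper[OF S0 bdd] by simp_all
    have below: "norm (w r - w 0) \<le> \<epsilon> * r" if r: "0 \<le> r" "r < c" for r
    proof -
      obtain s where "s \<in> S" "r < s"
        using r(2) less_cSup_iff[OF _ bdd] S0 unfolding c_def by auto
      then show ?thesis using r(1) by (auto simp: S_def)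
    qed
    have at_c: "norm (w c - w 0) \<le> \<epsilon> * c"
    proof (cases "c = 0")
      case False
      then have c0: "0 < c" using c by simp
      have "continuous_on {0..c} (\<lambda>r. \<epsilon> * r - norm (w r - w 0))"
        using cont by (intro continuous_intros) (rule continuous_on_subset, use c in auto)
      moreover have "closure {0..<c} = {0..c}" using c0 by (rule closure_atLeastLessThan)
      ultimately have "0 \<le> \<epsilon> * c - norm (w c - w 0)"
        using continuous_ge_on_closure[of "{0..<c}" "\<lambda>r. \<epsilon> * r - norm (w r - w 0)" c 0] below c0
        by auto
      then show ?thesis by simp
    qed simp
    have "c = t"
    proof (rule ccontr)
      assume "c \<noteq> t"
      then have ct: "c < t" using c by simp
      have "\<forall>\<^sub>F h in at_right 0. dist ((w (c + h) - w c) /\<^sub>R h) 0 < \<epsilon>"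
        using deriv[OF c(1) ct] \<epsilon> by (rule tendstoD)
      then obtain d where d: "0 < d" "\<And>h. 0 < h \<Longrightarrow> h < d \<Longrightarrow> norm ((w (c + h) - w c) /\<^sub>R h) < \<epsilon>"
        unfolding eventually_at_right_field by auto
      \<comment> \<open>The step stays strictly inside the range \<open>d\<close> of the derivative
        estimate and does not pass the endpoint \<open>t\<close>.\<close>
      define e where "e = min (d / 2) (t - c)"
      have e: "0 < e" "e < d" "c + e \<le> t" using d ct by (auto simp: e_def)
      have "norm (w r - w 0) \<le> \<epsilon> * r" if r: "0 \<le> r" "r \<le> c + e" for r
      proof (cases "r < c \<or> r = c")
        case True
        then show ?thesis using below at_c r by auto
      next
        case False
        define h where "h = r - c"
        have h: "0 < h" "h < d" "r = c + h" using False r e by (auto simp: h_def)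
        have "norm (w (c + h) - w c) = h * norm ((w (c + h) - w c) /\<^sub>R h)" using h by simp
        also have "\<dots> \<le> h * \<epsilon>" using d(2)[OF h(1,2)] h by (intro mult_left_mono) auto
        finally have "norm (w r - w c) \<le> h * \<epsilon>" using h by simp
        moreover have "norm (w r - w 0) \<le> norm (w r - w c) + norm (w c - w 0)"
          using norm_triangle_ineq[of "w r - w c" "w c - w 0"] by simp
        ultimately have "norm (w r - w 0) \<le> h * \<epsilon> + \<epsilon> * c" using at_c by linarith
        then show ?thesis using h by (simp add: algebra_simps)
      qed
      then have "c + e \<in> S" using e c by (auto simp: S_def)
      then have "c + e \<le> c" unfolding c_def using bdd by (rule cSup_upper)
      then show False using e by simp
    qed
    with at_c show ?thesis by simp
  qed
  have "norm (w t - w 0) \<le> 0"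
  proof (rule field_le_epsilon)
    fix \<delta> :: real assume "0 < \<delta>"
    have "norm (w t - w 0) \<le> \<delta> / (t + 1) * t" using \<open>0 < \<delta>\<close> t by (intro le) simp
    also have "\<dots> \<le> \<delta>" using t \<open>0 < \<delta>\<close> by (simp add: field_simps)
    finally show "norm (w t - w 0) \<le> 0 + \<delta>" by simp
  qed
  then show ?thesis by simp
qed

text \<open>Time averages of the orbit of \<open>x\<close> over \<open>{0..\<epsilon>}\<close> tend
  to \<open>x\<close>, and they lie in the domain because applying \<open>U h\<close> to an integral
  of the orbit only shifts the interval of integration.\<close>

lemma generator_dense:
  assumes U: "bounded_C0_semigroup U"
  shows "\<exists>X. (\<forall>\<epsilon>>0::real. X \<epsilon> \<in> Domain (generator U)) \<and> (X \<longlongrightarrow> x) (at_right 0)"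
proof -
  define f where "f t = U t x" for t
  define \<Phi> where "\<Phi> u = integral {0..u} f" for u
  have f: "continuous_on {0..} f" unfolding f_def using C0_semigroupD(5)[OF U order_refl] .
  have fS: "continuous_on S f" if "S \<subseteq> {0..}" for S using f that by (rule continuous_on_subset)
  have int: "f integrable_on {a..b}" if "0 \<le> a" for a b
    using that by (intro integrable_continuous_real fS) auto
  have right: "((\<lambda>h. (\<Phi> (a + h) - \<Phi> a) /\<^sub>R h) \<longlongrightarrow> f a) (at_right 0)" if a: "0 \<le> a" for a
  proof -
    have "(\<Phi> has_vector_derivative f a) (at a within {0..a + 1})"
      unfolding \<Phi>_def using a by (intro integral_has_vector_derivative fS) auto
    then have "(\<Phi> has_vector_derivative f a) (at a within {a..a + 1})"
      by (rule has_vector_derivative_within_subset) (use a in auto)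
    moreover have "at a within {a..a + 1} = at_right a"
      by (rule at_within_Icc_at_right) simp
    ultimately have "((\<lambda>y. (\<Phi> y - \<Phi> a - (y - a) *\<^sub>R f a) /\<^sub>R norm (y - a)) \<longlongrightarrow> 0) (at_right a)"
      by (simp add: has_vector_derivative_def has_derivative_at_within)
    then have "((\<lambda>h. (\<Phi> (a + h) - \<Phi> a - h *\<^sub>R f a) /\<^sub>R \<bar>h\<bar>) \<longlongrightarrow> 0) (at_right 0)"
      by (subst (asm) filterlim_at_right_to_0) (simp add: add.commute)
    then have "((\<lambda>h. (\<Phi> (a + h) - \<Phi> a) /\<^sub>R h - f a) \<longlongrightarrow> 0) (at_right 0)"
    proof (rule Lim_transform_eventually)
      show "\<forall>\<^sub>F h in at_right 0. (\<Phi> (a + h) - \<Phi> a - h *\<^sub>R f a) /\<^sub>R \<bar>h\<bar> = (\<Phi> (a + h) - \<Phi> a) /\<^sub>R h - f a"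
        by (auto simp: eventually_at_filter scaleR_diff_right intro!: always_eventually)
    qed
    then show ?thesis by (simp add: Lim_null[symmetric])
  qed
  have \<Phi>0: "\<Phi> 0 = 0" by (simp add: \<Phi>_def)
  show ?thesis
  proof (intro exI[of _ "\<lambda>\<epsilon>. \<Phi> \<epsilon> /\<^sub>R \<epsilon>"] conjI allI impI)
    show "((\<lambda>\<epsilon>. \<Phi> \<epsilon> /\<^sub>R \<epsilon>) \<longlongrightarrow> x) (at_right 0)"
      using right[of 0] C0_semigroupD(3)[OF U order_refl, of x] by (simp add: \<Phi>0 f_def)
    fix \<epsilon> :: real assume \<epsilon>: "0 < \<epsilon>"
    \<comment> \<open>After the shift only two end pieces of length \<open>h\<close> survive;
      divided by \<open>h\<close> they tend to the values of the orbit at \<epsilon> and at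
      0.\<close>
    have eq: "U h (\<Phi> \<epsilon>) - \<Phi> \<epsilon> = (\<Phi> (\<epsilon> + h) - \<Phi> \<epsilon>) - (\<Phi> (0 + h) - \<Phi> 0)" if h: "0 < h" for h
    proof -
      have "U h (\<Phi> \<epsilon>) = integral {0..\<epsilon>} (U h \<circ> f)"
        unfolding \<Phi>_def using h C0_semigroupD(1)[OF U, of h] by (subst integral_linear[OF int]) auto
      also have "\<dots> = integral {0..\<epsilon>} (f \<circ> ((+) h))"
        using h C0_semigroupD(4)[OF U, of _ h x] by (intro integral_cong) (auto simp: f_def)
      also have "\<dots> = integral {h..\<epsilon> + h} f" by (simp add: integral_shift_Icc_real)
      also have "\<dots> = \<Phi> (\<epsilon> + h) - \<Phi> h"
        unfolding \<Phi>_def using Henstock_Kurzweil_Integration.integral_combine[where a = 0 and c = h and b = "\<epsilon> + h" and f = f] h \<epsilon> int by (simp add: algebra_simps)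
      finally show ?thesis by (simp add: \<Phi>0)
    qed
    have "((\<lambda>h. (\<Phi> (\<epsilon> + h) - \<Phi> \<epsilon>) /\<^sub>R h - (\<Phi> (0 + h) - \<Phi> 0) /\<^sub>R h) \<longlongrightarrow> f \<epsilon> - f 0) (at_right 0)"
      using right[of \<epsilon>] right[of 0] \<epsilon> by (intro tendsto_diff) simp_all
    then have "((\<lambda>h. (U h (\<Phi> \<epsilon>) - \<Phi> \<epsilon>) /\<^sub>R h) \<longlongrightarrow> f \<epsilon> - f 0) (at_right 0)"
    proof (rule Lim_transform_eventually)
      show "\<forall>\<^sub>F h in at_right 0. (\<Phi> (\<epsilon> + h) - \<Phi> \<epsilon>) /\<^sub>R h - (\<Phi> (0 + h) - \<Phi> 0) /\<^sub>R h =
          (U h (\<Phi> \<epsilon>) - \<Phi> \<epsilon>) /\<^sub>R h"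
        unfolding eventually_at_filter
      proof (rule always_eventually, intro allI impI)
        fix h :: real assume "h \<in> {0<..}"
        then have h: "0 < h" by simp
        show "(\<Phi> (\<epsilon> + h) - \<Phi> \<epsilon>) /\<^sub>R h - (\<Phi> (0 + h) - \<Phi> 0) /\<^sub>R h = (U h (\<Phi> \<epsilon>) - \<Phi> \<epsilon>) /\<^sub>R h"
          unfolding eq[OF h] scaleR_diff_right ..
      qed
    qed
    then have "((\<lambda>h. ((U h (\<Phi> \<epsilon>) - \<Phi> \<epsilon>) /\<^sub>R h) /\<^sub>R \<epsilon>) \<longlongrightarrow> (f \<epsilon> - f 0) /\<^sub>R \<epsilon>) (at_right 0)"
      by (intro tendsto_intros)
    then have "((\<lambda>h. (U h (\<Phi> \<epsilon> /\<^sub>R \<epsilon>) - \<Phi> \<epsilon> /\<^sub>R \<epsilon>) /\<^sub>R h) \<longlongrightarrow> (f \<epsilon> - f 0) /\<^sub>R \<epsilon>) (at_right 0)"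
    proof (rule Lim_transform_eventually)
      show "\<forall>\<^sub>F h in at_right 0. ((U h (\<Phi> \<epsilon>) - \<Phi> \<epsilon>) /\<^sub>R h) /\<^sub>R \<epsilon> = (U h (\<Phi> \<epsilon> /\<^sub>R \<epsilon>) - \<Phi> \<epsilon> /\<^sub>R \<epsilon>) /\<^sub>R h"
        unfolding eventually_at_filter
      proof (rule always_eventually, intro allI impI)
        fix h :: real assume "h \<in> {0<..}"
        then interpret bounded_linear "U h" using C0_semigroupD(1)[OF U, of h] by simp
        show "((U h (\<Phi> \<epsilon>) - \<Phi> \<epsilon>) /\<^sub>R h) /\<^sub>R \<epsilon> = (U h (\<Phi> \<epsilon> /\<^sub>R \<epsilon>) - \<Phi> \<epsilon> /\<^sub>R \<epsilon>) /\<^sub>R h"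
          by (simp add: scaleR scaleR_diff_right mult.commute)
      qed
    qed
    then show "\<Phi> \<epsilon> /\<^sub>R \<epsilon> \<in> Domain (generator U)" by (auto simp: generator_def Domain_iff)
  qed
qed

text \<open>The function \<open>U (t - s) (V s x)\<close> of \<open>s\<close> interpolates between
  the two sides, and its right derivative is zero because \<open>V s x\<close> stays in the common
  domain.\<close>

lemma semigroup_eq_on_generator:
  assumes U: "bounded_C0_semigroup U" and V: "bounded_C0_semigroup V"
    and gen: "generator U = generator V" and x: "(x, y) \<in> generator V" and t: "0 \<le> t"
  shows "U t x = V t x"
proof -
  obtain M where M: "0 < M" "\<forall>t\<ge>0. \<forall>x. norm (U t x) \<le> M * norm x"
    using C0_semigroup_bound[OF U] by blast
  define w where "w s = U (t - s) (V s x)" for s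
  have "w t = w 0"
  proof (rule zero_right_derivative_const[OF _ t])
    show "continuous_on {0..t} w"
      unfolding w_def
    proof (rule C0_semigroup_continuous_compose[OF U])
      show "continuous_on {0..t} (\<lambda>s. V s x)"
        using C0_semigroupD(5)[OF V order_refl] by (rule continuous_on_subset) auto
    qed (auto intro!: continuous_intros)
    fix s assume s: "0 \<le> s" "s < t"
    define z where "z = V s x"
    have lim: "((\<lambda>h. (V h z - z) /\<^sub>R h) \<longlongrightarrow> V s y) (at_right 0)"
    proof -
      interpret Vs: bounded_linear "V s" using C0_semigroupD(1)[OF V s(1)] .
      have "((\<lambda>h. V s ((V h x - x) /\<^sub>R h)) \<longlongrightarrow> V s y) (at_right 0)"
        using x by (intro Vs.tendsto) (simp add: generator_def)
      then show ?thesis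
      proof (rule Lim_transform_eventually)
        show "\<forall>\<^sub>F h in at_right 0. V s ((V h x - x) /\<^sub>R h) = (V h z - z) /\<^sub>R h"
          unfolding eventually_at_filter
        proof (rule always_eventually, intro allI impI)
          fix h :: real assume "h \<in> {0<..}"
          then have h: "0 \<le> h" by simp
          have "V h z = V s (V h x)"
            unfolding z_def using C0_semigroupD(4)[OF V s(1) h, of x] C0_semigroupD(4)[OF V h s(1), of x]
            by (simp add: add.commute)
          then show "V s ((V h x - x) /\<^sub>R h) = (V h z - z) /\<^sub>R h"
            by (simp add: Vs.scaleR Vs.diff z_def)
        qed
      qed
    qed
    then have "(z, V s y) \<in> generator U" unfolding gen by (simp add: generator_def)
    then have lim': "((\<lambda>h. (U h z - z) /\<^sub>R h) \<longlongrightarrow> V s y) (at_right 0)" by (simp add: generator_def)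
    \<comment> \<open>Both quotients at \<open>z\<close> converge to the same vector since the
      generators agree, and \<open>M\<close> bounds the outer operator \<open>U (t - s - h)\<close>
      uniformly in \<open>h\<close>.\<close>
    have "((\<lambda>h. M * norm ((V h z - z) /\<^sub>R h - (U h z - z) /\<^sub>R h)) \<longlongrightarrow> M * norm (V s y - V s y)) (at_right 0)"
      by (intro tendsto_intros lim lim')
    then have lim0: "((\<lambda>h. M * norm ((V h z - z) /\<^sub>R h - (U h z - z) /\<^sub>R h)) \<longlongrightarrow> 0) (at_right 0)" by simp
    have "\<forall>\<^sub>F h in at_right 0. h \<in> {0<..<t - s}"
      using s by (intro eventually_at_rightI[of 0 "t - s"]) auto
    then have "\<forall>\<^sub>F h in at_right 0. norm ((w (s + h) - w s) /\<^sub>R h) \<le>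
        M * norm ((V h z - z) /\<^sub>R h - (U h z - z) /\<^sub>R h)"
    proof (rule eventually_mono)
      fix h assume "h \<in> {0<..<t - s}"
      then have h: "0 < h" "0 \<le> h" "h < t - s" by auto
      interpret L: bounded_linear "U (t - s - h)" using C0_semigroupD(1)[OF U, of "t - s - h"] h by simp
      have "w (s + h) = U (t - s - h) (V h z)"
        unfolding w_def z_def using C0_semigroupD(4)[OF V s(1) h(2), of x] by (simp add: add.commute diff_diff_add)
      moreover have "w s = U (t - s - h) (U h z)"
        unfolding w_def z_def using C0_semigroupD(4)[OF U h(2), of "t - s - h" "V s x"] h by simp
      ultimately have "(w (s + h) - w s) /\<^sub>R h = U (t - s - h) ((V h z - z) /\<^sub>R h - (U h z - z) /\<^sub>R h)"
        by (simp add: L.diff[symmetric] L.scaleR[symmetric] scaleR_diff_right[symmetric])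
      then show "norm ((w (s + h) - w s) /\<^sub>R h) \<le> M * norm ((V h z - z) /\<^sub>R h - (U h z - z) /\<^sub>R h)"
        using M(2) h by simp
    qed
    then show "((\<lambda>h. (w (s + h) - w s) /\<^sub>R h) \<longlongrightarrow> 0) (at_right 0)"
      using lim0 by (rule Lim_null_comparison)
  qed
  then show ?thesis
    unfolding w_def using C0_semigroupD(3)[OF U order_refl] C0_semigroupD(3)[OF V order_refl] by simp
qed

theorem semigroup_unique:
  assumes U: "bounded_C0_semigroup U" and V: "bounded_C0_semigroup V"
    and gen: "generator U = generator V" and t: "0 \<le> t"
  shows "U t x = V t x"
proof -
  from generator_dense[OF V, where x = x]
  obtain X where X: "\<forall>\<epsilon>>0::real. X \<epsilon> \<in> Domain (generator V)" "(X \<longlongrightarrow> x) (at_right 0)"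
    by (elim exE conjE)
  interpret U: bounded_linear "U t" using C0_semigroupD(1)[OF U t] .
  interpret V: bounded_linear "V t" using C0_semigroupD(1)[OF V t] .
  have "((\<lambda>\<epsilon>. V t (X \<epsilon>)) \<longlongrightarrow> U t x) (at_right 0)"
  proof (rule Lim_transform_eventually[OF U.tendsto[OF X(2)]])
    show "\<forall>\<^sub>F \<epsilon> in at_right 0. U t (X \<epsilon>) = V t (X \<epsilon>)"
      unfolding eventually_at_filter
    proof (rule always_eventually, intro allI impI)
      fix \<epsilon> :: real assume "\<epsilon> \<in> {0<..}"
      then obtain y where "(X \<epsilon>, y) \<in> generator V" using X(1) by auto
      then show "U t (X \<epsilon>) = V t (X \<epsilon>)" using t by (rule semigroup_eq_on_generator[OF U V gen])
    qed
  qed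
  from tendsto_unique[OF trivial_limit_at_right_real this V.tendsto[OF X(2)]] show ?thesis .
qed

lemma semigroup_of_eq:
  assumes "generates G U" and "0 \<le> t"
  shows "semigroup_of G t x = U t x"
  unfolding semigroup_of_def
proof (rule the_equality)
  show "\<exists>U'. generates G U' \<and> U t x = U' t x" using assms(1) by blast
  show "y = U t x" if "\<exists>U'. generates G U' \<and> y = U' t x" for y
    using that assms semigroup_unique unfolding generates_def by metis
qed

section \<open>Products of commuting semigroups\<close>

locale commuting_semigroups =
  fixes U :: "'n::finite \<Rightarrow> real \<Rightarrow> 'x::complex_banach \<Rightarrow> 'x"
  assumes C0: "bounded_C0_semigroup (U i)"
    and comm: "0 \<le> s \<Longrightarrow> 0 \<le> t \<Longrightarrow> U i s (U j t x) = U j t (U i s x)"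
begin

text \<open>Partial products over \<open>S\<close> permit induction on \<open>S\<close>; the case
  \<open>S = UNIV\<close> is the joint semigroup.\<close>

definition prod_on :: "'n set \<Rightarrow> real ^ 'n \<Rightarrow> 'x \<Rightarrow> 'x" where
  "prod_on S u x = Finite_Set.fold (\<lambda>i. U i (u $ i)) x S"

lemma prod_on_empty [simp]: "prod_on {} u x = x"
  by (simp add: prod_on_def)

lemma prod_on_insert:
  assumes "u \<in> orthant" and "i \<notin> S"
  shows "prod_on (insert i S) u x = U i (u $ i) (prod_on S u x)"
proof -
  interpret comp_fun_commute_on UNIV "\<lambda>i. U i (u $ i)"
    using assms(1) comm by unfold_locales (auto simp: orthant_def)
  show ?thesis unfolding prod_on_def using assms(2) by (subst fold_insert) auto
qed

lemma prod_on_commute: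
  assumes "u \<in> orthant" and "0 \<le> s"
  shows "U j s (prod_on S u x) = prod_on S u (U j s x)"
proof -
  have "finite S" by simp
  then show ?thesis
    using assms by induction (simp_all add: prod_on_insert comm orthant_def)
qed

lemma prod_on_linear:
  assumes "u \<in> orthant"
  shows "bounded_linear (prod_on S u)" and "prod_on S u (c *\<^sub>C x) = c *\<^sub>C prod_on S u x"
proof -
  have "finite S" by simp
  then have "bounded_linear (prod_on S u) \<and> (\<forall>c x. prod_on S u (c *\<^sub>C x) = c *\<^sub>C prod_on S u x)"
  proof induction
    case empty
    show ?case by (simp add: bounded_linear_ident)
  next
    case (insert i S)
    have "0 \<le> u $ i" using assms by (simp add: orthant_def)
    note D = C0_semigroupD(1,2)[OF C0 this]
    have "prod_on (insert i S) u = (\<lambda>x. U i (u $ i) (prod_on S u x))"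
      using prod_on_insert[OF assms insert.hyps(2)] by auto
    then show ?case using insert.IH D bounded_linear_compose[OF D(1), of "prod_on S u"] by auto
  qed
  then show "bounded_linear (prod_on S u)" "prod_on S u (c *\<^sub>C x) = c *\<^sub>C prod_on S u x" by auto
qed

lemma prod_on_zero: "prod_on S 0 x = x"
proof -
  have "finite S" by simp
  then show ?thesis
    using C0_semigroupD(3)[OF C0 order_refl] by induction (simp_all add: prod_on_insert)
qed

lemma prod_on_add:
  assumes "u \<in> orthant" and "v \<in> orthant"
  shows "prod_on S (u + v) x = prod_on S u (prod_on S v x)"
proof -
  have "finite S" by simp
  then show ?thesis
  proof induction
    case (insert i S)
    have i: "0 \<le> u $ i" "0 \<le> v $ i" using assms by (auto simp: orthant_def)
    show ?case
      using insert assms C0_semigroupD(4)[OF C0 i(2,1)] prod_on_commute[OF assms(1) i(2)]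
      by (simp add: prod_on_insert orthant_add)
  qed simp
qed

lemma prod_on_bound: "\<exists>M>0. \<forall>u\<in>orthant. \<forall>x. norm (prod_on S u x) \<le> M * norm x"
proof -
  have "finite S" by simp
  then show ?thesis
  proof induction
    case empty
    show ?case by (intro exI[of _ 1]) simp
  next
    case (insert i S)
    then obtain M where M: "0 < M" "\<And>u x. u \<in> orthant \<Longrightarrow> norm (prod_on S u x) \<le> M * norm x" by blast
    obtain M' where M': "0 < M'" "\<forall>t\<ge>0. \<forall>x. norm (U i t x) \<le> M' * norm x"
      using C0_semigroup_bound[OF C0] by blast
    show ?case
    proof (intro exI[of _ "M' * M"] conjI ballI allI)
      fix u :: "real ^ 'n" and x assume u: "u \<in> orthant"
      then have i: "0 \<le> u $ i" by (simp add: orthant_def)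
      have "norm (prod_on (insert i S) u x) \<le> M' * norm (prod_on S u x)"
        using M'(2) i prod_on_insert[OF u insert.hyps(2)] by simp
      also have "\<dots> \<le> M' * (M * norm x)" using M(2)[OF u] M'(1) by (intro mult_left_mono) auto
      finally show "norm (prod_on (insert i S) u x) \<le> M' * M * norm x" by (simp add: mult.assoc)
    qed (use M M' in simp)
  qed
qed

lemma prod_on_continuous: "continuous_on orthant (\<lambda>u. prod_on S u x)"
proof -
  have "finite S" by simp
  then show ?thesis
  proof induction
    case (insert i S)
    have "continuous_on orthant (\<lambda>u. U i (u $ i) (prod_on S u x))"
      by (rule C0_semigroup_continuous_compose[OF C0 _ _ insert.IH])
        (auto simp: orthant_def intro!: continuous_intros)
    then show ?case
      by (rule continuous_on_eq) (simp add: prod_on_insert[OF _ insert.hyps(2)])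
  qed simp
qed

end

text \<open>A bounded strongly continuous semigroup with parameters in the orthant. Subordination
  uses nothing else about the operators \<open>T_1(u_1) ... T_n(u_n)\<close>.\<close>

locale orthant_semigroup =
  fixes T :: "real ^ 'n::finite \<Rightarrow> 'x::complex_banach \<Rightarrow> 'x" and M :: real
  assumes bounded_linear_T: "u \<in> orthant \<Longrightarrow> bounded_linear (T u)"
    and T_scaleC: "u \<in> orthant \<Longrightarrow> T u (c *\<^sub>C x) = c *\<^sub>C T u x"
    and T_zero: "T 0 x = x"
    and T_add: "u \<in> orthant \<Longrightarrow> v \<in> orthant \<Longrightarrow> T (u + v) x = T u (T v x)"
    and T_bound: "u \<in> orthant \<Longrightarrow> norm (T u x) \<le> M * norm x"
    and M_pos: "0 < M"
    and T_continuous: "continuous_on orthant (\<lambda>u. T u x)"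

lemma orthant_semigroup_joint_semigroup:
  fixes A :: "'n::finite \<Rightarrow> ('x \<times> 'x::complex_banach) set"
  assumes "commuting_generators A"
  obtains M where "orthant_semigroup (joint_semigroup A) M"
proof -
  obtain U where U: "\<And>i. generates (A i) (U i)"
    using assms unfolding commuting_generators_def by metis
  have C0: "bounded_C0_semigroup (U i)" for i using U[of i] by (simp add: generates_def)
  have eq: "semigroup_of (A i) t = U i t" if "0 \<le> t" for i t
    using semigroup_of_eq[OF U that] by blast
  interpret commuting_semigroups U
  proof
    fix s t :: real and i j x assume st: "0 \<le> s" "0 \<le> t"
    then have "semigroup_of (A i) s \<circ> semigroup_of (A j) t = semigroup_of (A j) t \<circ> semigroup_of (A i) s"
      using assms unfolding commuting_generators_def by blast
    then show "U i s (U j t x) = U j t (U i s x)"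
      unfolding eq[OF st(1)] eq[OF st(2)] by (metis comp_apply)
  qed (rule C0)
  obtain M where M: "0 < M" "\<forall>u\<in>orthant. \<forall>x. norm (prod_on UNIV u x) \<le> M * norm x"
    using prod_on_bound by blast
  have joint: "joint_semigroup A u = prod_on UNIV u" if "u \<in> orthant" for u
    unfolding joint_semigroup_def[abs_def] prod_on_def[abs_def] using eq that by (simp add: orthant_def)
  have "continuous_on orthant (\<lambda>u. joint_semigroup A u x)" for x
    using prod_on_continuous by (rule continuous_on_eq) (simp add: joint)
  then have "orthant_semigroup (joint_semigroup A) M"
    using M prod_on_linear prod_on_zero prod_on_add
    by (intro orthant_semigroup.intro) (simp_all add: joint orthant_add)
  then show thesis by (rule that)
qed

lemma bounded_linear_scaleC: "bounded_linear (\<lambda>x :: 'x::complex_banach. c *\<^sub>C x)"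
proof (rule bounded_linear_intro)
  show "c *\<^sub>C (r *\<^sub>R x) = r *\<^sub>R (c *\<^sub>C x)" for r and x :: 'x
    by (simp add: scaleC_of_real[symmetric] scaleC_scaleC mult.commute)
  show "norm (c *\<^sub>C x) \<le> norm x * cmod c" for x :: 'x by (simp add: norm_scaleC mult.commute)
qed (rule scaleC_add_right)

text \<open>Fubini on the product measure, after pulling \<open>f\<close> back along addition;
  boundedness of \<open>f\<close> makes it integrable there. It serves the semigroup law of the
  subordinated operators.\<close>

lemma pair_integrals_distr_add:
  fixes f :: "real ^ 'n::finite \<Rightarrow> real"
  assumes N1: "orthant_measure N1" "finite_measure N1" and N2: "orthant_measure N2" "finite_measure N2"
    and f: "continuous_on orthant f" "\<And>u. u \<in> orthant \<Longrightarrow> \<bar>f u\<bar> \<le> B"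
  defines "N \<equiv> distr (N1 \<Otimes>\<^sub>M N2) orthant_borel (\<lambda>(u, v). u + v)"
  shows "integrable N1 (\<lambda>u. \<integral>v. f (u + v) \<partial>N2)"
    and "(\<integral>u. (\<integral>v. f (u + v) \<partial>N2) \<partial>N1) = (\<integral>u. f u \<partial>N)"
proof -
  interpret N1: finite_measure N1 by (rule N1(2))
  interpret N2: finite_measure N2 by (rule N2(2))
  interpret pair_sigma_finite N1 N2 ..
  interpret P: finite_measure "N1 \<Otimes>\<^sub>M N2" by (rule finite_measure_pair_measure) unfold_locales
  have sp: "space (N1 \<Otimes>\<^sub>M N2) = orthant \<times> orthant"
    using N1(1) N2(1) by (simp add: space_pair_measure space_orthant_measure)
  have id: "(\<lambda>u. u) \<in> borel_measurable N1" "(\<lambda>u. u) \<in> borel_measurable N2"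
    using borel_measurable_orthant[OF N1(1) continuous_on_id] borel_measurable_orthant[OF N2(1) continuous_on_id]
    by auto
  have "(\<lambda>p. fst p + snd p) \<in> borel_measurable (N1 \<Otimes>\<^sub>M N2)"
    using measurable_compose[OF measurable_fst id(1)] measurable_compose[OF measurable_snd id(2)]
    by (rule borel_measurable_add)
  then have plus: "(\<lambda>(u, v). u + v) \<in> measurable (N1 \<Otimes>\<^sub>M N2) orthant_borel"
    unfolding orthant_borel_def
    by (intro measurable_restrict_space2) (auto simp: sp orthant_add case_prod_beta)
  have fm: "f \<in> borel_measurable orthant_borel"
    unfolding orthant_borel_def using f(1) by (rule borel_measurable_continuous_on_restrict)
  have fm': "(\<lambda>p. f (case p of (u, v) \<Rightarrow> u + v)) \<in> borel_measurable (N1 \<Otimes>\<^sub>M N2)"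
    using measurable_compose[OF plus fm] .
  have int: "integrable (N1 \<Otimes>\<^sub>M N2) (\<lambda>p. f (case p of (u, v) \<Rightarrow> u + v))"
    by (rule P.integrable_const_bound[of _ B]) (use f(2) fm' in \<open>auto intro!: AE_I2 simp: sp orthant_add\<close>)
  show "integrable N1 (\<lambda>u. \<integral>v. f (u + v) \<partial>N2)" using integrable_fst'[OF int] by simp
  have "(\<integral>u. f u \<partial>N) = (\<integral>p. f (case p of (u, v) \<Rightarrow> u + v) \<partial>(N1 \<Otimes>\<^sub>M N2))"
    unfolding N_def by (rule integral_distr[OF plus fm])
  also have "\<dots> = (\<integral>u. (\<integral>v. f (u + v) \<partial>N2) \<partial>N1)" using integral_fst'[OF int] by simp
  finally show "(\<integral>u. (\<integral>v. f (u + v) \<partial>N2) \<partial>N1) = (\<integral>u. f u \<partial>N)" by simp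
qed

section \<open>Subordination\<close>

text \<open>The operators \<open>g\<close> are tied to \<open>T\<close> only through the description
  \<open>bochner_integral\<close>; existence and uniqueness of the integral turn this into a usable
  \<open>has_bochner\<close> statement.\<close>

locale subordination = orthant_semigroup T M
  for T :: "real ^ 'n::finite \<Rightarrow> 'x::complex_banach \<Rightarrow> 'x" and M :: real +
  fixes \<psi> :: "real ^ 'n \<Rightarrow> real" and \<nu> :: "real \<Rightarrow> (real ^ 'n) measure" and g :: "real \<Rightarrow> 'x \<Rightarrow> 'x"
  assumes conv: "convolution_semigroup_of \<psi> \<nu>"
    and g_bochner: "0 \<le> t \<Longrightarrow> bochner_integral (\<nu> t) (\<lambda>u. T u x) = g t x"
begin

lemma laplace: "0 \<le> t \<Longrightarrow> has_laplace_exponent (\<nu> t) (\<lambda>z. t * \<psi> z)"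
  using conv by (simp add: convolution_semigroup_of_def)

lemma \<nu>_prob: "0 \<le> t \<Longrightarrow> prob_space (\<nu> t)"
  and \<nu>_orthant: "0 \<le> t \<Longrightarrow> orthant_measure (\<nu> t)"
  using laplace by (auto simp: has_laplace_exponent_def)

lemma \<nu>_finite: "0 \<le> t \<Longrightarrow> finite_measure (\<nu> t)"
  using \<nu>_prob by (rule prob_space_finite)

lemma space_\<nu>: "0 \<le> t \<Longrightarrow> space (\<nu> t) = orthant"
  using \<nu>_orthant by (rule space_orthant_measure)

lemma has_bochner_g: 
  assumes t: "0 \<le> t"
  shows "has_bochner (\<nu> t) (\<lambda>u. T u x) (g t x)"
proof -
  obtain y where y: "has_bochner (\<nu> t) (\<lambda>u. T u x) y"
    using has_bochner_orthant_exists[OF \<nu>_orthant[OF t] \<nu>_finite[OF t] T_continuous T_bound] by blast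
  with bochner_integral_eqI[OF \<nu>_finite[OF t] y] g_bochner[OF t] show ?thesis by simp
qed

lemma norm_g_le:
  assumes t: "0 \<le> t"
  shows "norm (g t x) \<le> M * norm x"
proof -
  interpret prob_space "\<nu> t" using t by (rule \<nu>_prob)
  \<comment> \<open>Comparison with the empty sum is a plain norm bound.\<close>
  have "norm (g t x - (\<Sum>j\<in>{}. (\<integral>u. 0 \<partial>\<nu> t) *\<^sub>R 0)) \<le> (\<integral>u. M * norm x \<partial>\<nu> t)"
    by (rule has_bochner_norm_diff_le[OF \<nu>_finite[OF t] has_bochner_g[OF t]])
      (use T_bound space_\<nu>[OF t] in auto)
  then show ?thesis by (simp add: prob_space)
qed

lemma bounded_linear_g:
  assumes t: "0 \<le> t"
  shows "bounded_linear (g t)"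
proof (rule bounded_linear_intro)
  note unique = has_bochner_unique[OF \<nu>_finite[OF t]]
  show "g t (x + y) = g t x + g t y" for x y
  proof (rule unique)
    show "has_bochner (\<nu> t) (\<lambda>u. T u (x + y)) (g t (x + y))" by (rule has_bochner_g[OF t])
    have "has_bochner (\<nu> t) (\<lambda>u. T u x + T u y) (g t x + g t y)"
      by (intro has_bochner_add \<nu>_finite has_bochner_g t
          borel_measurable_orthant[OF \<nu>_orthant[OF t]] continuous_on_add T_continuous)
    moreover have "T u (x + y) = T u x + T u y" if "u \<in> space (\<nu> t)" for u
      using bounded_linear_T[of u] that t by (simp add: space_\<nu> linear_simps)
    ultimately show "has_bochner (\<nu> t) (\<lambda>u. T u (x + y)) (g t x + g t y)"
      by (subst has_bochner_cong)
  qed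
  show "g t (r *\<^sub>R x) = r *\<^sub>R g t x" for r x
  proof (rule unique)
    show "has_bochner (\<nu> t) (\<lambda>u. T u (r *\<^sub>R x)) (g t (r *\<^sub>R x))" by (rule has_bochner_g[OF t])
    have "has_bochner (\<nu> t) (\<lambda>u. r *\<^sub>R T u x) (r *\<^sub>R g t x)"
      by (intro has_bochner_bounded_linear[OF bounded_linear_scaleR_right] has_bochner_g t)
    moreover have "T u (r *\<^sub>R x) = r *\<^sub>R T u x" if "u \<in> space (\<nu> t)" for u
      using bounded_linear_T[of u] that t by (simp add: space_\<nu> linear_simps)
    ultimately show "has_bochner (\<nu> t) (\<lambda>u. T u (r *\<^sub>R x)) (r *\<^sub>R g t x)"
      by (subst has_bochner_cong)
  qed
  show "norm (g t x) \<le> norm x * M" for x using norm_g_le[OF t] by (simp add: mult.commute)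
qed

lemma g_scaleC:
  assumes t: "0 \<le> t"
  shows "g t (c *\<^sub>C x) = c *\<^sub>C g t x"
proof (rule has_bochner_unique[OF \<nu>_finite[OF t]])
  show "has_bochner (\<nu> t) (\<lambda>u. T u (c *\<^sub>C x)) (g t (c *\<^sub>C x))" by (rule has_bochner_g[OF t])
  have "has_bochner (\<nu> t) (\<lambda>u. c *\<^sub>C T u x) (c *\<^sub>C g t x)"
    by (intro has_bochner_bounded_linear[OF bounded_linear_scaleC] has_bochner_g t)
  moreover have "T u (c *\<^sub>C x) = c *\<^sub>C T u x" if "u \<in> space (\<nu> t)" for u
    using that t by (simp add: space_\<nu> T_scaleC)
  ultimately show "has_bochner (\<nu> t) (\<lambda>u. T u (c *\<^sub>C x)) (c *\<^sub>C g t x)"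
    by (subst has_bochner_cong)
qed

section \<open>Strong continuity and the semigroup law\<close>

text \<open>A Markov type estimate. Near 0 the continuity of \<open>T\<close> gives \<epsilon>; away
  from 0 a multiple of \<open>1 - exp (- 1 \<bullet> u)\<close> dominates, and its integral is known
  exactly from the Laplace exponent at the vector \<open>- 1\<close>.\<close>

lemma norm_g_diff_le:
  assumes "0 < \<epsilon>"
  obtains C where "0 \<le> C" "\<forall>t\<ge>0. norm (g t x - x) \<le> \<epsilon> + C * (1 - exp (t * \<psi> (- 1)))"
proof -
  have neg: "(- 1 :: real ^ 'n) \<in> neg_orthant" by (simp add: neg_orthant_def)
  obtain \<delta> where \<delta>: "0 < \<delta>" "\<And>u. u \<in> orthant \<Longrightarrow> dist u 0 < \<delta> \<Longrightarrow> dist (T u x) (T 0 x) < \<epsilon>"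
    using T_continuous[of x] assms unfolding continuous_on_iff by (meson zero_in_orthant)
  \<comment> \<open>For \<open>norm u \<ge> \<delta>\<close> the function
    \<open>1 - exp (- 1 \<bullet> u)\<close> is at least \<open>1 - exp (- \<delta>)\<close>, so
    \<open>C\<close> times it dominates the trivial bound \<open>(M + 1) * norm x\<close>.\<close>
  define C where "C = (M + 1) * norm x / (1 - exp (- \<delta>))"
  have pos: "0 < 1 - exp (- \<delta>)" using \<delta>(1) by simp
  have C: "0 \<le> C" unfolding C_def using pos M_pos by simp
  have le: "norm (T u x - x) \<le> \<epsilon> + C * (1 - exp (- 1 \<bullet> u))" if u: "u \<in> orthant" for u
  proof (cases "norm u < \<delta>")
    case True
    then have "norm (T u x - x) \<le> \<epsilon>" using \<delta>(2)[OF u] T_zero by (simp add: dist_norm)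
    moreover have "0 \<le> C * (1 - exp (- 1 \<bullet> u))" using C exp_neg_orthant_le_1[OF neg u] by simp
    ultimately show ?thesis by simp
  next
    case False
    have "norm u \<le> (\<Sum>i\<in>UNIV. \<bar>u $ i\<bar>)" by (rule norm_le_l1_cart)
    also have "\<dots> = 1 \<bullet> u" using u by (simp add: inner_vec_def orthant_def)
    finally have "exp (- 1 \<bullet> u) \<le> exp (- \<delta>)" using False by (simp add: inner_minus_left)
    then have "C * (1 - exp (- \<delta>)) \<le> C * (1 - exp (- 1 \<bullet> u))" using C by (intro mult_left_mono) auto
    moreover have "C * (1 - exp (- \<delta>)) = (M + 1) * norm x" unfolding C_def using pos by simp
    moreover have "norm (T u x - x) \<le> M * norm x + norm x"
      using norm_triangle_ineq4[of "T u x" x] T_bound[OF u, of x] by linarith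
    ultimately show ?thesis using assms by (simp add: algebra_simps)
  qed
  have "norm (g t x - x) \<le> \<epsilon> + C * (1 - exp (t * \<psi> (- 1)))" if t: "0 \<le> t" for t
  proof -
    interpret prob_space "\<nu> t" using t by (rule \<nu>_prob)
    have int: "integrable (\<nu> t) (\<lambda>u. exp (- 1 \<bullet> u))"
      using real_exp_poly_integrable[OF \<nu>_orthant[OF t] \<nu>_finite[OF t] real_exp_polys_monomial[OF neg, of 1]]
      by simp
    have "norm (g t x - (\<Sum>j\<in>{()}. (\<integral>u. 1 \<partial>\<nu> t) *\<^sub>R x)) \<le> (\<integral>u. \<epsilon> + C * (1 - exp (- 1 \<bullet> u)) \<partial>\<nu> t)"
      by (rule has_bochner_norm_diff_le[OF \<nu>_finite[OF t] has_bochner_g[OF t]])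
        (use le int space_\<nu>[OF t] in auto)
    also have "\<dots> = \<epsilon> + C * (1 - exp (t * \<psi> (- 1)))"
    proof -
      have "(\<integral>u. exp (- 1 \<bullet> u) \<partial>\<nu> t) = exp (t * \<psi> (- 1))"
        using laplace[OF t] neg unfolding has_laplace_exponent_def by blast
      moreover have "(\<integral>u. \<epsilon> + C * (1 - exp (- 1 \<bullet> u)) \<partial>\<nu> t) = \<epsilon> + C * (1 - (\<integral>u. exp (- 1 \<bullet> u) \<partial>\<nu> t))"
        using int by (simp add: prob_space)
      ultimately show ?thesis by simp
    qed
    finally show ?thesis by (simp add: prob_space)
  qed
  with C show thesis using that by blast
qed

lemma g_near_zero:
  assumes "0 < \<epsilon>"
  obtains d where "0 < d" "\<forall>t. 0 \<le> t \<and> t < d \<longrightarrow> norm (g t x - x) < \<epsilon>"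
proof -
  have "0 < \<epsilon> / 2" using assms by simp
  then obtain C where C: "0 \<le> C" "\<forall>t\<ge>0. norm (g t x - x) \<le> \<epsilon> / 2 + C * (1 - exp (t * \<psi> (- 1)))"
    by (rule norm_g_diff_le)
  have "((\<lambda>t. \<epsilon> / 2 + C * (1 - exp (t * \<psi> (- 1)))) \<longlongrightarrow> \<epsilon> / 2 + C * (1 - exp (0 * \<psi> (- 1)))) (at_right 0)"
    by (intro tendsto_intros)
  then have "((\<lambda>t. \<epsilon> / 2 + C * (1 - exp (t * \<psi> (- 1)))) \<longlongrightarrow> \<epsilon> / 2) (at_right 0)" by simp
  then have "\<forall>\<^sub>F t in at_right 0. \<epsilon> / 2 + C * (1 - exp (t * \<psi> (- 1))) < \<epsilon>"
    using assms by (intro order_tendstoD(2)[of _ "\<epsilon> / 2"]) auto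
  then obtain d where d: "0 < d" "\<And>t. 0 < t \<Longrightarrow> t < d \<Longrightarrow> \<epsilon> / 2 + C * (1 - exp (t * \<psi> (- 1))) < \<epsilon>"
    unfolding eventually_at_right_field by auto
  have "norm (g t x - x) < \<epsilon>" if t: "0 \<le> t" "t < d" for t
  proof (cases "t = 0")
    case True
    then show ?thesis using C(2)[rule_format, of 0] assms by simp
  next
    case False
    then show ?thesis using le_less_trans[OF C(2)[rule_format, OF t(1)] d(2)[OF _ t(2)]] t(1) by simp
  qed
  with d(1) show thesis using that by blast
qed

text \<open>The estimate near time 0 includes time 0 itself, so the distance of \<open>g 0 x\<close>
  from \<open>x\<close> is smaller than every positive number.\<close>

lemma g_zero: "g 0 x = x"
proof (rule ccontr)
  assume "g 0 x \<noteq> x"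
  then have "0 < norm (g 0 x - x)" by simp
  then obtain d where "0 < d" "\<forall>t. 0 \<le> t \<and> t < d \<longrightarrow> norm (g t x - x) < norm (g 0 x - x)"
    by (rule g_near_zero)
  then show False by auto
qed

text \<open>Fubini is applied to scalar functions only. Both sides are compared with the same finite
  sum of vectors \<open>F c\<close>; integrating over \<open>\<nu> t\<close> first merely replaces
  its coefficients and the error by averages.\<close>

lemma g_add:
  assumes s: "0 \<le> s" and t: "0 \<le> t"
  shows "g (s + t) x = g s (g t x)"
proof -
  have st: "0 \<le> s + t" using s t by simp
  define N where "N = \<nu> (s + t)"
  have N: "N = distr (\<nu> s \<Otimes>\<^sub>M \<nu> t) orthant_borel (\<lambda>(u, v). u + v)"
    using conv s t by (simp add: N_def convolution_semigroup_of_def)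
  define F where "F u = T u x" for u
  define B where "B = M * norm x"
  have F: "continuous_on orthant F" "\<And>u. u \<in> orthant \<Longrightarrow> norm (F u) \<le> B"
    unfolding F_def B_def using T_continuous T_bound by auto
  have B: "0 \<le> B" unfolding B_def using M_pos by simp
  note \<nu>s = \<nu>_orthant[OF s] \<nu>_finite[OF s]
  note \<nu>t = \<nu>_orthant[OF t] \<nu>_finite[OF t]
  have N': "finite {N}" "\<And>M. M \<in> {N} \<Longrightarrow> orthant_measure M" "\<And>M. M \<in> {N} \<Longrightarrow> finite_measure M"
    using \<nu>_orthant[OF st] \<nu>_finite[OF st] by (auto simp: N_def)
  have "norm (g (s + t) x - g s (g t x)) \<le> 0 + \<epsilon>" if "0 < \<epsilon>" for \<epsilon>
  proof -
    have half: "0 < \<epsilon> / 2" using that by simp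
    show ?thesis
    proof (rule orthant_partition_approx[of "{N}" "\<lambda>M. M", OF N' F half])
      fix C :: "(real ^ 'n) set" and \<phi> :: "real ^ 'n \<Rightarrow> real ^ 'n \<Rightarrow> real" and R and e :: "real ^ 'n \<Rightarrow> real"
      assume C: "finite C" "C \<subseteq> orthant" "\<And>c. continuous_on UNIV (\<phi> c)"
        "\<And>c u. (0::real) \<le> \<phi> c u" "\<And>u. (\<Sum>c\<in>C. \<phi> c u) \<le> 1"
        and approx: "\<And>u. u \<in> orthant \<Longrightarrow> norm (F u - (\<Sum>c\<in>C. \<phi> c u *\<^sub>R F c)) \<le> e u"
        and e: "\<And>M. M \<in> {N} \<Longrightarrow> integrable M e" "\<And>M. M \<in> {N} \<Longrightarrow> (\<integral>u. e u \<partial>M) \<le> \<epsilon> / 2"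
      have \<phi>1: "\<bar>\<phi> c u\<bar> \<le> 1" if "c \<in> C" for c u
        using order_trans[OF member_le_sum[of c C "\<lambda>c. \<phi> c u"] C(5)[of u]] C(1,4) that by simp
      have \<phi>c: "continuous_on S (\<phi> c)" for c S
        using C(3) by (rule continuous_on_subset) simp
      \<comment> \<open>The true error is continuous and bounded, hence admissible for Fubini;
        \<open>e\<close> only serves to bound its integral.\<close>
      define r where "r u = norm (F u - (\<Sum>c\<in>C. \<phi> c u *\<^sub>R F c))" for u
      have rc: "continuous_on orthant r"
        unfolding r_def by (intro continuous_intros F(1) \<phi>c)
      have rb: "\<bar>r u\<bar> \<le> B + B" if u: "u \<in> orthant" for u
      proof -
        have "norm (\<Sum>c\<in>C. \<phi> c u *\<^sub>R F c) \<le> (\<Sum>c\<in>C. \<phi> c u * B)"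
        proof (rule order_trans[OF norm_sum], rule sum_mono)
          fix c assume "c \<in> C"
          then have "norm (F c) \<le> B" using C(2) F(2) by auto
          then show "norm (\<phi> c u *\<^sub>R F c) \<le> \<phi> c u * B" using C(4) by (simp add: mult_left_mono)
        qed
        also have "\<dots> \<le> B" using mult_right_mono[OF C(5) B] by (simp add: sum_distrib_right)
        finally show ?thesis unfolding r_def abs_norm_cancel
          using F(2)[OF u] norm_triangle_ineq4[of "F u" "\<Sum>c\<in>C. \<phi> c u *\<^sub>R F c"] by linarith
      qed
      \<comment> \<open>Averages of the translates over \<open>\<nu> t\<close>: their integrals
        against \<open>\<nu> s\<close> are the integrals of \<open>\<phi> c\<close> and
        \<open>r\<close> against the convolution \<open>N\<close>.\<close>
      define \<phi>' where "\<phi>' c u = (\<integral>v. \<phi> c (u + v) \<partial>\<nu> t)" for c u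
      define r' where "r' u = (\<integral>v. r (u + v) \<partial>\<nu> t)" for u
      have \<phi>': "integrable (\<nu> s) (\<phi>' c)" "(\<integral>u. \<phi>' c u \<partial>\<nu> s) = (\<integral>u. \<phi> c u \<partial>N)" if "c \<in> C" for c
        unfolding \<phi>'_def N using pair_integrals_distr_add[OF \<nu>s \<nu>t \<phi>c \<phi>1[OF that]] by auto
      have r': "integrable (\<nu> s) r'" "(\<integral>u. r' u \<partial>\<nu> s) = (\<integral>u. r u \<partial>N)"
        unfolding r'_def N using pair_integrals_distr_add[OF \<nu>s \<nu>t rc rb] by auto
      have Nst: "orthant_measure N" "finite_measure N" using N' by auto
      have "(\<integral>u. r u \<partial>N) \<le> (\<integral>u. e u \<partial>N)"
      proof (rule integral_mono)
        show "integrable N r" using integrable_orthant[OF Nst rc, of "B + B"] rb by simp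
        show "integrable N e" using e(1) by simp
        show "r u \<le> e u" if "u \<in> space N" for u
          using approx that space_orthant_measure[OF Nst(1)] by (simp add: r_def)
      qed
      then have rN: "(\<integral>u. r u \<partial>N) \<le> \<epsilon> / 2" using e(2) by force
      have \<phi>N: "integrable N (\<phi> c)" if "c \<in> C" for c
        using integrable_orthant[OF Nst \<phi>c, of c 1] \<phi>1[OF that] by simp
      have 1: "norm (g (s + t) x - (\<Sum>c\<in>C. (\<integral>u. \<phi> c u \<partial>N) *\<^sub>R F c)) \<le> \<epsilon> / 2"
      proof -
        have "norm (g (s + t) x - (\<Sum>c\<in>C. (\<integral>u. \<phi> c u \<partial>N) *\<^sub>R F c)) \<le> (\<integral>u. r u \<partial>N)"
        proof (rule has_bochner_norm_diff_le[OF Nst(2) _ C(1) \<phi>N])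
          show "has_bochner N F (g (s + t) x)" unfolding F_def N_def by (rule has_bochner_g[OF st])
          show "integrable N r" using integrable_orthant[OF Nst rc, of "B + B"] rb by simp
        qed (auto simp: r_def)
        with rN show ?thesis by simp
      qed
      \<comment> \<open>\<open>T u\<close> passes through the inner integral, whose integrand
        becomes \<open>T (u + v) x\<close>; the approximation translated by \<open>u\<close> then
        applies.\<close>
      have pointwise: "norm (T u (g t x) - (\<Sum>c\<in>C. \<phi>' c u *\<^sub>R F c)) \<le> r' u" if "u \<in> space (\<nu> s)" for u
      proof -
        have u: "u \<in> orthant" using that s by (simp add: space_\<nu>)
        have shift: "continuous_on orthant (\<lambda>v. h (u + v))" if "continuous_on orthant h"
          for h :: "real ^ 'n \<Rightarrow> real"
          by (rule continuous_on_compose2[OF that])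
            (use u in \<open>auto intro!: continuous_intros simp: orthant_add\<close>)
        show ?thesis
          unfolding \<phi>'_def r'_def
        proof (rule has_bochner_norm_diff_le[OF \<nu>t(2) _ C(1)])
          show "has_bochner (\<nu> t) (\<lambda>v. T u (T v x)) (T u (g t x))"
            by (rule has_bochner_bounded_linear[OF bounded_linear_T[OF u] has_bochner_g[OF t]])
          show "integrable (\<nu> t) (\<lambda>v. \<phi> c (u + v))" if "c \<in> C" for c
            using integrable_orthant[OF \<nu>t shift[OF \<phi>c], of c 1] \<phi>1[OF that] by simp
          show "integrable (\<nu> t) (\<lambda>v. r (u + v))"
            using integrable_orthant[OF \<nu>t shift[OF rc], of "B + B"] rb u by (simp add: orthant_add)
          show "norm (T u (T v x) - (\<Sum>c\<in>C. \<phi> c (u + v) *\<^sub>R F c)) \<le> r (u + v)" if "v \<in> space (\<nu> t)" for v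
            using that t u T_add[of u v x] by (simp add: r_def F_def space_\<nu>)
        qed
      qed
      have "norm (g s (g t x) - (\<Sum>c\<in>C. (\<integral>u. \<phi>' c u \<partial>\<nu> s) *\<^sub>R F c)) \<le> (\<integral>u. r' u \<partial>\<nu> s)"
        by (rule has_bochner_norm_diff_le[OF \<nu>s(2) has_bochner_g[OF s] C(1) \<phi>'(1) r'(1) pointwise])
      also have "\<dots> \<le> \<epsilon> / 2" using r'(2) rN by simp
      finally have 2: "norm (g s (g t x) - (\<Sum>c\<in>C. (\<integral>u. \<phi> c u \<partial>N) *\<^sub>R F c)) \<le> \<epsilon> / 2"
        using \<phi>'(2) by simp
      have "norm ((\<Sum>c\<in>C. (\<integral>u. \<phi> c u \<partial>N) *\<^sub>R F c) - g s (g t x)) \<le> \<epsilon> / 2"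
        using 2 by (simp add: norm_minus_commute)
      from norm_diff_triangle_le[OF 1 this]
      show "norm (g (s + t) x - g s (g t x)) \<le> 0 + \<epsilon>" by simp
    qed
  qed
  then have "norm (g (s + t) x - g s (g t x)) \<le> 0" by (rule field_le_epsilon)
  then show ?thesis by simp
qed

text \<open>The semigroup law and the uniform bound reduce continuity at every time to continuity at
  0.\<close>

lemma norm_g_increment_le:
  assumes "0 \<le> s" and "0 \<le> t"
  shows "norm (g s x - g t x) \<le> M * norm (g \<bar>s - t\<bar> x - x)"
proof -
  have le: "norm (g (t + h) x - g t x) \<le> M * norm (g h x - x)" if "0 \<le> t" "0 \<le> h" for t h
  proof -
    interpret bounded_linear "g t" using bounded_linear_g[OF that(1)] .
    have "g (t + h) x - g t x = g t (g h x - x)" using g_add[OF that] by (simp add: diff)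
    then show ?thesis using norm_g_le[OF that(1)] by simp
  qed
  show ?thesis
  proof (cases "s \<le> t")
    case True
    then show ?thesis using le[of s "t - s"] assms by (simp add: norm_minus_commute)
  next
    case False
    then show ?thesis using le[of t "s - t"] assms by simp
  qed
qed

lemma bounded_C0_semigroup_g: "bounded_C0_semigroup g"
  unfolding bounded_C0_semigroup_def
proof (intro conjI allI impI)
  show "bounded_linear (g t)" if "0 \<le> t" for t using bounded_linear_g[OF that] .
  show "g t (c *\<^sub>C x) = c *\<^sub>C g t x" if "0 \<le> t" for t c x using g_scaleC[OF that] .
  show "g 0 = id" using g_zero by auto
  show "g (s + t) = g s \<circ> g t" if "0 \<le> s" "0 \<le> t" for s t using g_add[OF that] by auto
  show "continuous_on {0..} (\<lambda>t. g t x)" for x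
    unfolding continuous_on_iff
  proof (intro ballI allI impI)
    fix t \<epsilon> :: real assume t: "t \<in> {0..}" and \<epsilon>: "0 < \<epsilon>"
    have "0 < \<epsilon> / M" using \<epsilon> M_pos by simp
    then obtain d where d: "0 < d" "\<forall>t. 0 \<le> t \<and> t < d \<longrightarrow> norm (g t x - x) < \<epsilon> / M"
      by (rule g_near_zero)
    have "dist (g s x) (g t x) < \<epsilon>" if "s \<in> {0..}" "dist s t < d" for s
    proof -
      have "norm (g s x - g t x) \<le> M * norm (g \<bar>s - t\<bar> x - x)"
        using norm_g_increment_le that t by simp
      also have "\<dots> < M * (\<epsilon> / M)"
        using d(2) that M_pos by (intro mult_strict_left_mono) (auto simp: dist_real_def)
      finally show ?thesis using M_pos by (simp add: dist_norm)
    qed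
    with d(1) show "\<exists>d>0. \<forall>s\<in>{0..}. dist s t < d \<longrightarrow> dist (g s x) (g t x) < \<epsilon>" by blast
  qed
  show "\<exists>M. \<forall>t\<ge>0. onorm (g t) \<le> M"
    using norm_g_le M_pos by (intro exI[of _ M] allI impI onorm_bound) auto
qed

end

section \<open>Exponential polynomials along the convolution semigroup\<close>

text \<open>\<open>K\<close> is a supremum over polynomials of norm exactly 1, whereas
  \<open>B\<close> is only an upper bound. So the polynomial is rescaled by its true norm
  \<open>n\<close>. If \<open>n = 0\<close> it vanishes on the orthant, and the double integral,
  which sees only the orthant, is zero.\<close>

lemma abs_generator_exp_poly_le:
  fixes \<psi> :: "real ^ 'n::finite \<Rightarrow> real"
  assumes \<mu>: "levy_representation \<psi> 0 0 \<mu>" and N: "has_laplace_exponent N (\<lambda>z. t * \<psi> z)"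
    and k: "K N \<mu> \<le> ennreal k" "0 \<le> k"
    and s: "\<And>j. j < (m::nat) \<Longrightarrow> s j \<in> neg_orthant"
    and B: "\<And>r. r \<in> orthant \<Longrightarrow> \<bar>\<Sum>j<m. c j * exp (s j \<bullet> r)\<bar> \<le> B"
  shows "\<bar>\<Sum>j<m. c j * \<psi> (s j) * exp (t * \<psi> (s j))\<bar> \<le> k * B"
proof -
  have N': "orthant_measure N" "finite_measure N"
    using N by (auto simp: has_laplace_exponent_def prob_space_finite)
  have sp: "space N = orthant" "space \<mu> = orthant"
    using N'(1) \<mu> by (auto simp: orthant_measure_def levy_representation_def)
  have Lm: "integrable \<mu> (\<lambda>v. exp (s j \<bullet> v) - 1)" "(\<integral>v. (exp (s j \<bullet> v) - 1) \<partial>\<mu>) = \<psi> (s j)"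
    if "j < m" for j
    using \<mu> s[OF that] by (auto simp: levy_representation_def)
  define p where "p a r = (\<Sum>j<m. a j * exp (s j \<bullet> r))" for a and r :: "real ^ 'n"
  \<comment> \<open>\<open>P\<close> is the complex copy of \<open>p\<close> that is admissible in
    \<open>K\<close>; its values are real, so the integrals reduce to real ones.\<close>
  define P where "P a r = (\<Sum>j<m. complex_of_real (a j) * exp (complex_of_real (s j \<bullet> r)))" for a and r :: "real ^ 'n"
  define D where "D a = (\<Sum>j<m. a j * \<psi> (s j) * exp (t * \<psi> (s j)))" for a
  have Pp: "P a r = complex_of_real (p a r)" for a r
    by (simp add: P_def p_def exp_of_real)
  have P_in: "P a \<in> exp_polys" for a
    unfolding exp_polys_def mem_Collect_eq
    using s by (intro exI[of _ m] exI[of _ "\<lambda>j. complex_of_real (a j)"] exI[of _ s] conjI)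
      (auto simp: P_def)
  have double: "(\<integral>u. (\<integral>r. P a (r + u) - P a r \<partial>N) \<partial>\<mu>) = complex_of_real (D a)" for a
  proof -
    have inner: "(\<integral>r. P a (r + u) - P a r \<partial>N) =
        complex_of_real (\<Sum>j<m. a j * exp (t * \<psi> (s j)) * (exp (s j \<bullet> u) - 1))" for u
    proof -
      have "(\<integral>r. p a (r + u) - p a r \<partial>N) =
          (\<integral>r. (\<Sum>j<m. (a j * (exp (s j \<bullet> u) - 1)) * exp (s j \<bullet> r)) \<partial>N)"
        by (simp add: p_def sum_subtractf[symmetric] inner_add_right exp_add algebra_simps)
      also have "\<dots> = (\<Sum>j<m. (a j * (exp (s j \<bullet> u) - 1)) * exp (t * \<psi> (s j)))"
        using s by (intro integral_exp_poly_laplace[OF N]) auto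
      also have "\<dots> = (\<Sum>j<m. a j * exp (t * \<psi> (s j)) * (exp (s j \<bullet> u) - 1))"
        by (intro sum.cong) auto
      finally show ?thesis
        unfolding Pp of_real_diff[symmetric] by (simp only: integral_complex_of_real)
    qed
    have "(\<integral>u. (\<Sum>j<m. a j * exp (t * \<psi> (s j)) * (exp (s j \<bullet> u) - 1)) \<partial>\<mu>) =
        (\<Sum>j<m. a j * exp (t * \<psi> (s j)) * (\<integral>u. (exp (s j \<bullet> u) - 1) \<partial>\<mu>))"
      using Lm(1) by (subst Bochner_Integration.integral_sum) auto
    also have "\<dots> = D a"
      unfolding D_def using Lm(2) by (intro sum.cong) auto
    finally show ?thesis unfolding inner by (simp only: integral_complex_of_real)
  qed
  have pB: "\<bar>p c r\<bar> \<le> B" if "r \<in> orthant" for r using B[OF that] by (simp add: p_def)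
  have ne: "(orthant :: (real ^ 'n) set) \<noteq> {}" using zero_in_orthant by blast
  have bdd: "bdd_above ((\<lambda>r. cmod (P c r)) ` orthant)"
    by (rule bdd_aboveI[of _ B]) (use pB in \<open>auto simp: Pp\<close>)
  define n where "n = sup_norm (P c)"
  have up: "\<bar>p c r\<bar> \<le> n" if "r \<in> orthant" for r
    unfolding n_def sup_norm_def using cSUP_upper[OF that bdd] by (simp add: Pp)
  have nB: "n \<le> B"
    unfolding n_def sup_norm_def by (rule cSUP_least[OF ne]) (use pB in \<open>auto simp: Pp\<close>)
  have n0: "0 \<le> n" using up[OF zero_in_orthant] by linarith
  have "\<bar>D c\<bar> \<le> k * n"
  proof (cases "n = 0")
    case True
    then have P0: "P c r = 0" if "r \<in> orthant" for r using up[OF that] by (simp add: Pp)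
    have "(\<integral>r. P c (r + u) - P c r \<partial>N) = 0" if "u \<in> orthant" for u
    proof -
      have "(\<integral>r. P c (r + u) - P c r \<partial>N) = (\<integral>r. 0 \<partial>N)"
        using that P0 by (intro Bochner_Integration.integral_cong) (auto simp: sp orthant_add)
      then show ?thesis by simp
    qed
    then have "(\<integral>u. (\<integral>r. P c (r + u) - P c r \<partial>N) \<partial>\<mu>) = (\<integral>u. 0 \<partial>\<mu>)"
      by (intro Bochner_Integration.integral_cong) (auto simp: sp)
    then have "D c = 0" unfolding double by simp
    then show ?thesis using True by simp
  next
    case False
    then have npos: "0 < n" using n0 by simp
    define a where "a j = c j / n" for j
    have pa: "p a r = p c r / n" for r by (simp add: p_def a_def sum_divide_distrib)
    have Da: "D a = D c / n" by (simp add: D_def a_def sum_divide_distrib)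
    have le1: "cmod (P a r) \<le> 1" if "r \<in> orthant" for r
      using up[OF that] npos by (simp add: Pp pa norm_divide)
    have "sup_norm (P a) \<le> 1"
      unfolding sup_norm_def by (rule cSUP_least[OF ne le1])
    \<comment> \<open>This is the lower bound for the norm of the rescaled polynomial, which has to
      be exactly 1.\<close>
    moreover have "sup_norm (P c) \<le> n * sup_norm (P a)"
      unfolding sup_norm_def[of "P c"]
    proof (rule cSUP_least[OF ne])
      fix r :: "real ^ 'n" assume r: "r \<in> orthant"
      have "cmod (P a r) \<le> sup_norm (P a)"
        unfolding sup_norm_def
        by (rule cSUP_upper[OF r bdd_aboveI[of _ 1]]) (use le1 in auto)
      then have "n * cmod (P a r) \<le> n * sup_norm (P a)" using npos by (intro mult_left_mono) auto
      moreover have "n * cmod (P a r) = cmod (P c r)" using npos by (simp add: Pp pa norm_divide)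
      ultimately show "cmod (P c r) \<le> n * sup_norm (P a)" by simp
    qed
    then have "n \<le> n * sup_norm (P a)" by (simp add: n_def)
    ultimately have "sup_norm (P a) = 1" using npos by simp
    with P_in have "ennreal (cmod (\<integral>u. (\<integral>r. P a (r + u) - P a r \<partial>N) \<partial>\<mu>)) \<le> K N \<mu>"
      unfolding K_def by (intro SUP_upper) auto
    then have "ennreal \<bar>D a\<bar> \<le> ennreal k" using k(1) by (simp add: double)
    then have "\<bar>D a\<bar> \<le> k" using k(2) by simp
    then show ?thesis using npos by (simp add: Da field_simps)
  qed
  also have "\<dots> \<le> k * B" using nB k(2) by (rule mult_left_mono)
  finally show ?thesis by (simp add: D_def)
qed

text \<open>Splitting \<open>\<psi>\<^sup>2 e\<^bsup>t\<psi>\<^esup>\<close> as \<open>\<psi> e\<^bsup>t\<psi>/2\<^esup> \<cdot> \<psi> e\<^bsup>t\<psi>/2\<^esup>\<close>: the first factor turns the given exponential polynomial into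
  another one, whose norm is controlled by applying the first order bound to translates.\<close>

lemma abs_generator_sq_exp_poly_le:
  fixes \<psi> :: "real ^ 'n::finite \<Rightarrow> real"
  assumes \<mu>: "levy_representation \<psi> 0 0 \<mu>" and N: "has_laplace_exponent N (\<lambda>z. t / 2 * \<psi> z)"
    and k: "K N \<mu> \<le> ennreal k" "0 \<le> k"
    and s: "\<And>j. j < (m::nat) \<Longrightarrow> s j \<in> neg_orthant"
    and B: "\<And>r. r \<in> orthant \<Longrightarrow> \<bar>\<Sum>j<m. c j * exp (s j \<bullet> r)\<bar> \<le> B"
  shows "\<bar>\<Sum>j<m. c j * (\<psi> (s j))\<^sup>2 * exp (t * \<psi> (s j))\<bar> \<le> k * (k * B)"
proof -
  define c' where "c' j = c j * \<psi> (s j) * exp (t / 2 * \<psi> (s j))" for j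
  have "\<bar>\<Sum>j<m. c' j * exp (s j \<bullet> u)\<bar> \<le> k * B" if u: "u \<in> orthant" for u
  proof -
    have "\<bar>\<Sum>j<m. (c j * exp (s j \<bullet> u)) * \<psi> (s j) * exp (t / 2 * \<psi> (s j))\<bar> \<le> k * B"
    proof (rule abs_generator_exp_poly_le[OF \<mu> N k s])
      fix r :: "real ^ 'n" assume "r \<in> orthant"
      then show "\<bar>\<Sum>j<m. c j * exp (s j \<bullet> u) * exp (s j \<bullet> r)\<bar> \<le> B"
        using B[OF orthant_add[OF u]] by (simp add: inner_add_right exp_add mult.assoc)
    qed
    then show ?thesis by (simp add: c'_def mult_ac)
  qed
  from abs_generator_exp_poly_le[OF \<mu> N k s this]
  have "\<bar>\<Sum>j<m. c' j * \<psi> (s j) * exp (t / 2 * \<psi> (s j))\<bar> \<le> k * (k * B)" .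
  also have "(\<Sum>j<m. c' j * \<psi> (s j) * exp (t / 2 * \<psi> (s j))) = (\<Sum>j<m. c j * (\<psi> (s j))\<^sup>2 * exp (t * \<psi> (s j)))"
  proof (rule sum.cong[OF refl])
    fix j
    have "exp (t * \<psi> (s j)) = exp (t / 2 * \<psi> (s j)) * exp (t / 2 * \<psi> (s j))"
      by (simp add: exp_add[symmetric])
    then show "c' j * \<psi> (s j) * exp (t / 2 * \<psi> (s j)) = c j * (\<psi> (s j))\<^sup>2 * exp (t * \<psi> (s j))"
      by (simp add: c'_def power2_eq_square mult_ac)
  qed
  finally show ?thesis .
qed

text \<open>The mean value theorem for the scalar function \<Phi>, applied once for the increment
  and once more to \<open>\<Phi>'\<close> for the quotients. Intermediate times exceed
  \<open>t\<close>, so the bounds \<open>C / \<tau>\<close> may be replaced by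
  \<open>C / t\<close>.\<close>

lemma (in subordination) exp_poly_increments:
  assumes \<mu>: "levy_representation \<psi> 0 0 \<mu>" and C: "0 \<le> C"
    and Kle: "\<forall>t>0. t < \<delta> \<longrightarrow> K (\<nu> t) \<mu> \<le> ennreal (C / t)"
    and p: "p \<in> real_exp_polys neg_orthant" "\<And>u. u \<in> orthant \<Longrightarrow> \<bar>p u\<bar> \<le> B" and t: "0 < t"
  shows "0 < h \<Longrightarrow> t + h < \<delta> \<Longrightarrow> \<bar>(\<integral>u. p u \<partial>\<nu> (t + h)) - (\<integral>u. p u \<partial>\<nu> t)\<bar> \<le> h * (C / t) * B"
    and "0 < h \<Longrightarrow> t + h < \<delta> \<Longrightarrow> 0 < h' \<Longrightarrow> t + h' < \<delta> \<Longrightarrow>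
      \<bar>((\<integral>u. p u \<partial>\<nu> (t + h)) - (\<integral>u. p u \<partial>\<nu> t)) / h - ((\<integral>u. p u \<partial>\<nu> (t + h')) - (\<integral>u. p u \<partial>\<nu> t)) / h'\<bar>
        \<le> (h + h') * (2 * C / t)\<^sup>2 * B"
proof -
  obtain m c s where s: "\<forall>j<m::nat. s j \<in> neg_orthant" and peq: "p = (\<lambda>r. \<Sum>j<m. c j * exp (s j \<bullet> r))"
    using p(1) by (rule real_exp_polysE)
  note s = s[rule_format]
  have B0: "0 \<le> B" using p(2)[OF zero_in_orthant] by linarith
  have pB: "\<bar>\<Sum>j<m. c j * exp (s j \<bullet> r)\<bar> \<le> B" if "r \<in> orthant" for r
    using p(2)[OF that] by (simp add: peq)
  define \<Phi> where "\<Phi> \<tau> = (\<Sum>j<m. c j * exp (\<tau> * \<psi> (s j)))" for \<tau>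
  define \<Phi>' where "\<Phi>' \<tau> = (\<Sum>j<m. c j * \<psi> (s j) * exp (\<tau> * \<psi> (s j)))" for \<tau>
  define \<Phi>'' where "\<Phi>'' \<tau> = (\<Sum>j<m. c j * (\<psi> (s j))\<^sup>2 * exp (\<tau> * \<psi> (s j)))" for \<tau>
  have int: "(\<integral>u. p u \<partial>\<nu> \<tau>) = \<Phi> \<tau>" if "0 \<le> \<tau>" for \<tau>
    unfolding peq \<Phi>_def using s by (intro integral_exp_poly_laplace[OF laplace[OF that]]) auto
  have d1: "(\<Phi> has_real_derivative \<Phi>' \<tau>) (at \<tau>)" for \<tau>
    unfolding \<Phi>_def \<Phi>'_def by (auto intro!: derivative_eq_intros sum.cong simp: mult_ac)
  have d2: "(\<Phi>' has_real_derivative \<Phi>'' \<tau>) (at \<tau>)" for \<tau>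
    unfolding \<Phi>'_def \<Phi>''_def by (auto intro!: derivative_eq_intros sum.cong simp: mult_ac power2_eq_square)
  have b1: "\<bar>\<Phi>' \<tau>\<bar> \<le> C / t * B" if \<tau>: "t \<le> \<tau>" "\<tau> < \<delta>" for \<tau>
  proof -
    have "0 < \<tau>" using \<tau> t by simp
    then have "\<bar>\<Phi>' \<tau>\<bar> \<le> C / \<tau> * B"
      unfolding \<Phi>'_def using \<tau> C pB s
      by (intro abs_generator_exp_poly_le[OF \<mu> laplace Kle[rule_format]]) auto
    also have "\<dots> \<le> C / t * B" using C \<tau> t B0 by (intro mult_right_mono divide_left_mono) auto
    finally show ?thesis .
  qed
  have b2: "\<bar>\<Phi>'' \<tau>\<bar> \<le> (2 * C / t)\<^sup>2 * B" if \<tau>: "t \<le> \<tau>" "\<tau> < \<delta>" for \<tau>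
  proof -
    have pos: "0 < \<tau>" using \<tau> t by simp
    \<comment> \<open>\<open>K\<close> is used at time \<open>\<tau> / 2\<close>, which is again
      below \<delta>; this is the source of the factor 2 in \<open>2 * C / t\<close>.\<close>
    have "\<bar>\<Phi>'' \<tau>\<bar> \<le> C / (\<tau> / 2) * (C / (\<tau> / 2) * B)"
      unfolding \<Phi>''_def using pos \<tau> C pB s
      by (intro abs_generator_sq_exp_poly_le[OF \<mu> laplace Kle[rule_format]]) auto
    also have "\<dots> = (2 * C / \<tau>)\<^sup>2 * B" by (simp add: power2_eq_square mult_ac)
    also have "\<dots> \<le> (2 * C / t)\<^sup>2 * B"
      using C \<tau> t B0 by (intro mult_right_mono power_mono divide_left_mono) auto
    finally show ?thesis .
  qed
  have mvt: "\<exists>\<xi>. t < \<xi> \<and> \<xi> < t + h \<and> \<Phi> (t + h) - \<Phi> t = h * \<Phi>' \<xi>" if "0 < h" for h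
    using MVT2[of t "t + h" \<Phi> \<Phi>'] d1 that by auto
  show "\<bar>(\<integral>u. p u \<partial>\<nu> (t + h)) - (\<integral>u. p u \<partial>\<nu> t)\<bar> \<le> h * (C / t) * B" if h: "0 < h" "t + h < \<delta>"
  proof -
    obtain \<xi> where \<xi>: "t < \<xi>" "\<xi> < t + h" "\<Phi> (t + h) - \<Phi> t = h * \<Phi>' \<xi>" using mvt[OF h(1)] by blast
    have "\<bar>\<Phi> (t + h) - \<Phi> t\<bar> = h * \<bar>\<Phi>' \<xi>\<bar>" using \<xi>(3) h by (simp add: abs_mult)
    also have "\<dots> \<le> h * (C / t * B)" using b1[of \<xi>] \<xi> h by (intro mult_left_mono) auto
    finally show ?thesis using h t by (simp add: int mult.assoc)
  qed
  \<comment> \<open>Comparing each quotient with \<open>\<Phi>' t\<close> yields the sum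
    \<open>h + h'\<close> in the final bound.\<close>
  have quot: "\<bar>((\<integral>u. p u \<partial>\<nu> (t + h)) - (\<integral>u. p u \<partial>\<nu> t)) / h - \<Phi>' t\<bar> \<le> h * (2 * C / t)\<^sup>2 * B"
    if h: "0 < h" "t + h < \<delta>" for h
  proof -
    obtain \<xi> where \<xi>: "t < \<xi>" "\<xi> < t + h" "\<Phi> (t + h) - \<Phi> t = h * \<Phi>' \<xi>" using mvt[OF h(1)] by blast
    obtain \<eta> where \<eta>: "t < \<eta>" "\<eta> < \<xi>" "\<Phi>' \<xi> - \<Phi>' t = (\<xi> - t) * \<Phi>'' \<eta>"
      using MVT2[of t \<xi> \<Phi>' \<Phi>''] d2 \<xi>(1) by auto
    have "((\<integral>u. p u \<partial>\<nu> (t + h)) - (\<integral>u. p u \<partial>\<nu> t)) / h = \<Phi>' \<xi>" using \<xi>(3) h t by (simp add: int)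
    then have "\<bar>((\<integral>u. p u \<partial>\<nu> (t + h)) - (\<integral>u. p u \<partial>\<nu> t)) / h - \<Phi>' t\<bar> = (\<xi> - t) * \<bar>\<Phi>'' \<eta>\<bar>"
      using \<eta>(3) \<xi>(1) by (simp add: abs_mult)
    also have "\<dots> \<le> h * ((2 * C / t)\<^sup>2 * B)"
      using b2[of \<eta>] \<eta> \<xi> h by (intro mult_mono) auto
    finally show ?thesis by (simp add: mult.assoc)
  qed
  show "\<bar>((\<integral>u. p u \<partial>\<nu> (t + h)) - (\<integral>u. p u \<partial>\<nu> t)) / h - ((\<integral>u. p u \<partial>\<nu> (t + h')) - (\<integral>u. p u \<partial>\<nu> t)) / h'\<bar>
        \<le> (h + h') * (2 * C / t)\<^sup>2 * B"
    if h: "0 < h" "t + h < \<delta>" "0 < h'" "t + h' < \<delta>"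
    using quot[OF h(1,2)] quot[OF h(3,4)] by (simp add: distrib_right abs_le_iff)
qed

section \<open>From exponential polynomials to the generator\<close>

text \<open>Along \<open>H n\<close>, a sequence tending to 0, the values are Cauchy. Letting
  \<open>h'\<close> run through it in the hypothesis leaves
  \<open>norm (D h - y) \<le> h * A\<close>, which gives the limit along all
  \<open>h\<close>.\<close>

lemma tendsto_at_right_zero_if_lipschitz_Cauchy:
  fixes D :: "real \<Rightarrow> 'x::banach"
  assumes d: "0 < d" and A: "0 \<le> A"
    and le: "\<And>h h'. 0 < h \<Longrightarrow> h < d \<Longrightarrow> 0 < h' \<Longrightarrow> h' < d \<Longrightarrow> norm (D h - D h') \<le> (h + h') * A"
  shows "\<exists>y. (D \<longlongrightarrow> y) (at_right 0)"
proof -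
  define H where "H n = d / 2 * inverse (real (Suc n))" for n
  have H: "0 < H n" "H n < d" for n
  proof -
    show "0 < H n" using d by (simp add: H_def)
    have "inverse (real (Suc n)) \<le> 1" by (simp add: inverse_le_1_iff)
    then have "H n \<le> d / 2 * 1" unfolding H_def using d by (intro mult_left_mono) auto
    then show "H n < d" using d by simp
  qed
  have "(\<lambda>n. d / 2 * inverse (real (Suc n))) \<longlonglongrightarrow> d / 2 * 0"
    by (intro tendsto_mult tendsto_const LIMSEQ_inverse_real_of_nat)
  then have H0: "H \<longlonglongrightarrow> 0" by (simp add: H_def[abs_def])
  have "Cauchy (\<lambda>n. D (H n))"
  proof (rule metric_CauchyI)
    fix \<epsilon> :: real assume "0 < \<epsilon>"
    then have "0 < \<epsilon> / (2 * (A + 1))" using A by simp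
    with H0 have "\<forall>\<^sub>F n in sequentially. H n < \<epsilon> / (2 * (A + 1))" by (rule order_tendstoD(2))
    then obtain n0 where n0: "\<And>n. n \<ge> n0 \<Longrightarrow> H n < \<epsilon> / (2 * (A + 1))"
      by (auto simp: eventually_sequentially)
    have "dist (D (H k)) (D (H l)) < \<epsilon>" if "k \<ge> n0" "l \<ge> n0" for k l
    proof -
      have "norm (D (H k) - D (H l)) \<le> (H k + H l) * A" using H by (intro le)
      also have "\<dots> \<le> (H k + H l) * (A + 1)"
        using H(1)[of k] H(1)[of l] by (intro mult_left_mono) auto
      also have "\<dots> < (\<epsilon> / (2 * (A + 1)) + \<epsilon> / (2 * (A + 1))) * (A + 1)"
        using n0[OF that(1)] n0[OF that(2)] A by (intro mult_strict_right_mono add_strict_mono) auto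
      also have "\<dots> = \<epsilon>"
      proof -
        have eq: "(\<epsilon> / (2 * b) + \<epsilon> / (2 * b)) * b = \<epsilon>" if "b \<noteq> 0" for b
          using that by (simp add: field_simps)
        show ?thesis by (rule eq) (use A in simp)
      qed
      finally show ?thesis by (simp add: dist_norm)
    qed
    then show "\<exists>n0. \<forall>k\<ge>n0. \<forall>l\<ge>n0. dist (D (H k)) (D (H l)) < \<epsilon>" by blast
  qed
  then obtain y where y: "(\<lambda>n. D (H n)) \<longlonglongrightarrow> y" using Cauchy_convergent_iff convergent_def by blast
  have close: "norm (D h - y) \<le> h * A" if h: "0 < h" "h < d" for h
  proof (rule LIMSEQ_le)
    show "(\<lambda>n. norm (D h - D (H n))) \<longlonglongrightarrow> norm (D h - y)" by (intro tendsto_intros y)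
    have "(\<lambda>n. (h + H n) * A) \<longlonglongrightarrow> (h + 0) * A" by (intro tendsto_intros H0)
    then show "(\<lambda>n. (h + H n) * A) \<longlonglongrightarrow> h * A" by simp
    show "\<exists>n0. \<forall>n\<ge>n0. norm (D h - D (H n)) \<le> (h + H n) * A" using le[OF h H] by blast
  qed
  have "\<forall>\<^sub>F h in at_right 0. h \<in> {0<..<d}"
    using d by (intro eventually_at_rightI[of 0 d]) auto
  then have ev: "\<forall>\<^sub>F h in at_right 0. norm (D h - y) \<le> h * A"
    by (rule eventually_mono) (simp add: close)
  have "((\<lambda>h. h * A) \<longlongrightarrow> 0 * A) (at_right 0)" by (intro tendsto_intros)
  then have lim: "((\<lambda>h. h * A) \<longlongrightarrow> 0) (at_right (0::real))" by simp
  have "((\<lambda>h. D h - y) \<longlongrightarrow> 0) (at_right 0)" by (rule Lim_null_comparison[OF ev lim])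
  then have "(D \<longlongrightarrow> y) (at_right 0)" by (simp add: Lim_null[symmetric])
  then show ?thesis ..
qed

text \<open>The scalar bounds for increments and for differences of quotients are total variation
  bounds, hence hold for the orbit with \<open>M * norm x\<close> in place of the sup norm. The
  latter gives the limit, the former its size.\<close>

lemma (in subordination) generator_at_g:
  assumes \<mu>: "levy_representation \<psi> 0 0 \<mu>" and C: "0 \<le> C"
    and Kle: "\<forall>t>0. t < \<delta> \<longrightarrow> K (\<nu> t) \<mu> \<le> ennreal (C / t)"
    and t: "0 < t" "t < \<delta>"
  shows "\<exists>y. (g t x, y) \<in> generator g \<and> norm y \<le> C / t * (M * norm x)"
proof -
  define D where "D h = (g (t + h) x - g t x) /\<^sub>R h" for h
  note incr = exp_poly_increments[OF \<mu> C Kle]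
  have Tb: "norm (T u x) \<le> M * norm x" if "u \<in> orthant" for u using T_bound[OF that] .
  have Mx: "0 \<le> M * norm x" using M_pos by simp
  have lip: "norm (D h - D h') \<le> (h + h') * ((2 * C / t)\<^sup>2 * (M * norm x))"
    if h: "0 < h" "h < \<delta> - t" "0 < h'" "h' < \<delta> - t" for h h'
  proof -
    define \<tau> where "\<tau> j = (if j = 0 then t else if j = 1 then t + h else t + h')" for j :: nat
    \<comment> \<open>\<open>D h - D h'\<close> is a combination of values at three times;
      \<open>g t x\<close> enters both quotients, so its weights \<open>- 1 / h\<close> and
      \<open>1 / h'\<close> are merged.\<close>
    define a where "a j = (if j = 0 then 1 / h' - 1 / h else if j = 1 then 1 / h else - 1 / h')" for j :: nat
    have J: "{..<3} = {0, 1, 2 :: nat}" by auto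
    have \<tau>0: "0 \<le> \<tau> j" for j using t h by (simp add: \<tau>_def)
    have "norm (\<Sum>j<3. a j *\<^sub>R g (\<tau> j) x) \<le> ((h + h') * (2 * C / t)\<^sup>2) * (M * norm x)"
    proof (rule norm_sum_bochner_le_of_exp_poly_bound[where N = "\<lambda>j. \<nu> (\<tau> j)", OF _ _ _ _ _ T_continuous Tb])
      fix p :: "real ^ 'n \<Rightarrow> real" and B assume p: "p \<in> real_exp_polys neg_orthant" "\<And>u. u \<in> orthant \<Longrightarrow> \<bar>p u\<bar> \<le> B"
      have "(\<Sum>j<3. a j * (\<integral>u. p u \<partial>\<nu> (\<tau> j))) = ((\<integral>u. p u \<partial>\<nu> (t + h)) - (\<integral>u. p u \<partial>\<nu> t)) / h -
          ((\<integral>u. p u \<partial>\<nu> (t + h')) - (\<integral>u. p u \<partial>\<nu> t)) / h'"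
        by (simp add: J a_def \<tau>_def diff_divide_distrib left_diff_distrib)
      then show "\<bar>\<Sum>j<3. a j * (\<integral>u. p u \<partial>\<nu> (\<tau> j))\<bar> \<le> (h + h') * (2 * C / t)\<^sup>2 * B"
        using incr(2)[OF p t(1), of h h'] h by simp
    next
      show "0 \<le> (h + h') * (2 * C / t)\<^sup>2" using h by simp
    qed (use \<tau>0 \<nu>_orthant \<nu>_finite has_bochner_g in auto)
    moreover have "(\<Sum>j<3. a j *\<^sub>R g (\<tau> j) x) = D h - D h'"
      by (simp add: J a_def \<tau>_def D_def scaleR_diff_right scaleR_diff_left inverse_eq_divide)
    ultimately show ?thesis by (simp add: mult.assoc)
  qed
  have "\<exists>y. (D \<longlongrightarrow> y) (at_right 0)"
  proof (rule tendsto_at_right_zero_if_lipschitz_Cauchy)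
    show "0 < \<delta> - t" using t by simp
    show "0 \<le> (2 * C / t)\<^sup>2 * (M * norm x)" using Mx by simp
  qed (rule lip)
  then obtain y where y: "(D \<longlongrightarrow> y) (at_right 0)" ..
  have bound: "norm (D h) \<le> C / t * (M * norm x)" if h: "0 < h" "h < \<delta> - t" for h
  proof -
    \<comment> \<open>The estimate is made for the increment \<open>h *\<^sub>R D h\<close> and
      \<open>h\<close> is divided out at the end.\<close>
    define \<tau> where "\<tau> j = (if j = 0 then t else t + h)" for j :: nat
    define a where "a j = (if j = 0 then - 1 else 1 :: real)" for j :: nat
    have J: "{..<2} = {0, 1 :: nat}" by auto
    have \<tau>0: "0 \<le> \<tau> j" for j using t h by (simp add: \<tau>_def)
    have "norm (\<Sum>j<2. a j *\<^sub>R g (\<tau> j) x) \<le> (h * (C / t)) * (M * norm x)"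
    proof (rule norm_sum_bochner_le_of_exp_poly_bound[where N = "\<lambda>j. \<nu> (\<tau> j)", OF _ _ _ _ _ T_continuous Tb])
      fix p :: "real ^ 'n \<Rightarrow> real" and B assume p: "p \<in> real_exp_polys neg_orthant" "\<And>u. u \<in> orthant \<Longrightarrow> \<bar>p u\<bar> \<le> B"
      have "(\<Sum>j<2. a j * (\<integral>u. p u \<partial>\<nu> (\<tau> j))) = (\<integral>u. p u \<partial>\<nu> (t + h)) - (\<integral>u. p u \<partial>\<nu> t)"
        by (simp add: J a_def \<tau>_def)
      then show "\<bar>\<Sum>j<2. a j * (\<integral>u. p u \<partial>\<nu> (\<tau> j))\<bar> \<le> h * (C / t) * B"
        using incr(1)[OF p t(1), of h] h by simp
    next
      show "0 \<le> h * (C / t)" using h C t by simp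
    qed (use \<tau>0 \<nu>_orthant \<nu>_finite has_bochner_g in auto)
    moreover have "(\<Sum>j<2. a j *\<^sub>R g (\<tau> j) x) = h *\<^sub>R D h"
      using h by (simp add: J a_def \<tau>_def D_def)
    ultimately have "h * norm (D h) \<le> h * (C / t * (M * norm x))" using h by simp
    then show ?thesis by (rule mult_left_le_imp_le) (rule h(1))
  qed
  have ev: "\<forall>\<^sub>F h in at_right 0. h \<in> {0<..<\<delta> - t}"
    using t by (intro eventually_at_rightI[of 0 "\<delta> - t"]) auto
  have "norm y \<le> C / t * (M * norm x)"
  proof (rule tendsto_upperbound[OF tendsto_norm[OF y]])
    show "\<forall>\<^sub>F h in at_right 0. norm (D h) \<le> C / t * (M * norm x)"
      using ev by (rule eventually_mono) (rule bound; simp)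
  qed simp
  moreover have "((\<lambda>h. (g h (g t x) - g t x) /\<^sub>R h) \<longlongrightarrow> y) (at_right 0)"
  proof (rule Lim_transform_eventually[OF y])
    show "\<forall>\<^sub>F h in at_right 0. D h = (g h (g t x) - g t x) /\<^sub>R h"
      using ev
    proof (rule eventually_mono)
      fix h assume "h \<in> {0<..<\<delta> - t}"
      then show "D h = (g h (g t x) - g t x) /\<^sub>R h"
        using g_add[of h t x] t by (simp add: D_def add.commute)
    qed
  qed
  ultimately show ?thesis by (auto simp: generator_def)
qed

text \<open>The domain inclusion is needed at all positive times, the norm bound only near 0. The
  bound \<open>C / t * M\<close> for the operator norm makes the product with \<open>t\<close> the
  constant \<open>C * M\<close>.\<close>

lemma (in subordination) condition_Y_g:
  assumes \<mu>: "levy_representation \<psi> 0 0 \<mu>"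
    and lim: "Limsup (at_right 0) (\<lambda>t. ennreal t * K (\<nu> t) \<mu>) < \<infinity>"
  shows "condition_Y g"
proof -
  obtain l where l: "0 \<le> l" "Limsup (at_right 0) (\<lambda>t. ennreal t * K (\<nu> t) \<mu>) = ennreal l"
    using lim by (cases "Limsup (at_right 0) (\<lambda>t. ennreal t * K (\<nu> t) \<mu>)") auto
  \<comment> \<open>Room above the limit superior: a strict inequality then holds on a whole right
    neighbourhood of 0.\<close>
  define C where "C = l + 1"
  have C: "0 \<le> C" using l by (simp add: C_def)
  have "Limsup (at_right 0) (\<lambda>t. ennreal t * K (\<nu> t) \<mu>) < ennreal C"
    using l by (simp add: C_def ennreal_lessI)
  then have "\<forall>\<^sub>F t in at_right 0. ennreal t * K (\<nu> t) \<mu> < ennreal C" by (rule Limsup_lessD)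
  then obtain \<delta> where \<delta>: "0 < \<delta>" "\<And>t. 0 < t \<Longrightarrow> t < \<delta> \<Longrightarrow> ennreal t * K (\<nu> t) \<mu> < ennreal C"
    unfolding eventually_at_right_field by auto
  have "K (\<nu> t) \<mu> \<le> ennreal (C / t)" if t: "0 < t" "t < \<delta>" for t
  proof -
    have "ennreal t * K (\<nu> t) \<mu> < ennreal C" by (rule \<delta>(2)[OF t])
    then show ?thesis
    proof (cases "K (\<nu> t) \<mu>")
      case (real r)
      then have "ennreal (t * r) < ennreal C" using \<open>ennreal t * K (\<nu> t) \<mu> < ennreal C\<close> t
        by (simp add: ennreal_mult)
      then have "t * r \<le> C" using ennreal_less_iff[of "t * r" C] real(1) t by simp
      then show ?thesis using real t C by (simp add: field_simps)
    next
      case top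
      then show ?thesis using \<open>ennreal t * K (\<nu> t) \<mu> < ennreal C\<close> t by (simp add: ennreal_mult_top)
    qed
  qed
  then have "\<forall>t>0. t < \<delta> \<longrightarrow> K (\<nu> t) \<mu> \<le> ennreal (C / t)" by blast
  note gen = generator_at_g[OF \<mu> C this]
  have domain: "g t x \<in> Domain (generator g)" if t: "0 < t" for t x
  proof (cases "t < \<delta>")
    case True
    then show ?thesis using gen[OF t True] by blast
  next
    case False
    \<comment> \<open>Large times are reached by applying the last stretch
      \<open>\<delta> / 2\<close>, which already maps every vector into the domain.\<close>
    then have "g t x = g (\<delta> / 2) (g (t - \<delta> / 2) x)"
      using g_add[of "\<delta> / 2" "t - \<delta> / 2" x] \<delta>(1) by simp
    moreover have "\<exists>y. (g (\<delta> / 2) (g (t - \<delta> / 2) x), y) \<in> generator g"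
      using gen[of "\<delta> / 2" "g (t - \<delta> / 2) x"] \<delta>(1) by auto
    ultimately show ?thesis by (simp add: Domain_iff)
  qed
  have op: "ennreal t * op_norm (\<lambda>x. op_apply (generator g) (g t x)) \<le> ennreal (C * M)"
    if t: "0 < t" "t < \<delta>" for t
  proof -
    have "op_norm (\<lambda>x. op_apply (generator g) (g t x)) \<le> ennreal (C / t * M)"
      unfolding op_norm_def
    proof (rule SUP_least, rule ennreal_leI)
      fix x :: 'x assume "x \<in> {x. norm x \<le> 1}"
      then have x: "norm x \<le> 1" by simp
      obtain y where y: "(g t x, y) \<in> generator g" "norm y \<le> C / t * (M * norm x)"
        using gen[OF t] by blast
      \<comment> \<open>The graph is single-valued by uniqueness of limits, so the description in
        \<open>op_apply\<close> picks the vector just bounded.\<close>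
      have "op_apply (generator g) (g t x) = y"
        unfolding op_apply_def
      proof (rule the_equality, rule y(1))
        fix z assume "(g t x, z) \<in> generator g"
        with y(1) show "z = y"
          unfolding generator_def by (auto intro: tendsto_unique[OF trivial_limit_at_right_real])
      qed
      moreover have "C / t * (M * norm x) \<le> C / t * (M * 1)"
        using C t M_pos x by (intro mult_left_mono) auto
      ultimately show "norm (op_apply (generator g) (g t x)) \<le> C / t * M" using y(2) by simp
    qed
    then have "ennreal t * op_norm (\<lambda>x. op_apply (generator g) (g t x)) \<le> ennreal t * ennreal (C / t * M)"
      by (rule mult_left_mono) simp
    also have "\<dots> = ennreal (C * M)" using t C M_pos by (simp add: ennreal_mult[symmetric])
    finally show ?thesis .
  qed
  have "\<forall>\<^sub>F t in at_right 0. ennreal t * op_norm (\<lambda>x. op_apply (generator g) (g t x)) \<le> ennreal (C * M)"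
    using op \<delta>(1) by (auto simp: eventually_at_right_field)
  then have "Limsup (at_right 0) (\<lambda>t. ennreal t * op_norm (\<lambda>x. op_apply (generator g) (g t x))) \<le> ennreal (C * M)"
    by (rule Limsup_bounded)
  then have "Limsup (at_right 0) (\<lambda>t. ennreal t * op_norm (\<lambda>x. op_apply (generator g) (g t x))) < \<infinity>"
    using order_le_less_trans ennreal_less_top by fastforce
  then show ?thesis unfolding condition_Y_def using domain by blast
qed

theorem theorem5p3:
  fixes \<psi> :: "real ^ 'n::finite \<Rightarrow> real"
    and \<mu> :: "(real ^ 'n) measure"
    and \<nu> :: "real \<Rightarrow> (real ^ 'n) measure"
  assumes "\<psi> \<in> class_T0"
    and "levy_representation \<psi> 0 0 \<mu>"
    and "convolution_semigroup_of \<psi> \<nu>"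
    and "Limsup (at_right 0) (\<lambda>t. ennreal t * K (\<nu> t) \<mu>) < \<infinity>"
    and "weakly_differentiable \<nu>"
  shows "\<psi> \<in> class_TY TYPE('x::complex_banach)"
proof -
  have "generates (calculus \<psi> A) (subordinate_semigroup \<psi> A) \<and>
      quasibounded_holomorphic (subordinate_semigroup \<psi> A)"
    if A: "commuting_generators A" for A :: "'n \<Rightarrow> ('x \<times> 'x) set"
  proof -
    obtain M where M: "orthant_semigroup (joint_semigroup A) M"
      using orthant_semigroup_joint_semigroup[OF A] by blast
    interpret orthant_semigroup "joint_semigroup A" M by (rule M)
    interpret subordination "joint_semigroup A" M \<psi> \<nu> "subordinate_semigroup \<psi> A"
    proof
      show "convolution_semigroup_of \<psi> \<nu>" by (rule assms(3))
      fix t :: real and x assume "0 \<le> t"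
      then have "has_laplace_exponent (\<nu> t) (\<lambda>z. t * \<psi> z)"
        using assms(3) by (simp add: convolution_semigroup_of_def)
      \<comment> \<open>\<open>subordinate_semigroup\<close> integrates against the measure
        described by its Laplace exponent; uniqueness identifies that measure with
        \<open>\<nu> t\<close>.\<close>
      from conv_semigroup_eq[OF this]
      show "bochner_integral (\<nu> t) (\<lambda>u. joint_semigroup A u x) = subordinate_semigroup \<psi> A t x"
        by (simp add: subordinate_semigroup_def)
    qed
    show ?thesis
      unfolding generates_def calculus_def quasibounded_holomorphic_def
      using bounded_C0_semigroup_g condition_Y_g[OF assms(2,4)] by simp
  qed
  with assms(1) show ?thesis unfolding class_TY_def by simp
qed

end
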